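(* Let $G=\mathrm{USp}(4)$ and $H=\mathrm{SU}(2)\times\mathrm{SU}(2)$ embedded block-diagonally in $G$. For $g\in G$ with eigenvalues $e^{\pm i\theta_1},e^{\pm i\theta_2}$ let $s_1(g)=\mathrm{tr}(g)=2\cos\theta_1+2\cos\theta_2$, and set $\varepsilon=s_1+4$ and $\rho=\varepsilon/(8-\varepsilon)$. Let $\mu_G(\varepsilon)$, $\mu_H(\varepsilon)$ be the push-forwards of the normalized Haar measures on $G$, $H$ under $\varepsilon$. Then in a neighborhood of $\varepsilon=0$ (i.e. for sufficiently small $\varepsilon>0$), $$\mu_G(\varepsilon)=\frac{\varepsilon^4(8-\varepsilon)}{512\pi}\left(1-\frac{\rho^2}{8}\sum_{n=0}^{\infty}\frac{C_nC_{n+2}}{16^n}\rho^{2n}\right)d\varepsilon,$$ and $$\mu_H(\varepsilon)=\frac{\varepsilon^2(8-\varepsilon)}{64\pi}\left(1-\frac{\rho^2}{8}\sum_{n=0}^{\infty}\frac{C_nC_{n+1}}{16^n}\rho^{2n}\right)d\varepsilon,$$ where $C_n=\frac{1}{n+1}\binom{2n}{n}$ denotes the $n$-th Catalan number.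
   Context: $\mathrm{USp}(4)$ is the compact unitary symplectic group of $4\times4$ matrices, whose elements have eigenvalues $e^{\pm i\theta_1},e^{\pm i\theta_2}$, $\theta_j\in[0,\pi]$; $\mathrm{SU}(2)=\mathrm{USp}(2)$, and the trace of $(g_1,g_2)\in H$ is $\mathrm{tr}(g_1)+\mathrm{tr}(g_2)$. Haar measures are normalized to total mass $1$. *)

theory Defs
  imports "HOL-Probability.Probability"
begin

definition adjoint_mat :: "complex^'n^'n \<Rightarrow> complex^'n^'n" where
  "adjoint_mat U = (\<chi> i j. cnj (U $ j $ i))"

definition unitary_mat :: "complex^'n^'n \<Rightarrow> bool" where
  "unitary_mat U \<longleftrightarrow> adjoint_mat U ** U = mat 1"

text \<open>Standard symplectic form on C^4, block diagonal J2 (+) J2 with J2 = [[0,1],[-1,0]].\<close>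
definition J4 :: "complex^4^4" where
  "J4 = (\<chi> i j. if i = 0 \<and> j = 1 then 1 else if i = 1 \<and> j = 0 then -1
              else if i = 2 \<and> j = 3 then 1 else if i = 3 \<and> j = 2 then -1 else 0)"

definition USp4 :: "(complex^4^4) set" where
  "USp4 = {U. unitary_mat U \<and> transpose U ** J4 ** U = J4}"

definition SU2 :: "(complex^2^2) set" where
  "SU2 = {U. unitary_mat U \<and> det U = 1}"

definition blk1 :: "4 \<Rightarrow> bool" where
  "blk1 i \<longleftrightarrow> i = 0 \<or> i = 1"

definition idx2 :: "4 \<Rightarrow> 2" where
  "idx2 i = (if i = 0 \<or> i = 2 then 0 else 1)"

definition block_embed :: "complex^2^2 \<Rightarrow> complex^2^2 \<Rightarrow> complex^4^4" where
  "block_embed g1 g2 = (\<chi> i j.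
      if blk1 i \<and> blk1 j then g1 $ idx2 i $ idx2 j
      else if \<not> blk1 i \<and> \<not> blk1 j then g2 $ idx2 i $ idx2 j else 0)"

definition Hgrp :: "(complex^4^4) set" where
  "Hgrp = (\<lambda>(g1, g2). block_embed g1 g2) ` (SU2 \<times> SU2)"

definition haar :: "(complex^4^4) set \<Rightarrow> (complex^4^4) measure" where
  "haar S = (THE \<mu>. sets \<mu> = sets borel \<and> prob_space \<mu> \<and> emeasure \<mu> S = 1
                   \<and> (\<forall>g\<in>S. distr \<mu> borel (\<lambda>x. g ** x) = \<mu>))"

text \<open>epsilon = s_1 + 4 = tr + 4 (the trace is real on these groups).\<close>
definition eps_fun :: "complex^4^4 \<Rightarrow> real" where
  "eps_fun U = Re (trace U) + 4"

definition mu_G :: "real measure" where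
  "mu_G = distr (haar USp4) borel eps_fun"

definition mu_H :: "real measure" where
  "mu_H = distr (haar Hgrp) borel eps_fun"

definition catalan :: "nat \<Rightarrow> real" where
  "catalan n = real (2 * n choose n) / real (n + 1)"

definition rho :: "real \<Rightarrow> real" where
  "rho e = e / (8 - e)"

definition dens_G :: "real \<Rightarrow> real" where
  "dens_G e = e ^ 4 * (8 - e) / (512 * pi) *
     (1 - (rho e)\<^sup>2 / 8 * (\<Sum>n. catalan n * catalan (n + 2) / 16 ^ n * (rho e) ^ (2 * n)))"

definition dens_H :: "real \<Rightarrow> real" where
  "dens_H e = e ^ 2 * (8 - e) / (64 * pi) *
     (1 - (rho e)\<^sup>2 / 8 * (\<Sum>n. catalan n * catalan (n + 1) / 16 ^ n * (rho e) ^ (2 * n)))"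

end

theory Submission
  imports Defs
begin

text \<open>Left-invariant probability measures are unique, so both Haar measures can be replaced by explicit
  ones. With \<open>y\<close> uniform in the unit ball of \<open>\<complex>\<^sup>2\<close>, the unit quaternion \<open>q(y) = y / |y|\<close> is a Haar random
  element of \<open>SU(2)\<close>. For \<open>x\<close> uniform in the unit ball of \<open>\<complex>\<^sup>4\<close> let \<open>g(x)\<close> be a symplectic unitary matrix
  with first column \<open>x / |x|\<close>. Then \<open>g(x) diag(1, q(y))\<close> is Haar distributed on \<open>USp(4)\<close>, because
  \<open>h g(x) = g(h x) diag(1, k)\<close> with \<open>k \<in> SU(2)\<close>.

  Choosing \<open>g(x)\<close> with lower right block \<open>r = |(x\<^sub>0, x\<^sub>1)| / |x|\<close> shows that the trace on \<open>USp(4)\<close> is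
  distributed as \<open>r\<close> times the trace on \<open>SU(2) \<times> SU(2)\<close>, where \<open>r\<close> is independent with density
  \<open>12 r\<^sup>3 (1 - r\<^sup>2)\<close>. The trace on \<open>SU(2)\<close> has a semicircle law, and the convolution of two of these is the
  elliptic integral of \<open>sqrt ((1 - t\<^sup>2) (1 - \<rho>\<^sup>2 t\<^sup>2))\<close>, whose expansion in \<open>\<rho>\<close> is the Catalan series of the
  second formula. The Catalan series of the first formula satisfies a hypergeometric equation, from which
  an explicit antiderivative for the average over \<open>r\<close> is obtained.\<close>

section \<open>Isometries and the uniform measure on the unit ball\<close>

text \<open>The average over r is never evaluated as an integral of a series. With
  \<open>x = 4 - e\<close> and \<open>y = x / r\<close> it says that
  \<open>dens_G (4 - x) / x ^ 3\<close> is the integral of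
  \<open>12 * (y ^ 2 - x ^ 2) / y ^ 6 * dens_H (4 - y)\<close> for y from x to 4. Applying (1/x)
  d/dx and then d/dx to such an integral leaves \<open>24 / x ^ 6 * dens_H (4 - x)\<close>, and both
  intermediate functions vanish at x = 4. It is therefore enough to check these two derivatives and
  the two boundary values for the closed form. The second derivative of the Catalan series that
  turns up is removed by the hypergeometric equation, and what remains is recognised as the second
  Catalan series by a relation between neighbouring hypergeometric functions. The bound e < 4 marks
  the range in which rho stays below 1. There the supports of the two semicircle factors overlap in
  an interval of length e / 2, which is what produces the elliptic integral.\<close>

lemma unit_ball_vol_of_nat_nonzero [simp]: "unit_ball_vol (real n) \<noteq> 0"
  using unit_ball_vol_pos[OF of_nat_0_le_iff, of n] by linarith

text \<open>The image measure is translation invariant and gives balls their Lebesgue volume.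
  Integrating 1_A(x) 1_B(x + y) over both measures in both orders, with A the unit ball, yields v
  times each measure of B, so the measures agree. No determinant enters, and domain and codomain may
  be different types of equal dimension, which later allows coordinates to be regrouped into
  products.\<close>

lemma lborel_distr_isometry:
  fixes T :: "'a::euclidean_space \<Rightarrow> 'b::euclidean_space"
  assumes lin: "linear T" and nrm: "\<And>x. norm (T x) = norm x" and dim: "DIM('a) = DIM('b)"
  shows "distr lborel borel T = lborel"
proof -
  define \<mu> where "\<mu> = distr lborel borel T"
  have inj: "inj T"
    using lin nrm by (metis linear_injective_0 norm_eq_zero)
  have surj: "surj T"
  proof -
    have "dim (range T) = DIM('b)"
      using dim_image_eq[OF lin, of UNIV] inj dim by (simp add: dim_UNIV)
    then have "span (range T) = UNIV" by (simp add: dim_eq_full)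
    then show ?thesis
      using lin by (metis linear_span_image span_UNIV)
  qed
  have [measurable]: "T \<in> borel_measurable borel"
    using lin by (intro borel_measurable_continuous_onI linear_continuous_on linear_linear[THEN iffD2])
      (simp add: linear_conv_bounded_linear)
  have sets[simp, measurable_cong]: "sets \<mu> = sets borel" by (simp add: \<mu>_def)
  have [simp]: "space \<mu> = UNIV" by (simp add: \<mu>_def)
  have shift: "distr \<mu> borel (\<lambda>x. b + x) = \<mu>" for b
  proof -
    obtain a where a: "b = T a" using surj by auto
    have "distr \<mu> borel (\<lambda>x. b + x) = distr lborel borel (\<lambda>x. T (a + x))"
      unfolding \<mu>_def by (subst distr_distr) (auto simp: o_def a linear_add[OF lin])
    also have "\<dots> = distr (distr lborel borel (\<lambda>x. a + x)) borel T"
      by (subst distr_distr) (auto simp: o_def)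
    also have "\<dots> = \<mu>" by (simp add: lborel_distr_plus \<mu>_def)
    finally show ?thesis .
  qed
  define v where "v = emeasure (lborel :: 'b measure) (cball 0 1)"
  have v: "v > 0" "v < \<infinity>"
    by (auto simp: v_def emeasure_cball)
  have ball: "emeasure \<mu> (cball 0 r) = emeasure (lborel :: 'b measure) (cball 0 r)" if "r \<ge> 0" for r
  proof -
    have "T -` cball 0 r = cball 0 r" by (auto simp: nrm)
    then show ?thesis using that unfolding \<mu>_def
      by (simp add: emeasure_distr emeasure_cball dim)
  qed
  interpret \<mu>: sigma_finite_measure \<mu>
  proof
    show "\<exists>A. countable A \<and> A \<subseteq> sets \<mu> \<and> \<Union> A = space \<mu> \<and> (\<forall>a\<in>A. emeasure \<mu> a \<noteq> \<infinity>)"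
      by (intro exI[of _ "range (\<lambda>n::nat. cball 0 (real n))"])
        (auto simp: ball emeasure_cball real_arch_simple)
  qed
  interpret pair_sigma_finite \<mu> "lborel :: 'b measure" ..
  have "emeasure lborel B = emeasure \<mu> B" if [measurable]: "B \<in> sets borel" for B :: "'b set"
  proof -
    let ?A = "cball 0 1 :: 'b set"
    have [measurable]: "?A \<in> sets borel" by simp
    have shift': "(\<integral>\<^sup>+x. f x \<partial>\<mu>) = (\<integral>\<^sup>+x. f (b + x) \<partial>\<mu>)"
      if [measurable]: "f \<in> borel_measurable borel" for f :: "'b \<Rightarrow> ennreal" and b
      by (subst shift[of b, symmetric], subst nn_integral_distr) auto
    have shiftl: "emeasure lborel {y. x + y \<in> B} = emeasure lborel B" for x
    proof -
      have "emeasure lborel B = emeasure (distr lborel borel ((+) x)) B"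
        by (simp add: lborel_distr_plus)
      also have "\<dots> = emeasure lborel {y. x + y \<in> B}"
        by (subst emeasure_distr) (auto intro!: arg_cong[where f="emeasure lborel"])
      finally show ?thesis ..
    qed
    have "(\<integral>\<^sup>+y. (\<integral>\<^sup>+x. indicator ?A x * indicator B (x + y) \<partial>\<mu>) \<partial>lborel) =
          (\<integral>\<^sup>+x. (\<integral>\<^sup>+y. indicator ?A x * indicator B (x + y) \<partial>lborel) \<partial>\<mu>)"
      by (rule Fubini') measurable
    also have "\<dots> = (\<integral>\<^sup>+x. indicator ?A x * emeasure lborel B \<partial>\<mu>)"
    proof (intro nn_integral_cong)
      fix x
      have "(\<integral>\<^sup>+y. indicator ?A x * indicator B (x + y) \<partial>lborel) =
            (\<integral>\<^sup>+y. indicator ?A x * indicator {y. x + y \<in> B} y \<partial>lborel)"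
        by (intro nn_integral_cong) (auto simp: indicator_def)
      then show "(\<integral>\<^sup>+y. indicator ?A x * indicator B (x + y) \<partial>lborel) = indicator ?A x * emeasure lborel B"
        by (simp add: nn_integral_cmult shiftl)
    qed
    also have "\<dots> = v * emeasure lborel B"
      by (simp add: nn_integral_multc ball v_def)
    finally have 1: "(\<integral>\<^sup>+y. (\<integral>\<^sup>+x. indicator ?A x * indicator B (x + y) \<partial>\<mu>) \<partial>lborel) = v * emeasure lborel B" .
    have "(\<integral>\<^sup>+y. (\<integral>\<^sup>+x. indicator ?A x * indicator B (x + y) \<partial>\<mu>) \<partial>lborel) =
          (\<integral>\<^sup>+y. (\<integral>\<^sup>+x. indicator ?A (x - y) * indicator B x \<partial>\<mu>) \<partial>lborel)"
    proof (rule nn_integral_cong)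
      fix y
      show "(\<integral>\<^sup>+x. indicator ?A x * indicator B (x + y) \<partial>\<mu>) = (\<integral>\<^sup>+x. indicator ?A (x - y) * indicator B x \<partial>\<mu>)"
        by (subst shift'[where b="-y" and f="\<lambda>x. indicator ?A x * indicator B (x + y)"]) (simp_all add: algebra_simps)
    qed
    also have "\<dots> = (\<integral>\<^sup>+x. (\<integral>\<^sup>+y. indicator ?A (x - y) * indicator B x \<partial>lborel) \<partial>\<mu>)"
      by (rule Fubini') measurable
    also have "\<dots> = (\<integral>\<^sup>+x. v * indicator B x \<partial>\<mu>)"
    proof (intro nn_integral_cong)
      fix x
      have "(\<integral>\<^sup>+y. indicator ?A (x - y) * indicator B x \<partial>lborel) =
            (\<integral>\<^sup>+y. indicator (cball x 1) y * indicator B x \<partial>lborel)"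
        by (intro nn_integral_cong) (auto simp: indicator_def dist_norm norm_minus_commute)
      also have "\<dots> = v * indicator B x"
        by (subst nn_integral_multc) (auto simp: v_def emeasure_cball intro: borel_measurable_indicator)
      finally show "(\<integral>\<^sup>+y. indicator ?A (x - y) * indicator B x \<partial>lborel) = v * indicator B x" .
    qed
    also have "\<dots> = v * emeasure \<mu> B" by (simp add: nn_integral_cmult)
    finally have "v * emeasure lborel B = v * emeasure \<mu> B" using 1 by simp
    then show ?thesis using v by (auto simp: ennreal_mult_cancel_left)
  qed
  then show ?thesis unfolding \<mu>_def[symmetric] by (intro measure_eqI) auto
qed

text \<open>Only the direction x / |x| of a sample matters for the matrices built later. Taking the
  solid ball in place of the sphere keeps everything within Lebesgue measure, so that no surface
  measure is needed.\<close>

definition ball_measure :: "'a::euclidean_space measure" where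
  "ball_measure = uniform_measure lborel (ball 0 1)"

lemma emeasure_unit_ball_bounds:
  "emeasure lborel (ball (0::'a::euclidean_space) 1) \<noteq> 0" "emeasure lborel (ball (0::'a::euclidean_space) 1) \<noteq> \<infinity>"
  by (auto simp: emeasure_ball)

lemma sets_ball_measure [simp, measurable_cong]: "sets ball_measure = sets borel"
  and space_ball_measure [simp]: "space ball_measure = UNIV"
  by (auto simp: ball_measure_def)

lemma prob_space_ball_measure: "prob_space (ball_measure :: 'a::euclidean_space measure)"
  unfolding ball_measure_def
  by (rule prob_space_uniform_measure) (use emeasure_unit_ball_bounds in auto)

lemma AE_ball_measure_nonzero: "AE x in (ball_measure :: 'a::euclidean_space measure). x \<noteq> 0"
  unfolding ball_measure_def
  by (rule AE_uniform_measureI) (auto intro: AE_mp[OF AE_lborel_singleton[of 0]])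

lemma ball_measure_isometry:
  fixes T :: "'a::euclidean_space \<Rightarrow> 'b::euclidean_space"
  assumes lin: "linear T" and nrm: "\<And>x. norm (T x) = norm x" and dim: "DIM('a) = DIM('b)"
  shows "distr ball_measure borel T = ball_measure"
proof (rule measure_eqI)
  have [measurable]: "T \<in> borel_measurable borel"
    using lin by (intro borel_measurable_continuous_onI linear_continuous_on)
      (simp add: linear_conv_bounded_linear)
  fix A assume "A \<in> sets (distr ball_measure borel T)"
  then have [measurable]: "A \<in> sets borel" by simp
  have "emeasure lborel (ball 0 1 \<inter> T -` A) = emeasure lborel (T -` (ball 0 1 \<inter> A))"
    by (rule arg_cong[where f="emeasure lborel"]) (auto simp: nrm)
  also have "\<dots> = emeasure (distr lborel borel T) (ball 0 1 \<inter> A)"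
    by (subst emeasure_distr) auto
  also have "\<dots> = emeasure lborel (ball 0 1 \<inter> A)"
    by (simp add: lborel_distr_isometry[OF assms])
  finally show "emeasure (distr ball_measure borel T) A = emeasure ball_measure A"
    using measurable_sets[of T borel borel A]
    by (simp add: emeasure_distr ball_measure_def emeasure_ball dim)
qed simp

text \<open>By scaling of volume the norm is below t with probability t^m, where m is the dimension.
  Both sides are compared on the half-lines, an intersection-stable generator;
  \<open>min 1 (max 0 x)\<close> covers thresholds outside the unit interval.\<close>

lemma distr_ball_measure_norm:
  "distr (ball_measure :: 'a::euclidean_space measure) borel norm =
    density lborel (\<lambda>r. ennreal (DIM('a) * r ^ (DIM('a) - 1)) * indicator {0..1} r)" (is "?L = ?R")
proof -
  let ?m = "DIM('a)"
  have R: "emeasure ?R {..<x} = ennreal (min 1 (max 0 x) ^ ?m)" for x :: real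
  proof -
    let ?y = "min 1 (max 0 x)"
    have "emeasure ?R {..<x} = (\<integral>\<^sup>+r. ennreal (?m * r ^ (?m - 1)) * indicator {0..?y} r \<partial>lborel)"
      by (subst emeasure_density, simp, simp, intro nn_integral_cong_AE)
       (use AE_lborel_singleton[of x] AE_lborel_singleton[of 0] in eventually_elim, auto simp: indicator_def min_def max_def split: if_splits)
    also have "\<dots> = ennreal (?y ^ ?m - 0 ^ ?m)"
      by (rule nn_integral_FTC_Icc) (auto intro!: derivative_eq_intros)
    finally show ?thesis by simp
  qed
  have L: "emeasure ?L {..<x} = ennreal (min 1 (max 0 x) ^ ?m)" for x :: real
  proof -
    have "emeasure ?L {..<x} = emeasure lborel (ball 0 1 \<inter> ball (0::'a) x) / emeasure lborel (ball (0::'a) 1)"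
      by (subst emeasure_distr) (auto simp: ball_measure_def ball_def vimage_def dist_norm
          intro!: arg_cong2[where f="(/)"] arg_cong[where f="emeasure lborel"])
    also have "ball 0 1 \<inter> ball (0::'a) x = ball 0 (min 1 (max 0 x))"
      by (cases "x \<le> 0") (simp_all add: max_def ball_empty set_eq_iff)
    finally show ?thesis
      by (simp add: emeasure_ball divide_ennreal)
  qed
  show ?thesis
  proof (rule measure_eqI_generator_eq[where E="range lessThan" and \<Omega>=UNIV and A="\<lambda>n. {..<real n}"])
    show "Int_stable (range lessThan :: real set set)"
      by (auto simp: Int_stable_def image_iff intro: exI[of _ "min _ _"])
    show "sets ?L = sigma_sets UNIV (range lessThan)"
      by (simp add: borel_Iio)
    show "sets ?R = sigma_sets UNIV (range lessThan)"
      by (simp add: borel_Iio)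
    show "(\<Union>i. {..<real i}) = UNIV"
      using reals_Archimedean2 by auto
  qed (auto simp: L R simp del: One_nat_def)
qed

text \<open>Polar coordinates for functions of the norm, read off from the law of the norm; the
  factor \<open>unit_ball_vol\<close> undoes the normalisation of
  \<open>ball_measure\<close>.\<close>

lemma nn_integral_radial_ball:
  fixes F :: "real \<Rightarrow> ennreal"
  assumes [measurable]: "F \<in> borel_measurable borel"
  shows "(\<integral>\<^sup>+a. F (norm a) * indicator (ball 0 1) a \<partial>(lborel :: 'a::euclidean_space measure)) =
     ennreal (unit_ball_vol DIM('a)) * (\<integral>\<^sup>+r. F r * (ennreal (DIM('a) * r ^ (DIM('a) - 1)) * indicator {0..1} r) \<partial>lborel)"
proof -
  let ?v = "ennreal (unit_ball_vol DIM('a))"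
  have v: "?v \<noteq> 0" "?v \<noteq> \<top>" by auto
  have "(\<integral>\<^sup>+a. F (norm a) * indicator (ball 0 1) a \<partial>(lborel :: 'a measure)) / ?v = (\<integral>\<^sup>+a. F (norm (a::'a)) \<partial>ball_measure)"
    unfolding ball_measure_def by (subst nn_integral_uniform_measure) (auto simp: emeasure_ball)
  also have "\<dots> = (\<integral>\<^sup>+r. F r \<partial>distr (ball_measure :: 'a measure) borel norm)"
    by (subst nn_integral_distr) auto
  also have "\<dots> = (\<integral>\<^sup>+r. F r * (ennreal (DIM('a) * r ^ (DIM('a) - 1)) * indicator {0..1} r) \<partial>lborel)"
    unfolding distr_ball_measure_norm by (subst nn_integral_density) (auto simp: mult_ac)
  finally have eq: "(\<integral>\<^sup>+a. F (norm a) * indicator (ball 0 1) a \<partial>(lborel :: 'a measure)) / ?v =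
      (\<integral>\<^sup>+r. F r * (ennreal (DIM('a) * r ^ (DIM('a) - 1)) * indicator {0..1} r) \<partial>lborel)" .
  show ?thesis
    unfolding eq[symmetric] ennreal_times_divide mult.commute[of ?v] using v
    by (rule mult_divide_eq_ennreal[symmetric])
qed

section \<open>The law of a norm ratio in a product space\<close>

text \<open>The \<open>if\<close> expression is the radius of a slice of the cone
  \<open>v * norm x < norm (fst x)\<close> inside the unit ball: for r up to v the cone is the
  binding constraint, beyond v the ball is. The two pieces produce boundary terms \<open>?B\<close>
  of opposite sign, which cancel.\<close>

lemma has_integral_polar_aux:
  fixes m n :: nat and v :: real
  assumes "m \<ge> 1" "n \<ge> 2" "0 \<le> v" "v < 1"
  defines "J \<equiv> integral {v..1} (\<lambda>z. z ^ (m - 1) * sqrt (1 - z\<^sup>2) ^ (n - 2))"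
  shows "((\<lambda>r. r ^ (m - 1) * (if r \<le> v then r * sqrt (1 - v\<^sup>2) / v else sqrt (1 - r\<^sup>2)) ^ n)
           has_integral (n / (m + n) * J)) {0..1}"
proof -
  let ?h = "\<lambda>r. (if r \<le> v then r * sqrt (1 - v\<^sup>2) / v else sqrt (1 - r\<^sup>2))"
  let ?B = "v ^ m * sqrt (1 - v\<^sup>2) ^ n / (m + n)"
  obtain m' where m: "m = Suc m'" using assms(1) by (cases m) auto
  obtain n' where n: "n = Suc (Suc n')" using assms(2) by (metis Suc_le_D numeral_2_eq_2 Suc_le_mono)
  have J: "((\<lambda>z. z ^ (m - 1) * sqrt (1 - z\<^sup>2) ^ (n - 2)) has_integral J) {v..1}"
    unfolding J_def by (intro integrable_integral integrable_continuous_real continuous_intros)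
  define c where "c = (sqrt (1 - v\<^sup>2) / v) ^ n"
  have "((\<lambda>r. c * r ^ (m' + n)) has_integral
       (c * (v ^ Suc (m' + n) / Suc (m' + n)) - c * (0 ^ Suc (m' + n) / Suc (m' + n)))) {0..v}"
  proof (rule fundamental_theorem_of_calculus[OF assms(3)])
    fix x assume "x \<in> {0..v}"
    have "((\<lambda>r. r ^ Suc (m' + n) / Suc (m' + n)) has_real_derivative x ^ (m' + n)) (at x within {0..v})"
      by (rule DERIV_cdivide[THEN DERIV_cong], rule DERIV_power[OF DERIV_ident]) (simp del: of_nat_Suc)
    from DERIV_cmult[OF this, of c]
    show "((\<lambda>r. c * (r ^ Suc (m' + n) / Suc (m' + n))) has_vector_derivative c * x ^ (m' + n)) (at x within {0..v})"
      unfolding has_real_derivative_iff_has_vector_derivative .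
  qed
  also have "c * (v ^ Suc (m' + n) / Suc (m' + n)) - c * (0 ^ Suc (m' + n) / Suc (m' + n)) = ?B"
    using m n unfolding c_def by (cases "v = 0") (simp_all add: power_divide power_add)
  finally have I1: "((\<lambda>r. r ^ (m - 1) * ?h r ^ n) has_integral ?B) {0..v}"
    by (rule has_integral_eq[rotated]) (auto simp: c_def m power_divide power_mult_distrib power_add)
  \<comment> \<open>The antiderivative \<open>r ^ m * sqrt (1 - r^2) ^ n / (m + n)\<close> lowers
    the exponent n to n - 2: in its derivative, r^(m+1) is replaced by r^(m-1) (1 - y^2), where y is
    the square root.\<close>
  have "((\<lambda>r. r ^ (m - 1) * sqrt (1 - r\<^sup>2) ^ n - n / (m + n) * (r ^ (m - 1) * sqrt (1 - r\<^sup>2) ^ (n - 2))) has_integral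
          (1 ^ m * sqrt (1 - 1\<^sup>2) ^ n / (m + n) - ?B)) {v..1}"
  proof (rule fundamental_theorem_of_calculus_interior)
    show "continuous_on {v..1} (\<lambda>r. r ^ m * sqrt (1 - r\<^sup>2) ^ n / (m + n))"
      using assms by (intro continuous_intros) auto
    fix x assume x: "x \<in> {v<..<1}"
    then have x2: "x\<^sup>2 < 1" using assms by (simp add: power_less_one_iff abs_square_less_1)
    define y where "y = sqrt (1 - x\<^sup>2)"
    have y: "y > 0" "y * y = 1 - x * x" using x2 by (auto simp: y_def power2_eq_square)
    have dy: "((\<lambda>r. sqrt (1 - r\<^sup>2)) has_real_derivative (- x / y)) (at x)"
      using x2 unfolding y_def by (auto intro!: derivative_eq_intros simp: field_simps)
    have eq: "(real m * (1 * x ^ (m - Suc 0)) * y ^ n + real n * ((- x / y) * y ^ (n - Suc 0)) * x ^ m) / (m + n) =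
        x ^ (m - 1) * y ^ n - n / (m + n) * (x ^ (m - 1) * y ^ (n - 2))"
    proof -
      have "real m * (1 * x ^ (m - Suc 0)) * y ^ n + real n * ((- x / y) * y ^ (n - Suc 0)) * x ^ m =
          x ^ m' * y ^ n' * (real m * (y * y) - real n * (x * x))"
        using y(1) by (simp add: m n right_diff_distrib mult_ac)
      also have "real m * (y * y) - real n * (x * x) = real (m + n) * (y * y) - real n"
        unfolding y(2) by (simp add: algebra_simps)
      finally show ?thesis
        using m n by (simp add: diff_divide_distrib right_diff_distrib mult_ac del: of_nat_Suc of_nat_add)
    qed
    have "((\<lambda>r. r ^ m * sqrt (1 - r\<^sup>2) ^ n / (m + n)) has_real_derivative
        x ^ (m - 1) * y ^ n - n / (m + n) * (x ^ (m - 1) * y ^ (n - 2))) (at x)"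
      unfolding eq[symmetric] using DERIV_cdivide[OF DERIV_mult[OF DERIV_power[OF DERIV_ident, of m] DERIV_power[OF dy, of n]], of "m + n"]
      unfolding y_def .
    then show "((\<lambda>r. r ^ m * sqrt (1 - r\<^sup>2) ^ n / (m + n)) has_vector_derivative
        x ^ (m - 1) * sqrt (1 - x\<^sup>2) ^ n - n / (m + n) * (x ^ (m - 1) * sqrt (1 - x\<^sup>2) ^ (n - 2))) (at x)"
      unfolding has_real_derivative_iff_has_vector_derivative[symmetric] y_def .
  qed (use assms in auto)
  from has_integral_add[OF this has_integral_mult_right[OF J, of "n / (m + n)"]]
  have I2': "((\<lambda>r. r ^ (m - 1) * sqrt (1 - r\<^sup>2) ^ n) has_integral (n / (m + n) * J - ?B)) {v..1}"
    using n by (simp add: mult.assoc)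
  \<comment> \<open>At r = v the other branch of \<open>?h\<close> is in force, and for v = 0 its
    value differs; a single point may be ignored.\<close>
  have I2: "((\<lambda>r. r ^ (m - 1) * ?h r ^ n) has_integral (n / (m + n) * J - ?B)) {v..1}"
  proof (rule has_integral_spike_finite[OF _ _ I2', of "{v}"])
  qed auto
  have "((\<lambda>r. r ^ (m - 1) * ?h r ^ n) has_integral (?B + (n / (m + n) * J - ?B))) {0..1}"
    by (rule has_integral_combine[OF _ _ I1 I2]) (use assms in auto)
  then show ?thesis by simp
qed

lemma less_iff_power2_less:
  fixes x y :: real
  assumes "0 \<le> x" "0 \<le> y"
  shows "x < y \<longleftrightarrow> x\<^sup>2 < y\<^sup>2"
  using assms by (meson power2_less_imp_less power_strict_mono zero_less_numeral)

text \<open>Slicing along the first component turns the cone into balls whose radius depends only on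
  the norm of that component, so the volume becomes a one-dimensional integral. The result is
  written as an integral over \<open>{max 0 w..1}\<close> so that a density can be read off from
  it.\<close>

lemma emeasure_polar_cone:
  fixes w :: real
  defines "m \<equiv> DIM('a::euclidean_space)" and "n \<equiv> DIM('b::euclidean_space)"
  assumes n: "DIM('b) \<ge> 2" and w: "w < 1"
  shows "emeasure lborel {x :: 'a \<times> 'b. norm x < 1 \<and> w * norm x < norm (fst x)} =
    (\<integral>\<^sup>+z. ennreal (unit_ball_vol m * unit_ball_vol n * m * n / (m + n) * (z ^ (m - 1) * sqrt (1 - z\<^sup>2) ^ (n - 2))) *
       indicator {max 0 w..1} z \<partial>lborel)"
proof -
  let ?X = "{x :: 'a \<times> 'b. norm x < 1 \<and> w * norm x < norm (fst x)}"
  define v where "v = max 0 w"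
  have v: "0 \<le> v" "v < 1" using w by (auto simp: v_def)
  define h where "h r = (if r \<le> v then r * sqrt (1 - v\<^sup>2) / v else sqrt (1 - r\<^sup>2))" for r
  have h_nonneg: "h r \<ge> 0" if "0 \<le> r" "r \<le> 1" for r
    using that v by (auto simp: h_def power_le_one)
  have [measurable]: "h \<in> borel_measurable borel" unfolding h_def by measurable
  have m1: "m \<ge> 1" unfolding m_def by (simp add: Suc_le_eq)
  have n2: "n \<ge> 2" using n by (simp add: n_def)
  have [measurable]: "?X \<in> sets (borel \<Otimes>\<^sub>M borel)"
    unfolding borel_prod
    by (intro borel_open open_Collect_conj open_Collect_less continuous_intros)
  have "emeasure lborel ?X = (\<integral>\<^sup>+a. emeasure (lborel :: 'b measure) (Pair a -` ?X) \<partial>(lborel :: 'a measure))"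
    unfolding lborel_prod[symmetric]
    by (subst lborel.emeasure_pair_measure_alt) simp_all
  also have "\<dots> = (\<integral>\<^sup>+a. ennreal (unit_ball_vol n * h (norm a) ^ n) * indicator (ball 0 1) a \<partial>(lborel :: 'a measure))"
  \<comment> \<open>The slice over a = 0 has to be left out: for negative w it is a punctured ball,
    while the radius \<open>h 0\<close> is 0.\<close>
  proof (rule nn_integral_cong_AE, use AE_lborel_singleton[of "0::'a"] in eventually_elim)
    fix a :: 'a assume a: "a \<noteq> 0"
    show "emeasure lborel (Pair a -` ?X) = ennreal (unit_ball_vol n * h (norm a) ^ n) * indicator (ball 0 1) a"
    proof (cases "norm a < 1")
      case True
      define A where "A = norm a"
      have A: "0 < A" "A < 1" using True a by (auto simp: A_def)
      have A2: "A\<^sup>2 < 1" using A by (simp add: abs_square_less_1)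
      have v2: "v\<^sup>2 < 1" using v by (simp add: abs_square_less_1)
      have "(norm (a, c) < 1 \<and> w * norm (a, c) < A) \<longleftrightarrow> norm c < h A" for c :: 'b
      proof -
        define C where "C = norm c"
        have C: "C \<ge> 0" by (simp add: C_def)
        have nrm: "norm (a, c) = sqrt (A\<^sup>2 + C\<^sup>2)" by (simp add: norm_Pair A_def C_def)
        have 1: "norm (a, c) < 1 \<longleftrightarrow> C\<^sup>2 < 1 - A\<^sup>2"
          unfolding nrm by auto
        have "w * norm (a, c) < A \<longleftrightarrow> v * norm (a, c) < A"
          using A by (cases "w \<ge> 0") (auto simp: v_def max_def not_le intro: order_le_less_trans[OF mult_nonpos_nonneg])
        also have "\<dots> \<longleftrightarrow> (v * norm (a, c))\<^sup>2 < A\<^sup>2"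
          using A v by (intro less_iff_power2_less) auto
        also have "\<dots> \<longleftrightarrow> v\<^sup>2 * C\<^sup>2 < A\<^sup>2 * (1 - v\<^sup>2)"
          unfolding nrm by (auto simp: power_mult_distrib algebra_simps)
        finally have 2: "w * norm (a, c) < A \<longleftrightarrow> v\<^sup>2 * C\<^sup>2 < A\<^sup>2 * (1 - v\<^sup>2)" .
        have "C < h A \<longleftrightarrow> C\<^sup>2 < (h A)\<^sup>2"
          using C h_nonneg[of A] A by (intro less_iff_power2_less) auto
        also have "\<dots> \<longleftrightarrow> norm (a, c) < 1 \<and> w * norm (a, c) < A"
        \<comment> \<open>One constraint always implies the other: for A at most v the cone
          condition forces the point into the ball, for A above v the ball condition forces it into
          the cone.\<close>
        proof (cases "A \<le> v")
          case True
          then have vp: "v > 0" using A by simp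
          have hh: "(h A)\<^sup>2 = A\<^sup>2 * (1 - v\<^sup>2) / v\<^sup>2"
            using True v2 by (simp add: h_def power_divide power_mult_distrib)
          have eq: "C\<^sup>2 < (h A)\<^sup>2 \<longleftrightarrow> v\<^sup>2 * C\<^sup>2 < A\<^sup>2 * (1 - v\<^sup>2)"
            unfolding hh using vp by (simp add: field_simps)
          have "v\<^sup>2 * C\<^sup>2 < v\<^sup>2 * (1 - A\<^sup>2)" if "v\<^sup>2 * C\<^sup>2 < A\<^sup>2 * (1 - v\<^sup>2)"
          proof -
            have "A\<^sup>2 \<le> v\<^sup>2" using True A by (simp add: power_mono)
            then show ?thesis using that by (simp add: algebra_simps)
          qed
          then show ?thesis unfolding eq 1 2 using vp by auto
        next
          case False
          have hh: "(h A)\<^sup>2 = 1 - A\<^sup>2"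
            using False A2 by (simp add: h_def)
          have "v\<^sup>2 * C\<^sup>2 < A\<^sup>2 * (1 - v\<^sup>2)" if "C\<^sup>2 < 1 - A\<^sup>2"
          proof -
            have "v\<^sup>2 < A\<^sup>2" using False v by (simp add: power_strict_mono)
            moreover have "v\<^sup>2 * C\<^sup>2 \<le> v\<^sup>2 * (1 - A\<^sup>2)" using that by (intro mult_left_mono) auto
            ultimately show ?thesis by (simp add: algebra_simps)
          qed
          then show ?thesis unfolding hh 1 2 by auto
        qed
        finally show ?thesis unfolding C_def by auto
      qed
      then have "Pair a -` ?X = ball 0 (h A)"
        by (auto simp: A_def)
      then show ?thesis using True h_nonneg[of A] A
        by (simp add: emeasure_ball A_def n_def)
    next
      case False
      have "norm a \<le> norm (a, c)" for c :: 'b by (simp add: norm_Pair real_le_rsqrt)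
      then have empty: "Pair a -` ?X = {}" using False by (auto simp: not_less dest: order_trans)
      show ?thesis unfolding empty using False by simp
    qed
  qed
  also have "\<dots> = ennreal (unit_ball_vol m) * (\<integral>\<^sup>+r. ennreal (unit_ball_vol n * h r ^ n) *
        (ennreal (m * r ^ (m - 1)) * indicator {0..1} r) \<partial>lborel)"
    unfolding m_def by (rule nn_integral_radial_ball) measurable
  also have "(\<integral>\<^sup>+r. ennreal (unit_ball_vol n * h r ^ n) *
        (ennreal (m * r ^ (m - 1)) * indicator {0..1} r) \<partial>lborel) =
     (\<integral>\<^sup>+r. ennreal (unit_ball_vol n * m * (r ^ (m - 1) * h r ^ n)) * indicator {0..1} r \<partial>lborel)"
    using h_nonneg by (intro nn_integral_cong) (auto simp: indicator_def ennreal_mult'[symmetric] mult_ac)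
  also have "\<dots> = ennreal (unit_ball_vol n * m * (n / (m + n) * integral {v..1} (\<lambda>z. z ^ (m - 1) * sqrt (1 - z\<^sup>2) ^ (n - 2))))"
    using has_integral_polar_aux[OF m1 n2 v] h_nonneg unfolding h_def[symmetric]
    by (intro nn_integral_has_integral_lebesgue' has_integral_mult_right) auto
  also have "ennreal (unit_ball_vol m) * \<dots> =
      ennreal (unit_ball_vol m * unit_ball_vol n * m * n / (m + n) * integral {v..1} (\<lambda>z. z ^ (m - 1) * sqrt (1 - z\<^sup>2) ^ (n - 2)))"
    by (simp add: ennreal_mult'[symmetric] mult_ac)
  also have "\<dots> = (\<integral>\<^sup>+z. ennreal (unit_ball_vol m * unit_ball_vol n * m * n / (m + n) * (z ^ (m - 1) * sqrt (1 - z\<^sup>2) ^ (n - 2))) *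
       indicator {v..1} z \<partial>lborel)"
    using v by (intro nn_integral_has_integral_lebesgue'[symmetric] has_integral_mult_right integrable_integral
        integrable_continuous_real continuous_intros mult_nonneg_nonneg divide_nonneg_nonneg) (auto simp: power_le_one)
  finally show ?thesis unfolding v_def .
qed

text \<open>The ratio exceeds w exactly on a cone, up to the null point 0, so the upper tails are
  cone volumes divided by the volume of the ball. Splitting dimensions as 1 + 3 gives the constant 4
  / pi of the semicircle, and 4 + 4 gives the 12 in the law of r.\<close>

lemma distr_ball_measure_polar:
  defines "m \<equiv> DIM('a::euclidean_space)" and "n \<equiv> DIM('b::euclidean_space)"
  assumes n: "DIM('b) \<ge> 2"
  shows "distr (ball_measure :: ('a \<times> 'b) measure) borel (\<lambda>x. norm (fst x) / norm x) =
    density lborel (\<lambda>z. ennreal (unit_ball_vol m * unit_ball_vol n * m * n / (m + n) / unit_ball_vol (m + n) *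
       (z ^ (m - 1) * sqrt (1 - z\<^sup>2) ^ (n - 2))) * indicator {0..1} z)" (is "?L = ?R")
proof (rule measure_eqI_lessThan)
  let ?K = "unit_ball_vol m * unit_ball_vol n * m * n / (m + n)"
  have dim: "DIM('a \<times> 'b) = m + n" by (simp add: m_def n_def)
  interpret prob_space "ball_measure :: ('a \<times> 'b) measure" by (rule prob_space_ball_measure)
  have [measurable]: "(\<lambda>x::'a\<times>'b. norm (fst x) / norm x) \<in> borel_measurable borel"
    by (intro borel_measurable_divide borel_measurable_norm borel_measurable_continuous_onI continuous_intros)
  have [measurable]: "{x :: 'a \<times> 'b. w * norm x < norm (fst x)} \<in> sets borel" for w
    by (intro borel_open open_Collect_less continuous_intros)
  interpret L: prob_space ?L by (rule prob_space_distr) simp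
  show "emeasure ?L {x<..} < \<infinity>" for x
    by (simp add: less_top[symmetric])
  show "emeasure ?L {w<..} = emeasure ?R {w<..}" for w
  proof (cases "w < 1")
    case True
    have "emeasure ?L {w<..} = emeasure (ball_measure :: ('a \<times> 'b) measure) {x. w * norm x < norm (fst x)}"
    proof (subst emeasure_distr, simp, simp, rule emeasure_eq_AE)
      show "AE x in ball_measure. x \<in> (\<lambda>x :: 'a \<times> 'b. norm (fst x) / norm x) -` {w<..} \<inter> space ball_measure \<longleftrightarrow>
          x \<in> {x. w * norm x < norm (fst x)}"
        using AE_ball_measure_nonzero[where ?'a="'a \<times> 'b"]
        by eventually_elim (auto simp: field_simps)
    qed measurable
    also have "\<dots> = emeasure lborel {x :: 'a \<times> 'b. norm x < 1 \<and> w * norm x < norm (fst x)} / unit_ball_vol (m + n)"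
      unfolding ball_measure_def
      by (subst emeasure_uniform_measure) (auto simp: emeasure_ball m_def n_def Int_def cong: conj_cong)
    also have "\<dots> = (\<integral>\<^sup>+z. ennreal (?K * (z ^ (m - 1) * sqrt (1 - z\<^sup>2) ^ (n - 2))) *
       indicator {max 0 w..1} z \<partial>lborel) / unit_ball_vol (m + n)"
      unfolding emeasure_polar_cone[OF n True] m_def n_def ..
    also have "\<dots> = (\<integral>\<^sup>+z. ennreal (?K * (z ^ (m - 1) * sqrt (1 - z\<^sup>2) ^ (n - 2))) *
       indicator {max 0 w..1} z / unit_ball_vol (m + n) \<partial>lborel)"
      by (rule nn_integral_divide[symmetric]) measurable
    also have "\<dots> = emeasure ?R {w<..}"
    proof (subst emeasure_density, simp, simp, rule nn_integral_cong_AE,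
        use AE_lborel_singleton[of w] in eventually_elim)
      fix z :: real assume "z \<noteq> w"
      moreover have "ennreal (?K * (z ^ (m - 1) * sqrt (1 - z\<^sup>2) ^ (n - 2))) / unit_ball_vol (m + n) =
          ennreal (?K / unit_ball_vol (m + n) * (z ^ (m - 1) * sqrt (1 - z\<^sup>2) ^ (n - 2)))" if "0 \<le> z" "z \<le> 1"
        using that unit_ball_vol_pos[of "real m + real n"]
        by (subst divide_ennreal) (auto intro!: mult_nonneg_nonneg divide_nonneg_nonneg simp: power_le_one)
      ultimately show "ennreal (?K * (z ^ (m - 1) * sqrt (1 - z\<^sup>2) ^ (n - 2))) * indicator {max 0 w..1} z / unit_ball_vol (m + n) =
          ennreal (?K / unit_ball_vol (m + n) * (z ^ (m - 1) * sqrt (1 - z\<^sup>2) ^ (n - 2))) * indicator {0..1} z * indicator {w<..} z"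
        by (auto simp: indicator_def)
    qed
    finally show ?thesis .
  next
    case False
    have "norm (fst x) / norm x \<le> 1" for x :: "'a \<times> 'b"
      using norm_fst_le[of "fst x" "snd x"] by (cases "norm x = 0") (auto simp: divide_le_eq)
    with False have "\<not> w < norm (fst x) / norm x" for x :: "'a \<times> 'b"
      by (metis not_less order_trans)
    then have "(\<lambda>x::'a\<times>'b. norm (fst x) / norm x) -` {w<..} = {}"
      by auto
    then have "emeasure ?L {w<..} = 0" by (subst emeasure_distr) auto
    moreover have "emeasure ?R {w<..} = 0"
      using False by (subst emeasure_density) (auto intro!: nn_integral_zero' AE_I2 simp: indicator_def)
    ultimately show ?thesis by simp
  qed
qed auto

section \<open>Uniqueness of left-invariant probability measures and the matrix groups\<close>

text \<open>The index types are residue classes and the matrices are indexed from 0, so the numerals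
  2 in type \<open>2\<close> and 4 in type \<open>4\<close> are brought to the form 0.\<close>

lemma numeral_2_eq_0 [simp]: "(2::2) = 0" and numeral_4_eq_0 [simp]: "(4::4) = 0"
  by simp_all

lemma UNIV_4': "(UNIV :: 4 set) = {0, 1, 2, 3}"
  using UNIV_4 by auto

lemma UNIV_2': "(UNIV :: 2 set) = {0, 1}"
  using UNIV_2 by auto

lemma sum_4': "sum f (UNIV :: 4 set) = f 0 + f 1 + f 2 + f 3"
  unfolding UNIV_4' by (simp add: add.assoc)

lemma sum_2': "sum f (UNIV :: 2 set) = f 0 + f 1"
  unfolding UNIV_2' by simp

lemma forall_4': "(\<forall>i::4. P i) \<longleftrightarrow> P 0 \<and> P 1 \<and> P 2 \<and> P 3"
  by (metis UNIV_4' UNIV_I insertE singletonD)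

lemma forall_2': "(\<forall>i::2. P i) \<longleftrightarrow> P 0 \<and> P 1"
  by (metis UNIV_2' UNIV_I insertE singletonD)

lemma index_simps [simp]: "blk1 0" "blk1 1" "\<not> blk1 2" "\<not> blk1 3"
  "idx2 0 = 0" "idx2 1 = 1" "idx2 2 = 0" "idx2 3 = 1"
  by (simp_all add: blk1_def idx2_def)


section \<open>Conjugate transposes and uniqueness of invariant probability measures\<close>

lemma adjoint_mat_nth [simp]: "adjoint_mat U $ i $ j = cnj (U $ j $ i)"
  by (simp add: adjoint_mat_def)

lemma adjoint_mat_adjoint_mat [simp]: "adjoint_mat (adjoint_mat U) = U"
  by (simp add: vec_eq_iff)

lemma adjoint_mat_mult: "adjoint_mat (A ** B) = adjoint_mat B ** adjoint_mat A"
  by (simp add: vec_eq_iff matrix_matrix_mult_def cnj_sum mult.commute)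

lemma borel_measurable_matrix_mult [measurable (raw)]:
  fixes f g :: "'a \<Rightarrow> complex^'n^'n"
  assumes f [measurable]: "f \<in> borel_measurable M" and g [measurable]: "g \<in> borel_measurable M"
  shows "(\<lambda>x. f x ** g x) \<in> borel_measurable M"
proof -
  have "continuous_on UNIV (\<lambda>p :: (complex^'n^'n) \<times> (complex^'n^'n). fst p ** snd p)"
    unfolding matrix_matrix_mult_def by (intro continuous_intros)
  then have "(\<lambda>p. fst p ** snd p) \<in> borel_measurable (borel \<Otimes>\<^sub>M borel :: ((complex^'n^'n) \<times> (complex^'n^'n)) measure)"
    unfolding borel_prod by (rule borel_measurable_continuous_onI)
  from measurable_compose[OF measurable_Pair[OF f g] this] show ?thesis by simp
qed

lemma borel_measurable_adjoint_mat [measurable]: "adjoint_mat \<in> borel_measurable borel"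
  unfolding adjoint_mat_def by (intro borel_measurable_continuous_onI continuous_intros)

text \<open>A left-invariant probability measure \<open>\<mu>\<close> is the image under inversion of any other one \<open>\<nu>\<close>:
  integrate \<open>\<mu> {x. g\<inverse> x \<in> A} = \<mu> A\<close> over \<open>g\<close> and swap the integrals.\<close>

lemma left_invariant_eq_distr_adjoint:
  fixes \<mu> \<nu> :: "(complex^'n^'n) measure"
  assumes adj: "\<And>g. g \<in> S \<Longrightarrow> adjoint_mat g \<in> S"
    and \<mu>: "sets \<mu> = sets borel" "prob_space \<mu>" "emeasure \<mu> S = 1" "\<And>g. g \<in> S \<Longrightarrow> distr \<mu> borel (\<lambda>x. g ** x) = \<mu>"
    and \<nu>: "sets \<nu> = sets borel" "prob_space \<nu>" "emeasure \<nu> S = 1" "\<And>g. g \<in> S \<Longrightarrow> distr \<nu> borel (\<lambda>x. g ** x) = \<nu>"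
  shows "\<mu> = distr \<nu> borel adjoint_mat"
proof (rule measure_eqI)
  interpret M: prob_space \<mu> by fact
  interpret N: prob_space \<nu> by fact
  interpret pair_sigma_finite \<mu> \<nu> ..
  note [measurable_cong] = \<mu>(1) \<nu>(1)
  have [simp]: "space \<mu> = UNIV" "space \<nu> = UNIV"
    using \<mu>(1) \<nu>(1) by (auto dest: sets_eq_imp_space_eq)
  \<comment> \<open>A set outside the sigma-algebra has \<open>emeasure\<close> 0, so the value 1
    already forces measurability.\<close>
  have S [measurable]: "S \<in> sets borel"
    using \<mu>(1,3) emeasure_notin_sets[of S \<mu>] by fastforce
  have AE: "AE x in \<mu>. x \<in> S" "AE x in \<nu>. x \<in> S"
    using \<mu>(3) \<nu>(3) by (auto intro!: M.AE_prob_1 N.AE_prob_1 simp: measure_def)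
  fix A assume "A \<in> sets \<mu>"
  then have [measurable]: "A \<in> sets borel" using \<mu>(1) by simp
  have inv: "(\<integral>\<^sup>+x. f (g ** x) \<partial>\<mu>) = (\<integral>\<^sup>+x. f x \<partial>\<mu>)" "(\<integral>\<^sup>+x. f (g ** x) \<partial>\<nu>) = (\<integral>\<^sup>+x. f x \<partial>\<nu>)"
    if "g \<in> S" and [measurable]: "f \<in> borel_measurable borel" for g and f :: "complex^'n^'n \<Rightarrow> ennreal"
    by (subst (2) \<mu>(4)[OF that(1), symmetric], subst nn_integral_distr; simp)
       (subst (2) \<nu>(4)[OF that(1), symmetric], subst nn_integral_distr; simp)
  have "emeasure \<mu> A = (\<integral>\<^sup>+h. (\<integral>\<^sup>+x. indicator A x \<partial>\<mu>) \<partial>\<nu>)"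
    by (simp add: N.emeasure_space_1[simplified])
  also have "\<dots> = (\<integral>\<^sup>+h. (\<integral>\<^sup>+x. indicator A (adjoint_mat h ** x) \<partial>\<mu>) \<partial>\<nu>)"
    using AE(2) by (intro nn_integral_cong_AE, eventually_elim) (simp add: inv(1) adj)
  also have "\<dots> = (\<integral>\<^sup>+x. (\<integral>\<^sup>+h. indicator A (adjoint_mat h ** x) \<partial>\<nu>) \<partial>\<mu>)"
    by (rule Fubini') measurable
  also have "\<dots> = (\<integral>\<^sup>+x. (\<integral>\<^sup>+h. indicator A (adjoint_mat h) \<partial>\<nu>) \<partial>\<mu>)"
  proof (intro nn_integral_cong_AE, use AE(1) in eventually_elim)
    fix x assume "x \<in> S"
    have "(\<integral>\<^sup>+h. indicator A (adjoint_mat h ** x) \<partial>\<nu>) = (\<integral>\<^sup>+h. indicator A (adjoint_mat (adjoint_mat x ** h)) \<partial>\<nu>)"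
      by (simp add: adjoint_mat_mult)
    also have "\<dots> = (\<integral>\<^sup>+h. indicator A (adjoint_mat h) \<partial>\<nu>)"
      using inv(2)[of "adjoint_mat x" "\<lambda>h. indicator A (adjoint_mat h)"] adj[OF \<open>x \<in> S\<close>] by simp
    finally show "(\<integral>\<^sup>+h. indicator A (adjoint_mat h ** x) \<partial>\<nu>) = (\<integral>\<^sup>+h. indicator A (adjoint_mat h) \<partial>\<nu>)" .
  qed
  also have "\<dots> = (\<integral>\<^sup>+h. indicator A h \<partial>distr \<nu> borel adjoint_mat)"
    by (subst nn_integral_distr) (simp_all add: M.emeasure_space_1[simplified])
  also have "\<dots> = emeasure (distr \<nu> borel adjoint_mat) A" by simp
  finally show "emeasure \<mu> A = emeasure (distr \<nu> borel adjoint_mat) A" .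
qed (simp add: \<mu>)

text \<open>Comparing \<nu> with itself shows that \<nu> is invariant under inversion; comparing any
  other candidate with \<nu> then gives equality. This supplies both existence and uniqueness for
  the \<open>THE\<close> in \<open>haar\<close>.\<close>

lemma haar_eqI:
  assumes adj: "\<And>g. g \<in> S \<Longrightarrow> adjoint_mat g \<in> S"
    and \<nu>: "sets \<nu> = sets borel" "prob_space \<nu>" "emeasure \<nu> S = 1" "\<And>g. g \<in> S \<Longrightarrow> distr \<nu> borel (\<lambda>x. g ** x) = \<nu>"
  shows "haar S = \<nu>"
  unfolding haar_def
proof (rule the_equality)
  fix \<mu> :: "(complex^4^4) measure"
  assume "sets \<mu> = sets borel \<and> prob_space \<mu> \<and> emeasure \<mu> S = 1 \<and> (\<forall>g\<in>S. distr \<mu> borel (\<lambda>x. g ** x) = \<mu>)"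
  then have "\<mu> = distr \<nu> borel adjoint_mat"
    by (intro left_invariant_eq_distr_adjoint[OF adj _ _ _ _ \<nu>]) auto
  also have "\<dots> = \<nu>"
    using left_invariant_eq_distr_adjoint[OF adj \<nu> \<nu>] by simp
  finally show "\<mu> = \<nu>" .
qed (use \<nu> in auto)

section \<open>Unitary matrices as isometries, and measurability of vector-valued maps\<close>

lemma linear_matrix_vector_mult_complex: "linear (\<lambda>x. (A :: complex^'n^'n) *v x)"
proof (rule linearI)
  show "A *v (c *\<^sub>R x) = c *\<^sub>R (A *v x)" for c x
    by (simp add: vec_eq_iff matrix_vector_mult_def scaleR_sum_right)
qed (rule matrix_vector_right_distrib)

lemma norm_vec_power2: "complex_of_real ((norm (x :: complex^'n))\<^sup>2) = (\<Sum>i\<in>UNIV. cnj (x $ i) * x $ i)"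
proof -
  have "(norm x)\<^sup>2 = (\<Sum>i\<in>UNIV. (cmod (x $ i))\<^sup>2)"
    by (simp add: norm_vec_def L2_set_def sum_nonneg)
  then show ?thesis by (simp only: of_real_sum complex_norm_square mult.commute)
qed

lemma norm_unitary_mult:
  fixes x :: "complex^'n"
  assumes "unitary_mat U"
  shows "norm (U *v x) = norm x"
proof -
  have U: "(\<Sum>i\<in>UNIV. cnj (U $ i $ j) * U $ i $ k) = (if j = k then 1 else 0)" for j k
    using assms by (simp add: unitary_mat_def vec_eq_iff matrix_matrix_mult_def mat_def)
  have "complex_of_real ((norm (U *v x))\<^sup>2) =
      (\<Sum>i\<in>UNIV. \<Sum>j\<in>UNIV. \<Sum>k\<in>UNIV. cnj (x $ j) * x $ k * (cnj (U $ i $ j) * U $ i $ k))"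
    unfolding norm_vec_power2 matrix_vector_mult_def vec_lambda_beta cnj_sum sum_product
    by (intro sum.cong refl) (simp add: mult_ac)
  also have "\<dots> = (\<Sum>j\<in>UNIV. \<Sum>i\<in>UNIV. \<Sum>k\<in>UNIV. cnj (x $ j) * x $ k * (cnj (U $ i $ j) * U $ i $ k))"
    by (rule sum.swap)
  also have "\<dots> = (\<Sum>j\<in>UNIV. \<Sum>k\<in>UNIV. \<Sum>i\<in>UNIV. cnj (x $ j) * x $ k * (cnj (U $ i $ j) * U $ i $ k))"
    by (intro sum.cong refl sum.swap)
  also have "\<dots> = complex_of_real ((norm x)\<^sup>2)"
    unfolding sum_distrib_left[symmetric] U norm_vec_power2
    by (simp add: if_distrib[of "(*) _"] cong: if_cong)
  finally have "(norm (U *v x))\<^sup>2 = (norm x)\<^sup>2" unfolding of_real_eq_iff .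
  then show ?thesis by simp
qed

lemma borel_measurable_vecI:
  fixes f :: "'a \<Rightarrow> 'b::euclidean_space^'n"
  assumes [measurable]: "\<And>i. (\<lambda>x. f x $ i) \<in> borel_measurable M"
  shows "f \<in> borel_measurable M"
proof (subst borel_measurable_euclidean_space, intro ballI)
  fix b :: "'b^'n" assume "b \<in> Basis"
  then obtain i u where b: "b = axis i u" by (auto simp: Basis_vec_def)
  show "(\<lambda>x. f x \<bullet> b) \<in> borel_measurable M"
    unfolding b inner_axis by measurable
qed

lemma borel_measurable_vec_nth [measurable (raw)]:
  fixes f :: "'a \<Rightarrow> 'b::euclidean_space^'n"
  assumes "f \<in> borel_measurable M"
  shows "(\<lambda>x. f x $ i) \<in> borel_measurable M"
  using assms by (rule borel_measurable_continuous_on[rotated]) (intro continuous_intros)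

lemma borel_measurable_cnj [measurable (raw)]:
  "f \<in> borel_measurable M \<Longrightarrow> (\<lambda>x. cnj (f x)) \<in> borel_measurable M"
  by (rule borel_measurable_continuous_on[of cnj]) (auto intro: continuous_intros)

lemma borel_measurable_complex_of_real [measurable (raw)]:
  "f \<in> borel_measurable M \<Longrightarrow> (\<lambda>x. complex_of_real (f x)) \<in> borel_measurable M"
  by (rule borel_measurable_continuous_on[of complex_of_real]) (auto intro: continuous_intros)

text \<open>The unit quaternion with first column y / |y|; the second column is then forced. At y =
  0 division by zero yields the zero matrix, which is harmless because that point is null.\<close>

definition su2_of :: "complex^2 \<Rightarrow> complex^2^2" where
  "su2_of y = (\<chi> i j. (if j = 0 then (if i = 0 then y $ 0 else y $ 1)
     else (if i = 0 then - cnj (y $ 1) else cnj (y $ 0))) / of_real (norm y))"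

lemma SU2_entries:
  assumes "g \<in> SU2"
  shows "g $ 1 $ 1 = cnj (g $ 0 $ 0)" "g $ 0 $ 1 = - cnj (g $ 1 $ 0)"
proof -
  have d: "g$0$0 * g$1$1 - g$0$1 * g$1$0 = 1"
    using assms by (simp add: SU2_def det_2 mult.commute)
  have u: "cnj (g$0$0) * g$0$0 + cnj (g$1$0) * g$1$0 = 1" "cnj (g$0$0) * g$0$1 + cnj (g$1$0) * g$1$1 = 0"
    using assms by (auto simp: SU2_def unitary_mat_def vec_eq_iff matrix_matrix_mult_def sum_2' forall_2' mat_def)
  show "g $ 1 $ 1 = cnj (g $ 0 $ 0)" using d u by algebra
  show "g $ 0 $ 1 = - cnj (g $ 1 $ 0)" using d u by algebra
qed

lemma SU2_I:
  assumes "cnj (g$0$0) * g$0$0 + cnj (g$1$0) * g$1$0 = 1" "g $ 1 $ 1 = cnj (g $ 0 $ 0)" "g $ 0 $ 1 = - cnj (g $ 1 $ 0)"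
  shows "g \<in> SU2"
  using assms by (auto simp: SU2_def unitary_mat_def det_2 vec_eq_iff matrix_matrix_mult_def sum_2' forall_2' mat_def algebra_simps)

lemma su2_of_SU2:
  assumes "y \<noteq> 0"
  shows "su2_of y \<in> SU2"
proof (rule SU2_I)
  define n where "n = complex_of_real (norm y)"
  have n: "n \<noteq> 0" "n * n = cnj (y $ 0) * y $ 0 + cnj (y $ 1) * y $ 1"
    using assms norm_vec_power2[of y] by (auto simp: n_def sum_2' power2_eq_square)
  have "cnj (su2_of y$0$0) * su2_of y$0$0 + cnj (su2_of y$1$0) * su2_of y$1$0 =
      (cnj (y $ 0) * y $ 0 + cnj (y $ 1) * y $ 1) / (n * n)"
    by (simp add: su2_of_def n_def add_divide_distrib)
  then show "cnj (su2_of y$0$0) * su2_of y$0$0 + cnj (su2_of y$1$0) * su2_of y$1$0 = 1"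
    using n by auto
qed (simp_all add: su2_of_def)

text \<open>An element of SU(2) is determined by its first column, on which left multiplication acts
  linearly. This equivariance turns rotation invariance of the ball into left invariance on the
  group.\<close>

lemma SU2_mult_su2_of:
  assumes "g \<in> SU2"
  shows "g ** su2_of y = su2_of (g *v y)"
proof -
  have "norm (g *v y) = norm y"
    using assms by (intro norm_unitary_mult) (simp add: SU2_def)
  then show ?thesis
    by (simp add: vec_eq_iff matrix_matrix_mult_def su2_of_def matrix_vector_mult_def sum_2' forall_2'
        SU2_entries[OF assms] add_divide_distrib diff_divide_distrib)
qed

lemma measurable_su2_of [measurable]: "su2_of \<in> borel_measurable borel"
  unfolding su2_of_def
proof (intro borel_measurable_vecI, simp only: vec_lambda_beta)
  fix i j :: 2
  show "(\<lambda>y. (if j = 0 then (if i = 0 then y $ 0 else y $ 1)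
     else (if i = 0 then - cnj (y $ 1) else cnj (y $ 0))) / complex_of_real (norm y)) \<in> borel_measurable borel"
    by (cases "i = 0"; cases "j = 0"; simp)
qed


section \<open>Diagonal blocks, and the two groups as closed sets\<close>

definition qblock :: "complex^4^4 \<Rightarrow> complex^2^2" where
  "qblock U = (\<chi> i j. U $ (if i = 0 then 2 else 3) $ (if j = 0 then 2 else 3))"

definition pblock :: "complex^4^4 \<Rightarrow> complex^2^2" where
  "pblock U = (\<chi> i j. U $ (if i = 0 then 0 else 1) $ (if j = 0 then 0 else 1))"

lemma block_embed_mult: "block_embed a b ** block_embed c d = block_embed (a ** c) (b ** d)"
  by (simp add: vec_eq_iff matrix_matrix_mult_def block_embed_def sum_4' sum_2' forall_4')

lemma block_embed_1: "block_embed (mat 1) (mat 1) = mat 1"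
  by (simp add: vec_eq_iff block_embed_def forall_4' mat_def)

lemma adjoint_block_embed: "adjoint_mat (block_embed a b) = block_embed (adjoint_mat a) (adjoint_mat b)"
  by (simp add: vec_eq_iff block_embed_def forall_4')

lemma pblock_block_embed [simp]: "pblock (block_embed a b) = a"
  and qblock_block_embed [simp]: "qblock (block_embed a b) = b"
  by (simp_all add: vec_eq_iff block_embed_def forall_2' pblock_def qblock_def)

lemma continuous_on_block_embed [continuous_intros]:
  "continuous_on A f \<Longrightarrow> continuous_on A g \<Longrightarrow> continuous_on A (\<lambda>x. block_embed (f x) (g x))"
  unfolding block_embed_def
proof (intro continuous_on_vec_lambda)
  fix i j :: 4
  assume "continuous_on A f" "continuous_on A g"
  then show "continuous_on A (\<lambda>x. if blk1 i \<and> blk1 j then f x $ idx2 i $ idx2 j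
      else if \<not> blk1 i \<and> \<not> blk1 j then g x $ idx2 i $ idx2 j else 0)"
    by (cases "blk1 i"; cases "blk1 j") (auto intro!: continuous_intros)
qed

lemma continuous_on_pblock [continuous_intros]: "continuous_on A f \<Longrightarrow> continuous_on A (\<lambda>x. pblock (f x))"
  and continuous_on_qblock [continuous_intros]: "continuous_on A f \<Longrightarrow> continuous_on A (\<lambda>x. qblock (f x))"
  unfolding pblock_def qblock_def by (intro continuous_intros; assumption)+

lemma borel_measurable_block_embed [measurable (raw)]:
  assumes [measurable]: "f \<in> borel_measurable M" "g \<in> borel_measurable M"
  shows "(\<lambda>x. block_embed (f x) (g x)) \<in> borel_measurable M"
proof (intro borel_measurable_vecI)
  fix i j :: 4
  show "(\<lambda>x. block_embed (f x) (g x) $ i $ j) \<in> borel_measurable M"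
    by (cases "blk1 i"; cases "blk1 j"; simp add: block_embed_def)
qed

lemma closed_SU2: "closed SU2"
  unfolding SU2_def unitary_mat_def adjoint_mat_def matrix_matrix_mult_def det_2
  by (intro closed_Collect_conj closed_Collect_eq continuous_intros)

lemma closed_USp4: "closed USp4"
  unfolding USp4_def unitary_mat_def adjoint_mat_def matrix_matrix_mult_def transpose_def
  by (intro closed_Collect_conj closed_Collect_eq continuous_intros)

lemma Hgrp_eq: "Hgrp = {U. block_embed (pblock U) (qblock U) = U} \<inter> pblock -` SU2 \<inter> qblock -` SU2"
  unfolding Hgrp_def by (auto simp: image_iff) metis

lemma closed_Hgrp: "closed Hgrp"
  unfolding Hgrp_eq
  by (intro closed_Int closed_Collect_eq closed_vimage closed_SU2 continuous_intros)

lemma adjoint_SU2: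
  assumes "g \<in> SU2" shows "adjoint_mat g \<in> SU2"
proof -
  have "cnj (g$0$0) * g$0$0 + cnj (g$1$0) * g$1$0 = 1"
    using assms by (auto simp: SU2_def unitary_mat_def vec_eq_iff matrix_matrix_mult_def sum_2' forall_2' mat_def)
  then show ?thesis
    by (intro SU2_I) (simp_all add: SU2_entries[OF assms] mult.commute)
qed

lemma adjoint_Hgrp: "g \<in> Hgrp \<Longrightarrow> adjoint_mat g \<in> Hgrp"
  unfolding Hgrp_def by (auto simp: adjoint_block_embed intro!: image_eqI[of _ _ "(adjoint_mat _, adjoint_mat _)"] adjoint_SU2)

lemma mat_1_SU2: "mat 1 \<in> SU2"
  by (rule SU2_I) (simp_all add: mat_def)

lemma block_embed_USp4:
  assumes "a \<in> SU2" "b \<in> SU2"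
  shows "block_embed a b \<in> USp4"
proof -
  have d: "a$0$0 * a$1$1 - a$0$1 * a$1$0 = 1" "b$0$0 * b$1$1 - b$0$1 * b$1$0 = 1"
    using assms by (simp_all add: SU2_def det_2 mult.commute)
  have "transpose (block_embed a b) ** J4 ** block_embed a b = J4"
    using d by (simp add: vec_eq_iff matrix_matrix_mult_def block_embed_def sum_4' forall_4' J4_def transpose_def algebra_simps)
  then show ?thesis
    using assms by (simp add: USp4_def unitary_mat_def adjoint_block_embed block_embed_mult SU2_def block_embed_1)
qed

lemma USp4_unitary: "U \<in> USp4 \<Longrightarrow> adjoint_mat U ** U = mat 1" "U \<in> USp4 \<Longrightarrow> U ** adjoint_mat U = mat 1"
  by (auto simp: USp4_def unitary_mat_def matrix_left_right_inverse[of U])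

text \<open>\<open>transpose (adjoint_mat U)\<close> is the entrywise conjugate, so the condition
  says that U commutes with the antilinear map taking v to J4 times the conjugate of v. Such
  matrices are 2 by 2 matrices over the quaternions, and the condition is real linear in the
  entries, unlike the quadratic equation defining \<open>USp4\<close>.\<close>

definition quaternionic :: "complex^4^4 \<Rightarrow> bool" where
  "quaternionic U \<longleftrightarrow> J4 ** U = transpose (adjoint_mat U) ** J4"

lemma quaternionic_entries:
  "quaternionic U \<longleftrightarrow>
    U$1$1 = cnj (U$0$0) \<and> U$0$1 = - cnj (U$1$0) \<and> U$1$3 = cnj (U$0$2) \<and> U$0$3 = - cnj (U$1$2) \<and>
    U$3$1 = cnj (U$2$0) \<and> U$2$1 = - cnj (U$3$0) \<and> U$3$3 = cnj (U$2$2) \<and> U$2$3 = - cnj (U$3$2)"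
    (is "_ \<longleftrightarrow> ?R")
proof
  assume q: "quaternionic U"
  have "(J4 ** U) $ i $ j = (transpose (adjoint_mat U) ** J4) $ i $ j" for i j
    using q by (simp add: quaternionic_def)
  note * = this[unfolded matrix_matrix_mult_def sum_4' J4_def transpose_def]
  show ?R
    using *[of 0 1] *[of 1 1] *[of 0 3] *[of 1 3] *[of 2 1] *[of 3 1] *[of 2 3] *[of 3 3]
    by (simp add: eq_neg_iff_add_eq_0 neg_eq_iff_add_eq_0)
next
  assume ?R
  then show "quaternionic U"
    by (simp add: quaternionic_def vec_eq_iff matrix_matrix_mult_def sum_4' forall_4' J4_def transpose_def)
qed

text \<open>For unitary U the inverse of the transpose is the entrywise conjugate; multiplying the
  symplectic equation by it on the left passes from one form to the other.\<close>

lemma USp4_iff: "U \<in> USp4 \<longleftrightarrow> unitary_mat U \<and> quaternionic U"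
proof -
  have "transpose U ** J4 ** U = J4 \<longleftrightarrow> J4 ** U = transpose (adjoint_mat U) ** J4" if U: "unitary_mat U"
  proof -
    have "adjoint_mat U ** U = mat 1" "U ** adjoint_mat U = mat 1"
      using U by (auto simp: unitary_mat_def matrix_left_right_inverse[of U])
    then have 1: "transpose (adjoint_mat U) ** transpose U = mat 1" "transpose U ** transpose (adjoint_mat U) = mat 1"
      by (simp_all add: transpose_mat flip: matrix_transpose_mul)
    show ?thesis
    proof
      assume "transpose U ** J4 ** U = J4"
      then have "transpose (adjoint_mat U) ** (transpose U ** J4 ** U) = transpose (adjoint_mat U) ** J4" by simp
      then show "J4 ** U = transpose (adjoint_mat U) ** J4" by (simp add: matrix_mul_assoc 1)
    next
      assume "J4 ** U = transpose (adjoint_mat U) ** J4"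
      then show "transpose U ** J4 ** U = J4" by (simp add: 1 matrix_mul_assoc flip: matrix_mul_assoc[of _ J4 U])
    qed
  qed
  then show ?thesis by (auto simp: USp4_def quaternionic_def)
qed

lemma unitary_mat_mult: "unitary_mat A \<Longrightarrow> unitary_mat B \<Longrightarrow> unitary_mat (A ** B)"
proof -
  assume A: "unitary_mat A" and B: "unitary_mat B"
  have "adjoint_mat (A ** B) ** (A ** B) = adjoint_mat B ** (adjoint_mat A ** A) ** B"
    by (simp only: adjoint_mat_mult matrix_mul_assoc)
  then show ?thesis using A B by (simp add: unitary_mat_def)
qed

lemma USp4_mult: 
  assumes "A \<in> USp4" "B \<in> USp4" shows "A ** B \<in> USp4"
proof -
  have "transpose (A ** B) ** J4 ** (A ** B) = transpose B ** (transpose A ** J4 ** A) ** B"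
    by (simp only: matrix_transpose_mul matrix_mul_assoc)
  then show ?thesis using assms by (simp add: USp4_def unitary_mat_mult)
qed

lemma adjoint_USp4:
  assumes U: "U \<in> USp4" shows "adjoint_mat U \<in> USp4"
proof -
  have "J4 ** U ** adjoint_mat U = transpose (adjoint_mat U) ** J4 ** adjoint_mat U"
    using U by (simp add: USp4_iff quaternionic_def)
  moreover have "J4 ** U ** adjoint_mat U = J4"
    by (simp only: USp4_unitary[OF U] matrix_mul_rid flip: matrix_mul_assoc)
  ultimately have "transpose (adjoint_mat U) ** J4 ** adjoint_mat U = J4" by simp
  then show ?thesis by (simp add: USp4_def unitary_mat_def USp4_unitary[OF U])
qed

section \<open>The stabiliser of the first basis vector\<close>

definition first_col :: "complex^4^4 \<Rightarrow> complex^4" where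
  "first_col U = (\<chi> i. U $ i $ 0)"

lemma first_col_mult: "first_col (A ** B) = A *v first_col B"
  by (simp add: first_col_def vec_eq_iff matrix_matrix_mult_def matrix_vector_mult_def)

text \<open>The quaternionic relations determine the second column from the first, and orthogonality
  of columns then clears the rest of the first two rows. What is left is a unitary quaternionic 2 by
  2 block, that is, an element of SU(2).\<close>

lemma USp4_first_col_fixed:
  assumes U: "U \<in> USp4" and c: "first_col U = first_col (mat 1)"
  shows "U = block_embed (mat 1) (qblock U)" "qblock U \<in> SU2"
proof -
  have q: "quaternionic U" using U by (simp add: USp4_iff)
  note e = q[unfolded quaternionic_entries]
  have c0: "U$0$0 = 1" "U$1$0 = 0" "U$2$0 = 0" "U$3$0 = 0"
    using c by (auto simp: first_col_def vec_eq_iff forall_4' mat_def)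
  have "(adjoint_mat U ** U) $ i $ j = (mat 1 :: complex^4^4) $ i $ j" for i j
    by (simp only: USp4_unitary[OF U])
  note u = this[unfolded matrix_matrix_mult_def sum_4' mat_def]
  have r0: "U$0$2 = 0" "U$0$3 = 0"
    using u[of 0 2] u[of 0 3] c0 by simp_all
  have c1: "U$0$1 = 0" "U$1$1 = 1" "U$2$1 = 0" "U$3$1 = 0" using e c0 by simp_all
  have r1: "U$1$2 = 0" "U$1$3 = 0"
    using u[of 1 2] u[of 1 3] c1 by simp_all
  show "U = block_embed (mat 1) (qblock U)"
    using c0 r0 c1 r1 by (simp add: vec_eq_iff forall_4' block_embed_def qblock_def mat_def)
  have "cnj (U$2$2) * U$2$2 + cnj (U$3$2) * U$3$2 = 1"
    using u[of 2 2] r0 r1 by simp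
  then show "qblock U \<in> SU2"
    using e by (intro SU2_I) (simp_all add: qblock_def)
qed

text \<open>The matrix whose quaternionic columns are \<open>u\<close> and \<open>v\<close>.\<close>

definition qcols :: "complex^4 \<Rightarrow> complex^4 \<Rightarrow> complex^4^4" where
  "qcols u v = (\<chi> i j. let w = (if blk1 j then u else v) in
     if j = 0 \<or> j = 2 then w $ i
     else if i = 0 then - cnj (w $ 1) else if i = 1 then cnj (w $ 0)
     else if i = 2 then - cnj (w $ 3) else cnj (w $ 2))"

text \<open>The quaternionic form is built in, so only unitarity is at stake. The last two
  hypotheses say that v is orthogonal to u and to the quaternionic partner of u; the other
  orthogonality relations follow by conjugation.\<close>

lemma qcols_USp4:
  assumes u: "(\<Sum>i\<in>UNIV. cnj (u $ i) * u $ i) = 1" and v: "(\<Sum>i\<in>UNIV. cnj (v $ i) * v $ i) = 1"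
    and uv: "(\<Sum>i\<in>UNIV. cnj (u $ i) * v $ i) = 0"
    and uJv: "u$0 * v$1 - u$1 * v$0 + u$2 * v$3 - u$3 * v$2 = 0"
  shows "qcols u v \<in> USp4"
proof -
  have "quaternionic (qcols u v)"
    by (simp add: quaternionic_entries qcols_def)
  have uv': "(\<Sum>i\<in>UNIV. cnj (v $ i) * u $ i) = 0"
    using arg_cong[OF uv, of cnj] by (simp add: sum_4' mult.commute)
  have uJv': "cnj (u$0) * cnj (v$1) - cnj (u$1) * cnj (v$0) + cnj (u$2) * cnj (v$3) - cnj (u$3) * cnj (v$2) = 0"
    using arg_cong[OF uJv, of cnj] by simp
  note * = u[unfolded sum_4'] v[unfolded sum_4'] uv[unfolded sum_4'] uv'[unfolded sum_4'] uJv uJv'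
  have "unitary_mat (qcols u v)"
    unfolding unitary_mat_def vec_eq_iff forall_4'
    by (intro conjI; simp add: matrix_matrix_mult_def sum_4' qcols_def mat_def; use * in algebra)
  with \<open>quaternionic (qcols u v)\<close> show ?thesis by (simp add: USp4_iff)
qed

section \<open>Explicit Haar measures\<close>

definition top2 :: "complex^4 \<Rightarrow> complex^2" where
  "top2 x = (\<chi> i. if i = 0 then x $ 0 else x $ 1)"

definition bot2 :: "complex^4 \<Rightarrow> complex^2" where
  "bot2 x = (\<chi> i. if i = 0 then x $ 2 else x $ 3)"

lemma top2_nth [simp]: "top2 x $ 0 = x $ 0" "top2 x $ 1 = x $ 1"
  by (simp_all add: top2_def)

text \<open>Quaternionic Gram-Schmidt: the basis vector with index 2 minus its projections onto x
  and onto the quaternionic partner of x, then normalised. The projection has length |top2 x| / |x|,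
  whence the entries |top2 x| / |x| and 0 at indices 2 and 3. If \<open>top2 x\<close> vanishes that
  basis vector lies in the quaternionic span of x, and the one with index 0 is taken
  instead.\<close>

definition second_qcol :: "complex^4 \<Rightarrow> complex^4" where
  "second_qcol x = (if top2 x = 0 then axis 0 1 else
     (\<chi> i. (if i = 0 then - (x$0 * cnj (x$2) + cnj (x$1) * x$3) / of_real (norm (top2 x))
            else if i = 1 then - (x$1 * cnj (x$2) - cnj (x$0) * x$3) / of_real (norm (top2 x))
            else if i = 2 then of_real (norm (top2 x)) else 0) / of_real (norm x)))"

definition usp_of :: "complex^4 \<Rightarrow> complex^4^4" where
  "usp_of x = qcols (\<chi> i. x $ i / of_real (norm x)) (second_qcol x)"

lemma first_col_usp_of: "first_col (usp_of x) = (\<chi> i. x $ i / of_real (norm x))"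
  by (simp add: first_col_def usp_of_def qcols_def)

text \<open>That the second column has unit length rests on multiplicativity of the quaternion norm:
  before division its first two entries have total squared modulus |top|^2 |bottom|^2, and adding
  |top|^4 gives |top|^2 |x|^2.\<close>

lemma usp_of_USp4:
  assumes "x \<noteq> 0"
  shows "usp_of x \<in> USp4"
proof -
  define n where "n = complex_of_real (norm x)"
  define A where "A = complex_of_real (norm (top2 x))"
  have n: "n \<noteq> 0" "cnj n = n" using assms by (auto simp: n_def)
  have nn: "n * n = cnj (x$0) * x$0 + cnj (x$1) * x$1 + cnj (x$2) * x$2 + cnj (x$3) * x$3"
    using norm_vec_power2[of x] by (simp add: n_def sum_4' power2_eq_square)
  have A: "cnj A = A" by (simp add: A_def)
  have AA: "A * A = cnj (x$0) * x$0 + cnj (x$1) * x$1"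
    using norm_vec_power2[of "top2 x"] by (simp add: A_def sum_2' power2_eq_square)
  have u: "(\<Sum>i\<in>UNIV. cnj ((\<chi> i. x $ i / n) $ i) * (\<chi> i. x $ i / n) $ i) = 1"
    using n by (simp add: sum_4' flip: add_divide_distrib nn)
  show ?thesis
  proof (cases "top2 x = 0")
    case True
    then have "x $ 0 = 0" "x $ 1 = 0"
      by (auto simp: vec_eq_iff top2_def forall_2')
    then show ?thesis using u unfolding usp_of_def n_def second_qcol_def
      by (intro qcols_USp4) (simp_all add: True sum_4' axis_def)
  next
    case False
    then have A0: "A \<noteq> 0" by (simp add: A_def)
    define v where "v = second_qcol x"
    have v: "v $ 0 = - (x$0 * cnj (x$2) + cnj (x$1) * x$3) / A / n"
      "v $ 1 = - (x$1 * cnj (x$2) - cnj (x$0) * x$3) / A / n" "v $ 2 = A / n" "v $ 3 = 0"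
      using False by (auto simp: v_def second_qcol_def A_def n_def)
    show ?thesis unfolding usp_of_def n_def[symmetric] v_def[symmetric]
    proof (rule qcols_USp4[OF u])
      have "(\<Sum>i\<in>UNIV. cnj (v $ i) * v $ i) =
         ((cnj (x$0) * x$2 + x$1 * cnj (x$3)) * (x$0 * cnj (x$2) + cnj (x$1) * x$3) +
          (cnj (x$1) * x$2 - x$0 * cnj (x$3)) * (x$1 * cnj (x$2) - cnj (x$0) * x$3) + A * A * (A * A)) / (A * A * (n * n))"
        using A0 n by (simp add: sum_4' v A field_simps)
      also have "(cnj (x$0) * x$2 + x$1 * cnj (x$3)) * (x$0 * cnj (x$2) + cnj (x$1) * x$3) +
          (cnj (x$1) * x$2 - x$0 * cnj (x$3)) * (x$1 * cnj (x$2) - cnj (x$0) * x$3) + A * A * (A * A) = A * A * (n * n)"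
        unfolding AA nn by (simp add: algebra_simps)
      finally show "(\<Sum>i\<in>UNIV. cnj (v $ i) * v $ i) = 1" using A0 n by simp
      have "(\<Sum>i\<in>UNIV. cnj ((\<chi> i. x $ i / n) $ i) * v $ i) =
          (A * A - (cnj (x$0) * x$0 + cnj (x$1) * x$1)) * cnj (x$2) / (A * (n * n))"
        using A0 n by (simp add: sum_4' v field_simps)
      then show "(\<Sum>i\<in>UNIV. cnj ((\<chi> i. x $ i / n) $ i) * v $ i) = 0" unfolding AA by simp
      have "(\<chi> i. x $ i / n) $ 0 * v $ 1 - (\<chi> i. x $ i / n) $ 1 * v $ 0 + (\<chi> i. x $ i / n) $ 2 * v $ 3 - (\<chi> i. x $ i / n) $ 3 * v $ 2 =
          ((cnj (x$0) * x$0 + cnj (x$1) * x$1) - A * A) * x$3 / (A * (n * n))"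
        using A0 n by (simp add: v field_simps)
      then show "(\<chi> i. x $ i / n) $ 0 * v $ 1 - (\<chi> i. x $ i / n) $ 1 * v $ 0 + (\<chi> i. x $ i / n) $ 2 * v $ 3 - (\<chi> i. x $ i / n) $ 3 * v $ 2 = 0"
        unfolding AA by simp
    qed
  qed
qed

text \<open>Both \<open>h ** usp_of x\<close> and \<open>usp_of (h *v x)\<close> have first column h
  x / |x|, so they differ on the right by an element fixing the first basis vector. The factor k
  depends on x.\<close>

lemma USp4_mult_usp_of:
  assumes h: "h \<in> USp4" and x: "x \<noteq> 0"
  obtains k where "k \<in> SU2" "h ** usp_of x = usp_of (h *v x) ** block_embed (mat 1) k"
proof -
  have nrm: "norm (h *v x) = norm x"
    using h by (intro norm_unitary_mult) (simp add: USp4_def)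
  then have hx: "h *v x \<noteq> 0" using x by auto
  let ?g = "usp_of (h *v x)"
  note g = usp_of_USp4[OF hx]
  define m where "m = adjoint_mat ?g ** (h ** usp_of x)"
  have m: "m \<in> USp4" unfolding m_def by (intro USp4_mult adjoint_USp4 g h usp_of_USp4 x)
  have "first_col (h ** usp_of x) = first_col ?g"
    by (simp add: first_col_mult first_col_usp_of nrm) (simp add: vec_eq_iff matrix_vector_mult_def sum_divide_distrib)
  then have "first_col m = first_col (adjoint_mat ?g ** ?g)"
    unfolding m_def first_col_mult[of "adjoint_mat ?g"] by simp
  then have c: "first_col m = first_col (mat 1)" by (simp add: USp4_unitary[OF g])
  have "h ** usp_of x = ?g ** m"
    unfolding m_def by (simp add: matrix_mul_assoc USp4_unitary[OF g])
  with USp4_first_col_fixed[OF m c] show ?thesis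
    by (intro that[of "qblock m"]) simp_all
qed

lemma measurable_top2 [measurable]: "top2 \<in> borel_measurable borel"
  unfolding top2_def
proof (intro borel_measurable_vecI, simp only: vec_lambda_beta)
  fix i :: 2
  show "(\<lambda>x. if i = 0 then x $ 0 else x $ 1 :: complex) \<in> borel_measurable borel"
    by (cases "i = 0"; simp)
qed

lemma measurable_second_qcol [measurable]: "second_qcol \<in> borel_measurable borel"
proof -
  have "(\<lambda>x. (\<chi> i. (if i = 0 then - (x$0 * cnj (x$2) + cnj (x$1) * x$3) / of_real (norm (top2 x))
            else if i = 1 then - (x$1 * cnj (x$2) - cnj (x$0) * x$3) / of_real (norm (top2 x))
            else if i = 2 then of_real (norm (top2 x)) else 0) / of_real (norm x)) :: complex^4) \<in> borel_measurable borel"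
  proof (intro borel_measurable_vecI, simp only: vec_lambda_beta)
    fix i :: 4
    show "(\<lambda>x. (if i = 0 then - (x$0 * cnj (x$2) + cnj (x$1) * x$3) / complex_of_real (norm (top2 x))
            else if i = 1 then - (x$1 * cnj (x$2) - cnj (x$0) * x$3) / of_real (norm (top2 x))
            else if i = 2 then of_real (norm (top2 x)) else 0) / of_real (norm x)) \<in> borel_measurable borel"
      by (cases "i = 0"; cases "i = 1"; cases "i = 2"; simp)
  qed
  then show ?thesis unfolding second_qcol_def[abs_def] by measurable
qed

lemma measurable_usp_of [measurable]: "usp_of \<in> borel_measurable borel"
proof (intro borel_measurable_vecI)
  fix i j :: 4
  show "(\<lambda>x. usp_of x $ i $ j) \<in> borel_measurable borel"
    unfolding usp_of_def qcols_def Let_def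
    by (cases "blk1 j"; cases "j = 0 \<or> j = 2"; cases "i = 0"; cases "i = 1"; cases "i = 2"; simp)
qed

section \<open>The explicit measures and their left invariance\<close>

lemma nn_integral_ball_measure_isometry:
  fixes f :: "'b::euclidean_space \<Rightarrow> ennreal"
  assumes T: "linear T" "\<And>x. norm (T x) = norm x" "DIM('a::euclidean_space) = DIM('b)"
    and f: "f \<in> borel_measurable borel"
  shows "(\<integral>\<^sup>+x. f (T (x::'a)) \<partial>ball_measure) = (\<integral>\<^sup>+x. f x \<partial>ball_measure)"
proof -
  have "T \<in> borel_measurable borel"
    using T(1) by (intro borel_measurable_continuous_onI linear_continuous_on)
      (simp add: linear_conv_bounded_linear)
  then show ?thesis
    unfolding ball_measure_isometry[OF T, symmetric] using f by (subst nn_integral_distr) auto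
qed

definition nu_G :: "(complex^4^4) measure" where
  "nu_G = distr (ball_measure \<Otimes>\<^sub>M ball_measure) borel (\<lambda>(x, y). usp_of x ** block_embed (mat 1) (su2_of y))"

definition nu_H :: "(complex^4^4) measure" where
  "nu_H = distr (ball_measure \<Otimes>\<^sub>M ball_measure) borel (\<lambda>(x, y). block_embed (su2_of x) (su2_of y))"

lemma sets_nu [simp, measurable_cong]: "sets nu_G = sets borel" "sets nu_H = sets borel"
  by (simp_all add: nu_G_def nu_H_def)

lemma nn_integral_ball_pair:
  fixes F :: "'a::euclidean_space \<times> 'b::euclidean_space \<Rightarrow> ennreal"
  assumes [measurable]: "F \<in> borel_measurable (borel \<Otimes>\<^sub>M borel)"
  shows "(\<integral>\<^sup>+p. F p \<partial>(ball_measure \<Otimes>\<^sub>M ball_measure)) = (\<integral>\<^sup>+x. \<integral>\<^sup>+y. F (x, y) \<partial>ball_measure \<partial>ball_measure)"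
proof -
  interpret prob_space "ball_measure :: 'b measure" by (rule prob_space_ball_measure)
  show ?thesis by (rule nn_integral_fst[symmetric]) measurable
qed

lemma nn_integral_nu_G:
  assumes [measurable]: "f \<in> borel_measurable borel"
  shows "(\<integral>\<^sup>+U. f U \<partial>nu_G) = (\<integral>\<^sup>+x. \<integral>\<^sup>+y. f (usp_of x ** block_embed (mat 1) (su2_of y)) \<partial>ball_measure \<partial>ball_measure)"
  unfolding nu_G_def by (subst nn_integral_distr, simp, simp, subst nn_integral_ball_pair) simp_all

lemma nn_integral_nu_H:
  assumes [measurable]: "f \<in> borel_measurable borel"
  shows "(\<integral>\<^sup>+U. f U \<partial>nu_H) = (\<integral>\<^sup>+x. \<integral>\<^sup>+y. f (block_embed (su2_of x) (su2_of y)) \<partial>ball_measure \<partial>ball_measure)"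
  unfolding nu_H_def by (subst nn_integral_distr, simp, simp, subst nn_integral_ball_pair) simp_all

lemma nn_integral_SU2_mult:
  assumes g: "g \<in> SU2" and [measurable]: "f \<in> borel_measurable borel"
  shows "(\<integral>\<^sup>+y. f (g ** su2_of y) \<partial>ball_measure) = (\<integral>\<^sup>+y. f (su2_of y) \<partial>ball_measure)"
  unfolding SU2_mult_su2_of[OF g]
  using g by (intro nn_integral_ball_measure_isometry[where f="\<lambda>y. f (su2_of y)"] linear_matrix_vector_mult_complex norm_unitary_mult)
    (auto simp: SU2_def)

text \<open>For fixed x the correction factor k is a constant of SU(2) and is absorbed by the inner
  integral over y. Once it is gone, the outer integral is invariant because x is only rotated by
  h.\<close>

lemma nn_integral_nu_G_mult:
  assumes h: "h \<in> USp4" and [measurable]: "f \<in> borel_measurable borel"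
  shows "(\<integral>\<^sup>+U. f (h ** U) \<partial>nu_G) = (\<integral>\<^sup>+U. f U \<partial>nu_G)"
proof -
  interpret prob_space "ball_measure :: (complex^2) measure" by (rule prob_space_ball_measure)
  have "(\<integral>\<^sup>+U. f (h ** U) \<partial>nu_G) =
      (\<integral>\<^sup>+x. \<integral>\<^sup>+y. f (usp_of (h *v x) ** block_embed (mat 1) (su2_of y)) \<partial>ball_measure \<partial>ball_measure)"
  proof (subst nn_integral_nu_G, simp, intro nn_integral_cong_AE, use AE_ball_measure_nonzero in eventually_elim)
    fix x :: "complex^4" assume "x \<noteq> 0"
    then obtain k where k: "k \<in> SU2" "h ** usp_of x = usp_of (h *v x) ** block_embed (mat 1) k"
      using USp4_mult_usp_of[OF h] by blast
    have "h ** (usp_of x ** block_embed (mat 1) (su2_of y)) = usp_of (h *v x) ** block_embed (mat 1) (k ** su2_of y)" for y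
    proof -
      have "h ** (usp_of x ** block_embed (mat 1) (su2_of y)) = (h ** usp_of x) ** block_embed (mat 1) (su2_of y)"
        by (simp only: matrix_mul_assoc)
      also have "\<dots> = usp_of (h *v x) ** (block_embed (mat 1) k ** block_embed (mat 1) (su2_of y))"
        by (simp only: k(2) matrix_mul_assoc)
      finally show ?thesis by (simp add: block_embed_mult)
    qed
    then show "(\<integral>\<^sup>+y. f (h ** (usp_of x ** block_embed (mat 1) (su2_of y))) \<partial>ball_measure) =
        (\<integral>\<^sup>+y. f (usp_of (h *v x) ** block_embed (mat 1) (su2_of y)) \<partial>ball_measure)"
      using nn_integral_SU2_mult[OF k(1), of "\<lambda>q. f (usp_of (h *v x) ** block_embed (mat 1) q)"] by simp
  qed
  also have "\<dots> = (\<integral>\<^sup>+x. \<integral>\<^sup>+y. f (usp_of x ** block_embed (mat 1) (su2_of y)) \<partial>ball_measure \<partial>ball_measure)"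
    using h by (intro nn_integral_ball_measure_isometry[where
          f="\<lambda>x. \<integral>\<^sup>+y. f (usp_of x ** block_embed (mat 1) (su2_of y)) \<partial>ball_measure"]
        linear_matrix_vector_mult_complex norm_unitary_mult) (auto simp: USp4_def)
  also have "\<dots> = (\<integral>\<^sup>+U. f U \<partial>nu_G)" by (simp add: nn_integral_nu_G)
  finally show ?thesis .
qed

lemma nn_integral_nu_H_mult:
  assumes h: "h \<in> Hgrp" and [measurable]: "f \<in> borel_measurable borel"
  shows "(\<integral>\<^sup>+U. f (h ** U) \<partial>nu_H) = (\<integral>\<^sup>+U. f U \<partial>nu_H)"
proof -
  interpret prob_space "ball_measure :: (complex^2) measure" by (rule prob_space_ball_measure)
  obtain a b where ab: "a \<in> SU2" "b \<in> SU2" "h = block_embed a b"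
    using h by (auto simp: Hgrp_def)
  have "(\<integral>\<^sup>+U. f (h ** U) \<partial>nu_H) =
      (\<integral>\<^sup>+x. \<integral>\<^sup>+y. f (block_embed (a ** su2_of x) (b ** su2_of y)) \<partial>ball_measure \<partial>ball_measure)"
    by (subst nn_integral_nu_H) (simp_all add: ab block_embed_mult)
  also have "\<dots> = (\<integral>\<^sup>+x. \<integral>\<^sup>+y. f (block_embed (a ** su2_of x) (su2_of y)) \<partial>ball_measure \<partial>ball_measure)"
    by (rule nn_integral_cong, rule nn_integral_SU2_mult[OF ab(2)]) measurable
  also have "\<dots> = (\<integral>\<^sup>+x. \<integral>\<^sup>+y. f (block_embed (su2_of x) (su2_of y)) \<partial>ball_measure \<partial>ball_measure)"
    by (rule nn_integral_SU2_mult[OF ab(1), where f="\<lambda>q. \<integral>\<^sup>+y. f (block_embed q (su2_of y)) \<partial>ball_measure"]) measurable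
  finally show ?thesis by (simp add: nn_integral_nu_H)
qed

lemma distr_eqI_nn_integral:
  assumes "sets M = sets borel" "T \<in> borel_measurable borel"
    and "\<And>f :: _ \<Rightarrow> ennreal. f \<in> borel_measurable borel \<Longrightarrow> (\<integral>\<^sup>+x. f (T x) \<partial>M) = (\<integral>\<^sup>+x. f x \<partial>M)"
  shows "distr M borel T = M"
proof (rule measure_eqI)
  note [measurable_cong] = assms(1) and [measurable] = assms(2)
  fix A assume "A \<in> sets (distr M borel T)"
  then have [measurable]: "A \<in> sets borel" by simp
  have "emeasure (distr M borel T) A = (\<integral>\<^sup>+x. indicator A (T x) \<partial>M)"
    by (subst nn_integral_indicator[symmetric], simp, subst nn_integral_distr) simp_all
  also have "\<dots> = (\<integral>\<^sup>+x. indicator A x \<partial>M)" by (intro assms(3)) measurable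
  finally show "emeasure (distr M borel T) A = emeasure M A" by (simp add: assms(1))
qed (simp add: assms)

lemma prob_space_nu: "prob_space nu_G" "prob_space nu_H"
proof -
  interpret X: prob_space "ball_measure :: (complex^4) measure" by (rule prob_space_ball_measure)
  interpret Y: prob_space "ball_measure :: (complex^2) measure" by (rule prob_space_ball_measure)
  interpret XY: pair_prob_space "ball_measure :: (complex^4) measure" "ball_measure :: (complex^2) measure" ..
  interpret YY: pair_prob_space "ball_measure :: (complex^2) measure" "ball_measure :: (complex^2) measure" ..
  show "prob_space nu_G" unfolding nu_G_def by (rule XY.prob_space_distr) measurable
  show "prob_space nu_H" unfolding nu_H_def by (rule YY.prob_space_distr) measurable
qed

lemma haar_USp4: "haar USp4 = nu_G"
proof (rule haar_eqI[OF adjoint_USp4])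
  interpret prob_space "ball_measure :: (complex^4) measure" by (rule prob_space_ball_measure)
  interpret Y: prob_space "ball_measure :: (complex^2) measure" by (rule prob_space_ball_measure)
  have [measurable]: "USp4 \<in> sets borel" by (intro borel_closed closed_USp4)
  have "emeasure nu_G USp4 = (\<integral>\<^sup>+U. indicator USp4 U \<partial>nu_G)" by simp
  also have "\<dots> = (\<integral>\<^sup>+x. \<integral>\<^sup>+y. indicator USp4 (usp_of x ** block_embed (mat 1) (su2_of y)) \<partial>ball_measure \<partial>ball_measure)"
    by (rule nn_integral_nu_G) measurable
  also have "\<dots> = (\<integral>\<^sup>+x. \<integral>\<^sup>+y. 1 \<partial>(ball_measure :: (complex^2) measure) \<partial>(ball_measure :: (complex^4) measure))"
  proof (intro nn_integral_cong_AE, use AE_ball_measure_nonzero in eventually_elim)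
    fix x :: "complex^4" assume x: "x \<noteq> 0"
    show "(\<integral>\<^sup>+y. indicator USp4 (usp_of x ** block_embed (mat 1) (su2_of y)) \<partial>ball_measure) = (\<integral>\<^sup>+y. 1 \<partial>(ball_measure :: (complex^2) measure))"
      by (intro nn_integral_cong_AE, use AE_ball_measure_nonzero in eventually_elim)
        (simp add: USp4_mult usp_of_USp4 x block_embed_USp4 mat_1_SU2 su2_of_SU2)
  qed
  also have "\<dots> = 1" using emeasure_space_1 Y.emeasure_space_1 by simp
  finally show "emeasure nu_G USp4 = 1" .
  show "distr nu_G borel ((**) g) = nu_G" if "g \<in> USp4" for g
    by (rule distr_eqI_nn_integral) (simp_all add: nn_integral_nu_G_mult[OF that])
qed (simp_all add: prob_space_nu)

lemma block_embed_Hgrp: "a \<in> SU2 \<Longrightarrow> b \<in> SU2 \<Longrightarrow> block_embed a b \<in> Hgrp"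
  unfolding Hgrp_def by (rule image_eqI[of _ _ "(a, b)"]) simp_all

lemma haar_Hgrp: "haar Hgrp = nu_H"
proof (rule haar_eqI[OF adjoint_Hgrp])
  interpret Y: prob_space "ball_measure :: (complex^2) measure" by (rule prob_space_ball_measure)
  have [measurable]: "Hgrp \<in> sets borel" by (intro borel_closed closed_Hgrp)
  have "emeasure nu_H Hgrp = (\<integral>\<^sup>+U. indicator Hgrp U \<partial>nu_H)" by simp
  also have "\<dots> = (\<integral>\<^sup>+x. \<integral>\<^sup>+y. indicator Hgrp (block_embed (su2_of x) (su2_of y)) \<partial>ball_measure \<partial>ball_measure)"
    by (rule nn_integral_nu_H) measurable
  also have "\<dots> = (\<integral>\<^sup>+x. \<integral>\<^sup>+y. 1 \<partial>(ball_measure :: (complex^2) measure) \<partial>(ball_measure :: (complex^2) measure))"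
  proof (intro nn_integral_cong_AE, use AE_ball_measure_nonzero in eventually_elim)
    fix x :: "complex^2" assume x: "x \<noteq> 0"
    show "(\<integral>\<^sup>+y. indicator Hgrp (block_embed (su2_of x) (su2_of y)) \<partial>ball_measure) = (\<integral>\<^sup>+y. 1 \<partial>(ball_measure :: (complex^2) measure))"
      by (intro nn_integral_cong_AE, use AE_ball_measure_nonzero in eventually_elim)
        (simp add: block_embed_Hgrp x su2_of_SU2)
  qed
  also have "\<dots> = 1" using Y.emeasure_space_1 by simp
  finally show "emeasure nu_H Hgrp = 1" .
  show "distr nu_H borel ((**) g) = nu_H" if "g \<in> Hgrp" for g
    by (rule distr_eqI_nn_integral) (simp_all add: nn_integral_nu_H_mult[OF that])
qed (simp_all add: prob_space_nu)

section \<open>The laws of the traces\<close>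

definition semicircle :: "real \<Rightarrow> ennreal" where
  "semicircle s = ennreal (2 / pi * sqrt (1 - s\<^sup>2))"

lemma measurable_semicircle [measurable]: "semicircle \<in> borel_measurable borel"
  unfolding semicircle_def by measurable

section \<open>Laws of the real part and of the norm ratio\<close>

lemma norm_vec_2: "(norm (y :: complex^2))\<^sup>2 = (cmod (y $ 0))\<^sup>2 + (cmod (y $ 1))\<^sup>2"
  by (simp add: norm_vec_def L2_set_def sum_2')

lemma norm_vec_4: "(norm (y :: complex^4))\<^sup>2 = (cmod (y $ 0))\<^sup>2 + (cmod (y $ 1))\<^sup>2 + (cmod (y $ 2))\<^sup>2 + (cmod (y $ 3))\<^sup>2"
  by (simp add: norm_vec_def L2_set_def sum_4')

text \<open>Regrouping the four real coordinates as 1 + 3 makes |Re y_0| / |y| a norm ratio. A norm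
  forgets the sign, so this step yields only the absolute value.\<close>

lemma nn_integral_abs_semicircle:
  fixes f :: "real \<Rightarrow> ennreal"
  assumes [measurable]: "f \<in> borel_measurable borel"
  shows "(\<integral>\<^sup>+y. f \<bar>Re (y $ 0) / norm y\<bar> \<partial>(ball_measure :: (complex^2) measure)) =
    (\<integral>\<^sup>+z. ennreal (4 / pi * sqrt (1 - z\<^sup>2)) * indicator {0..1} z * f z \<partial>lborel)"
proof -
  let ?T = "\<lambda>y :: complex^2. (Re (y $ 0), Im (y $ 0), y $ 1)"
  have "norm (?T y) = norm y" for y
  proof -
    have "(norm (?T y))\<^sup>2 = (norm y)\<^sup>2"
      by (simp add: norm_vec_2 norm_Pair cmod_power2)
    then show ?thesis by simp
  qed
  moreover have "linear ?T" by (intro linearI) auto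
  ultimately have T: "linear ?T" "\<And>y. norm (?T y) = norm y" "DIM(complex^2) = DIM(real \<times> real \<times> complex)"
    by auto
  have [measurable]: "(\<lambda>x :: real \<times> real \<times> complex. norm (fst x) / norm x) \<in> borel_measurable borel"
    by (intro borel_measurable_divide borel_measurable_norm borel_measurable_continuous_onI continuous_intros)
  have "(\<integral>\<^sup>+y. f \<bar>Re (y $ 0) / norm y\<bar> \<partial>(ball_measure :: (complex^2) measure)) =
      (\<integral>\<^sup>+y. f (norm (fst (?T y)) / norm (?T y)) \<partial>ball_measure)"
    unfolding T(2) by simp
  also have "\<dots> = (\<integral>\<^sup>+x. f (norm (fst x) / norm x) \<partial>(ball_measure :: (real \<times> real \<times> complex) measure))"
    by (rule nn_integral_ball_measure_isometry[OF T]) measurable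
  also have "\<dots> = (\<integral>\<^sup>+z. f z \<partial>distr (ball_measure :: (real \<times> real \<times> complex) measure) borel (\<lambda>x. norm (fst x) / norm x))"
    by (rule nn_integral_distr[symmetric]) measurable
  also have "distr (ball_measure :: (real \<times> real \<times> complex) measure) borel (\<lambda>x. norm (fst x) / norm x) =
      density lborel (\<lambda>z. ennreal (4 / pi * sqrt (1 - z\<^sup>2)) * indicator {0..1} z)"
    by (subst distr_ball_measure_polar) (simp_all add: eval_unit_ball_vol power2_eq_square)
  also have "(\<integral>\<^sup>+z. f z \<partial>density lborel (\<lambda>z. ennreal (4 / pi * sqrt (1 - z\<^sup>2)) * indicator {0..1} z)) =
      (\<integral>\<^sup>+z. ennreal (4 / pi * sqrt (1 - z\<^sup>2)) * indicator {0..1} z * f z \<partial>lborel)"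
    by (rule nn_integral_density) measurable
  finally show ?thesis .
qed

text \<open>The sign lost in the norm ratio is recovered from the symmetry y to -y: twice the
  integral of f equals the integral of f(s) + f(-s), which depends on |s| alone.\<close>

lemma nn_integral_semicircle:
  fixes f :: "real \<Rightarrow> ennreal"
  assumes [measurable]: "f \<in> borel_measurable borel"
  shows "(\<integral>\<^sup>+y. f (Re (y $ 0) / norm y) \<partial>(ball_measure :: (complex^2) measure)) = (\<integral>\<^sup>+s. semicircle s * f s \<partial>lborel)"
proof -
  let ?s = "\<lambda>y :: complex^2. Re (y $ 0) / norm y"
  let ?I = "\<integral>\<^sup>+y. f (?s y) \<partial>ball_measure"
  have sym: "(\<integral>\<^sup>+y. f (- ?s y) \<partial>ball_measure) = ?I"
    using nn_integral_ball_measure_isometry[of uminus "\<lambda>y. f (?s y)"] by (simp add: linear_uminus)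
  have half: "ennreal (4 / pi * sqrt (1 - z\<^sup>2)) = 2 * semicircle z" if "z \<in> {-1..1}" for z
  proof -
    have "z\<^sup>2 \<le> 1" using that by (simp add: abs_square_le_1 abs_le_iff)
    then show ?thesis by (simp add: semicircle_def ennreal_mult[symmetric] flip: ennreal_numeral)
  qed
  have "2 * ?I = (\<integral>\<^sup>+y. f (?s y) + f (- ?s y) \<partial>ball_measure)"
    by (subst nn_integral_add) (simp_all add: sym mult_2)
  also have "\<dots> = (\<integral>\<^sup>+y. f \<bar>?s y\<bar> + f (- \<bar>?s y\<bar>) \<partial>ball_measure)"
    by (intro nn_integral_cong) (simp add: abs_if add.commute)
  also have "\<dots> = (\<integral>\<^sup>+z. ennreal (4 / pi * sqrt (1 - z\<^sup>2)) * indicator {0..1} z * (f z + f (- z)) \<partial>lborel)"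
    by (rule nn_integral_abs_semicircle[of "\<lambda>z. f z + f (- z)"]) measurable
  also have "\<dots> = (\<integral>\<^sup>+z. 2 * semicircle z * indicator {0..1} z * f z + 2 * semicircle z * indicator {0..1} z * f (- z) \<partial>lborel)"
  proof (rule nn_integral_cong)
    fix z :: real
    show "ennreal (4 / pi * sqrt (1 - z\<^sup>2)) * indicator {0..1} z * (f z + f (- z)) =
        2 * semicircle z * indicator {0..1} z * f z + 2 * semicircle z * indicator {0..1} z * f (- z)"
    proof (cases "z \<in> {0..1}")
      case True
      then have "ennreal (4 / pi * sqrt (1 - z\<^sup>2)) = 2 * semicircle z" by (intro half) auto
      then show ?thesis by (simp only: distrib_left)
    qed simp
  qed
  also have "\<dots> = (\<integral>\<^sup>+z. 2 * semicircle z * indicator {0..1} z * f z \<partial>lborel) + (\<integral>\<^sup>+z. 2 * semicircle z * indicator {0..1} z * f (- z) \<partial>lborel)"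
    by (rule nn_integral_add) measurable
  also have "(\<integral>\<^sup>+z. 2 * semicircle z * indicator {0..1} z * f (- z) \<partial>lborel) = (\<integral>\<^sup>+z. 2 * semicircle z * indicator {-1..0} z * f z \<partial>lborel)"
    by (subst nn_integral_real_affine[where c="-1" and t=0])
      (auto intro!: nn_integral_cong simp: semicircle_def indicator_def)
  also have "(\<integral>\<^sup>+z. 2 * semicircle z * indicator {0..1} z * f z \<partial>lborel) + \<dots> =
      (\<integral>\<^sup>+z. 2 * semicircle z * indicator {0..1} z * f z + 2 * semicircle z * indicator {-1..0} z * f z \<partial>lborel)"
    by (rule nn_integral_add[symmetric]) measurable
  \<comment> \<open>The two half-intervals share the point 0, which is discarded as a null
    set.\<close>
  also have "\<dots> = (\<integral>\<^sup>+z. 2 * (semicircle z * f z) \<partial>lborel)"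
  proof (intro nn_integral_cong_AE, use AE_lborel_singleton[of 0] in eventually_elim)
    fix z :: real assume z: "z \<noteq> 0"
    have "semicircle z = 0" if "\<bar>z\<bar> > 1"
    proof -
      have "z\<^sup>2 \<ge> 1" using that by (metis abs_square_less_1 not_less less_asym)
      then show ?thesis by (simp add: semicircle_def ennreal_neg mult_le_0_iff divide_le_0_iff)
    qed
    then show "2 * semicircle z * indicator {0..1} z * f z + 2 * semicircle z * indicator {-1..0} z * f z = 2 * (semicircle z * f z)"
      using z by (auto simp: indicator_def mult.assoc not_le abs_if split: if_splits)
  qed
  also have "\<dots> = 2 * (\<integral>\<^sup>+z. semicircle z * f z \<partial>lborel)"
    by (rule nn_integral_cmult) measurable
  finally show ?thesis by (simp add: ennreal_mult_cancel_left)
qed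

text \<open>The norm-ratio law for the splitting of eight real dimensions as 4 + 4.\<close>

lemma nn_integral_top2_ratio:
  fixes f :: "real \<Rightarrow> ennreal"
  assumes [measurable]: "f \<in> borel_measurable borel"
  shows "(\<integral>\<^sup>+x. f (norm (top2 x) / norm x) \<partial>ball_measure) =
    (\<integral>\<^sup>+r. ennreal (12 * r ^ 3 * (1 - r\<^sup>2)) * indicator {0..1} r * f r \<partial>lborel)"
proof -
  let ?T = "\<lambda>x. (top2 x, bot2 x)"
  have nrm: "norm (?T y) = norm y" for y
  proof -
    have "(norm (?T y))\<^sup>2 = (norm y)\<^sup>2"
      by (simp add: norm_Pair norm_vec_2 norm_vec_4 top2_def bot2_def)
    then show ?thesis by simp
  qed
  have lin: "linear ?T"
    by (intro linearI) (auto simp: top2_def bot2_def vec_eq_iff)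
  have [measurable]: "(\<lambda>x :: (complex^2) \<times> (complex^2). norm (fst x) / norm x) \<in> borel_measurable borel"
    by (intro borel_measurable_divide borel_measurable_norm borel_measurable_continuous_onI continuous_intros)
  have "(\<integral>\<^sup>+x. f (norm (top2 x) / norm x) \<partial>ball_measure) =
      (\<integral>\<^sup>+x. f (norm (fst (?T x)) / norm (?T x)) \<partial>ball_measure)"
    unfolding nrm by simp
  also have "\<dots> = (\<integral>\<^sup>+x. f (norm (fst x) / norm x) \<partial>(ball_measure :: ((complex^2) \<times> (complex^2)) measure))"
    by (rule nn_integral_ball_measure_isometry[OF lin nrm]) simp_all
  also have "\<dots> = (\<integral>\<^sup>+z. f z \<partial>distr (ball_measure :: ((complex^2) \<times> (complex^2)) measure) borel (\<lambda>x. norm (fst x) / norm x))"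
    by (rule nn_integral_distr[symmetric]) measurable
  also have "distr (ball_measure :: ((complex^2) \<times> (complex^2)) measure) borel (\<lambda>x. norm (fst x) / norm x) =
      density lborel (\<lambda>r. ennreal (12 * r ^ 3 * (1 - r\<^sup>2)) * indicator {0..1} r)"
  proof (subst distr_ball_measure_polar, simp, rule arg_cong[where f="density lborel"], rule ext, goal_cases)
    case (1 z)
    then show ?case
    proof (cases "z \<in> {0..1}")
      case True
      show ?thesis using True by (simp add: power_le_one eval_unit_ball_vol mult_ac)
    qed simp
  qed
  also have "(\<integral>\<^sup>+z. f z \<partial>density lborel (\<lambda>r. ennreal (12 * r ^ 3 * (1 - r\<^sup>2)) * indicator {0..1} r)) =
      (\<integral>\<^sup>+r. ennreal (12 * r ^ 3 * (1 - r\<^sup>2)) * indicator {0..1} r * f r \<partial>lborel)"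
    by (rule nn_integral_density) measurable
  finally show ?thesis .
qed

lemma measurable_eps_fun [measurable]: "eps_fun \<in> borel_measurable borel"
  unfolding eps_fun_def trace_def
  by (intro borel_measurable_continuous_onI continuous_intros)

lemma eps_fun_block_embed:
  "eps_fun (block_embed (su2_of z) (su2_of y)) = 2 * (Re (z $ 0) / norm z) + 2 * (Re (y $ 0) / norm y) + 4"
  by (simp add: eps_fun_def trace_def sum_4' block_embed_def su2_of_def)

text \<open>The factor r appears in both diagonal blocks: the lower right one carries the entry r of
  \<open>second_qcol\<close>, and the upper left one is r times the quaternion of
  \<open>top2 x\<close>. Cyclicity of the trace moves that quaternion next to z, where a rotation of
  z can remove it. If \<open>top2 x\<close> is 0, both sides lose the z-term.\<close>

lemma eps_fun_usp_of:
  fixes x :: "complex^4"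
  defines "r \<equiv> norm (top2 x) / norm x"
  shows "eps_fun (block_embed (su2_of z) (mat 1) ** (usp_of x ** block_embed (mat 1) (su2_of y))) =
    r * (2 * (Re ((su2_of (top2 x) *v z) $ 0) / norm z) + 2 * (Re (y $ 0) / norm y)) + 4"
proof -
  have *: "trace (block_embed k (mat 1) ** (U ** block_embed (mat 1) q)) =
      k$0$0 * U$0$0 + k$0$1 * U$1$0 + k$1$0 * U$0$1 + k$1$1 * U$1$1 +
      (U$2$2 * q$0$0 + U$2$3 * q$1$0 + U$3$2 * q$0$1 + U$3$3 * q$1$1)" for k q U
    by (simp add: trace_def matrix_matrix_mult_def sum_4' block_embed_def mat_def)
  have v: "second_qcol x $ 2 = of_real r" "second_qcol x $ 3 = 0"
    by (simp_all add: second_qcol_def r_def axis_def)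
  have 1: "Re (su2_of z $0$0 * usp_of x $0$0 + su2_of z $0$1 * usp_of x $1$0 + su2_of z $1$0 * usp_of x $0$1 + su2_of z $1$1 * usp_of x $1$1)
      = 2 * Re (x $ 0 * z $ 0 - cnj (x $ 1) * z $ 1) / (norm z * norm x)"
    by (simp add: su2_of_def usp_of_def qcols_def add_divide_distrib diff_divide_distrib mult_ac flip: of_real_mult)
  have 2: "Re ((su2_of (top2 x) *v z) $ 0) = Re (x $ 0 * z $ 0 - cnj (x $ 1) * z $ 1) / norm (top2 x)"
    by (simp add: su2_of_def matrix_vector_mult_def sum_2' add_divide_distrib diff_divide_distrib)
  have 3: "Re (x $ 0 * z $ 0 - cnj (x $ 1) * z $ 1) = 0" if "top2 x = 0"
    using that by (auto simp: vec_eq_iff top2_def forall_2')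
  have 4: "Re (usp_of x$2$2 * su2_of y$0$0 + usp_of x$2$3 * su2_of y$1$0 + usp_of x$3$2 * su2_of y$0$1 + usp_of x$3$3 * su2_of y$1$1)
      = r * (2 * (Re (y $ 0) / norm y))"
    by (simp add: usp_of_def qcols_def v su2_of_def)
  have "r * (2 * (Re ((su2_of (top2 x) *v z) $ 0) / norm z)) = 2 * Re (x $ 0 * z $ 0 - cnj (x $ 1) * z $ 1) / (norm z * norm x)"
    unfolding 2 r_def using 3 by (cases "top2 x = 0") auto
  then show ?thesis
    unfolding eps_fun_def * plus_complex.simps(1)[of "_ + _" "_ + _"] distrib_left using 1 4 by simp
qed

lemma emeasure_mu_H:
  assumes [measurable]: "A \<in> sets borel"
  shows "emeasure mu_H A = (\<integral>\<^sup>+s. semicircle s * (\<integral>\<^sup>+t. semicircle t * indicator A (2 * s + 2 * t + 4) \<partial>lborel) \<partial>lborel)"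
proof -
  have "emeasure mu_H A = (\<integral>\<^sup>+U. indicator A (eps_fun U) \<partial>nu_H)"
    unfolding mu_H_def haar_Hgrp
    by (subst nn_integral_indicator[symmetric], simp, subst nn_integral_distr) simp_all
  also have "\<dots> = (\<integral>\<^sup>+z. \<integral>\<^sup>+y. indicator A (2 * (Re (z $ 0) / norm z) + 2 * (Re (y $ 0) / norm y) + 4)
      \<partial>(ball_measure :: (complex^2) measure) \<partial>(ball_measure :: (complex^2) measure))"
    by (subst nn_integral_nu_H) (simp_all add: eps_fun_block_embed)
  also have "\<dots> = (\<integral>\<^sup>+z. (\<integral>\<^sup>+t. semicircle t * indicator A (2 * (Re (z $ 0) / norm z) + 2 * t + 4) \<partial>lborel) \<partial>(ball_measure :: (complex^2) measure))"
    by (rule nn_integral_cong, rule nn_integral_semicircle) measurable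
  also have "\<dots> = (\<integral>\<^sup>+s. semicircle s * (\<integral>\<^sup>+t. semicircle t * indicator A (2 * s + 2 * t + 4) \<partial>lborel) \<partial>lborel)"
    by (rule nn_integral_semicircle[where f="\<lambda>s. (\<integral>\<^sup>+t. semicircle t * indicator A (2 * s + 2 * t + 4) \<partial>lborel)"]) measurable
  finally show ?thesis .
qed

text \<open>Left invariance allows an auxiliary random factor diag(q(z), 1) to be averaged in. For
  fixed x, rotating z removes every dependence on x except through r, so independence of the length
  and the direction of \<open>top2 x\<close> never has to be proved.\<close>

lemma emeasure_mu_G:
  assumes [measurable]: "A \<in> sets borel"
  shows "emeasure mu_G A = (\<integral>\<^sup>+r. ennreal (12 * r ^ 3 * (1 - r\<^sup>2)) * indicator {0..1} r *
     emeasure mu_H {e. r * (e - 4) + 4 \<in> A} \<partial>lborel)"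
proof -
  interpret X: prob_space "ball_measure :: (complex^4) measure" by (rule prob_space_ball_measure)
  interpret Z: prob_space "ball_measure :: (complex^2) measure" by (rule prob_space_ball_measure)
  interpret ZX: pair_prob_space "ball_measure :: (complex^2) measure" "ball_measure :: (complex^4) measure" ..
  define F where "F r = (\<integral>\<^sup>+z. \<integral>\<^sup>+y. indicator A (r * (2 * (Re (z $ 0) / norm z) + 2 * (Re (y $ 0) / norm y)) + 4)
      \<partial>(ball_measure :: (complex^2) measure) \<partial>(ball_measure :: (complex^2) measure))" for r
  have [measurable]: "F \<in> borel_measurable borel" unfolding F_def by measurable
  have F: "F r = emeasure mu_H {e. r * (e - 4) + 4 \<in> A}" for r
  proof -
    have "emeasure mu_H {e. r * (e - 4) + 4 \<in> A} = (\<integral>\<^sup>+U. indicator A (r * (eps_fun U - 4) + 4) \<partial>nu_H)"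
      unfolding mu_H_def haar_Hgrp
      by (subst nn_integral_indicator[symmetric], simp, subst nn_integral_distr) (auto intro!: nn_integral_cong simp: indicator_def)
    also have "\<dots> = F r"
      unfolding F_def by (subst nn_integral_nu_H) (simp_all add: eps_fun_block_embed)
    finally show ?thesis ..
  qed
  have "emeasure mu_G A = (\<integral>\<^sup>+U. indicator A (eps_fun U) \<partial>nu_G)"
    unfolding mu_G_def haar_USp4
    by (subst nn_integral_indicator[symmetric], simp, subst nn_integral_distr) simp_all
  also have "\<dots> = (\<integral>\<^sup>+z. (\<integral>\<^sup>+U. indicator A (eps_fun U) \<partial>nu_G) \<partial>(ball_measure :: (complex^2) measure))"
    using Z.emeasure_space_1 by simp
  also have "\<dots> = (\<integral>\<^sup>+z. (\<integral>\<^sup>+U. indicator A (eps_fun (block_embed (su2_of z) (mat 1) ** U)) \<partial>nu_G) \<partial>ball_measure)"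
  proof (intro nn_integral_cong_AE, use AE_ball_measure_nonzero in eventually_elim)
    fix z :: "complex^2" assume "z \<noteq> 0"
    then have "block_embed (su2_of z) (mat 1) \<in> USp4" by (intro block_embed_USp4 su2_of_SU2 mat_1_SU2)
    from nn_integral_nu_G_mult[OF this, of "\<lambda>U. indicator A (eps_fun U)"]
    show "(\<integral>\<^sup>+U. indicator A (eps_fun U) \<partial>nu_G) = (\<integral>\<^sup>+U. indicator A (eps_fun (block_embed (su2_of z) (mat 1) ** U)) \<partial>nu_G)"
      by simp
  qed
  also have "\<dots> = (\<integral>\<^sup>+z. \<integral>\<^sup>+x. \<integral>\<^sup>+y. indicator A (eps_fun (block_embed (su2_of z) (mat 1) ** (usp_of x ** block_embed (mat 1) (su2_of y))))
      \<partial>ball_measure \<partial>ball_measure \<partial>ball_measure)"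
    by (rule nn_integral_cong, rule nn_integral_nu_G) measurable
  also have "\<dots> = (\<integral>\<^sup>+x. \<integral>\<^sup>+z. \<integral>\<^sup>+y. indicator A (eps_fun (block_embed (su2_of z) (mat 1) ** (usp_of x ** block_embed (mat 1) (su2_of y))))
      \<partial>ball_measure \<partial>ball_measure \<partial>ball_measure)"
    by (rule ZX.Fubini'[symmetric]) measurable
  also have "\<dots> = (\<integral>\<^sup>+x. F (norm (top2 x) / norm x) \<partial>ball_measure)"
  proof (rule nn_integral_cong)
    fix x :: "complex^4"
    let ?r = "norm (top2 x) / norm x"
    let ?f = "\<lambda>z :: complex^2. \<integral>\<^sup>+y. indicator A (?r * (2 * (Re (z $ 0) / norm z) + 2 * (Re (y $ 0) / norm y)) + 4) \<partial>(ball_measure :: (complex^2) measure)"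
    show "(\<integral>\<^sup>+z. \<integral>\<^sup>+y. indicator A (eps_fun (block_embed (su2_of z) (mat 1) ** (usp_of x ** block_embed (mat 1) (su2_of y))))
        \<partial>ball_measure \<partial>ball_measure) = F ?r"
    \<comment> \<open>Here the ratio is 0 and the z-term disappears; only in the other case is
      \<open>su2_of (top2 x)\<close> unitary and available as a rotation.\<close>
    proof (cases "top2 x = 0")
      case True
      then show ?thesis unfolding eps_fun_usp_of F_def by simp
    next
      case False
      then have "unitary_mat (su2_of (top2 x))" using su2_of_SU2[OF False] by (simp add: SU2_def)
      note n = norm_unitary_mult[OF this]
      have "F ?r = (\<integral>\<^sup>+z. ?f z \<partial>ball_measure)" by (simp add: F_def)
      also have "\<dots> = (\<integral>\<^sup>+z. ?f (su2_of (top2 x) *v z) \<partial>ball_measure)"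
        by (rule nn_integral_ball_measure_isometry[symmetric, OF linear_matrix_vector_mult_complex n refl]) measurable
      finally show ?thesis unfolding eps_fun_usp_of n ..
    qed
  qed
  also have "\<dots> = (\<integral>\<^sup>+r. ennreal (12 * r ^ 3 * (1 - r\<^sup>2)) * indicator {0..1} r * F r \<partial>lborel)"
    by (rule nn_integral_top2_ratio) measurable
  finally show ?thesis unfolding F .
qed

section \<open>Catalan series and the density on the product group\<close>

lemma catalan_pos: "catalan n > 0"
  by (simp add: catalan_def)

lemma catalan_0 [simp]: "catalan 0 = 1"
  by (simp add: catalan_def)

lemma catalan_Suc: "catalan (Suc n) = (4 * n + 2) / (n + 2) * catalan n"
proof -
  have f: "fact (2 * n) \<noteq> (0::real)" "fact n \<noteq> (0::real)" by simp_all
  have "real (2 * Suc n choose Suc n) = fact (2 * Suc n) / (fact (Suc n) * fact (Suc n))"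
    by (subst binomial_fact) (simp_all del: fact_Suc)
  also have "\<dots> = 2 * (2 * n + 1) / (n + 1) * (fact (2 * n) / (fact n * fact n))"
    using f by (simp add: divide_simps) (simp add: algebra_simps)
  also have "fact (2 * n) / (fact n * fact n) = real (2 * n choose n)"
    by (subst binomial_fact) simp_all
  finally have b: "real (2 * Suc n choose Suc n) = 2 * (2 * n + 1) / (n + 1) * real (2 * n choose n)" .
  show ?thesis
    unfolding catalan_def b by (simp add: divide_simps) (simp add: algebra_simps)
qed

lemma catalan_le: "catalan n \<le> 4 ^ n"
proof (induction n)
  case (Suc n)
  have "catalan (Suc n) \<le> 4 * catalan n"
    unfolding catalan_Suc using catalan_pos[of n] by (intro mult_right_mono) (auto simp: divide_simps)
  with Suc show ?case by simp
qed simp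

text \<open>The Catalan generating function at x / 4, taken from the binomial series with exponent
  1/2. All coefficients on the left are positive, which later permits termwise integration.\<close>

lemma sqrt_catalan_series:
  fixes x :: real
  assumes "\<bar>x\<bar> < 1"
  shows "(\<lambda>n. 2 * catalan n * (x / 4) ^ Suc n) sums (1 - sqrt (1 - x))"
proof -
  have b: "(1 / 2 gchoose Suc n) * (- 1) ^ Suc n = - 2 * catalan n / 4 ^ Suc n" for n
  proof (induction n)
    case (Suc n)
    have "(1 / 2 gchoose Suc (Suc n)) = (1 / 2 - real (Suc n)) / real (Suc (Suc n)) * (1 / 2 gchoose Suc n)"
      using gbinomial_mult_1[of "1 / 2 :: real" "Suc n"] by (simp add: field_simps del: of_nat_Suc)
    then have "(1 / 2 gchoose Suc (Suc n)) * (- 1) ^ Suc (Suc n) =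
        - ((1 / 2 - real (Suc n)) / real (Suc (Suc n))) * ((1 / 2 gchoose Suc n) * (- 1) ^ Suc n)"
      by simp
    also have "\<dots> = - 2 * catalan (Suc n) / 4 ^ Suc (Suc n)"
      unfolding Suc.IH catalan_Suc by (simp add: divide_simps) (simp add: algebra_simps)
    finally show ?case .
  qed simp
  have "(\<lambda>n. (1 / 2 gchoose n) * (- x) ^ n) sums sqrt (1 + - x)"
    using assms by (intro sqrt_series) simp
  then have "(\<lambda>n. (1 / 2 gchoose Suc n) * (- x) ^ Suc n) sums (sqrt (1 + - x) - 1)"
    by (subst sums_Suc_iff) simp
  then have "(\<lambda>n. - ((1 / 2 gchoose Suc n) * (- x) ^ Suc n)) sums (- (sqrt (1 + - x) - 1))"
    by (rule sums_minus)
  also have "(\<lambda>n. - ((1 / 2 gchoose Suc n) * (- x) ^ Suc n)) = (\<lambda>n. 2 * catalan n * (x / 4) ^ Suc n)"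
  proof
    fix n
    have "- ((1 / 2 gchoose Suc n) * (- x) ^ Suc n) = - ((1 / 2 gchoose Suc n) * (- 1) ^ Suc n) * x ^ Suc n"
      by (subst power_minus) (simp only: mult_ac minus_mult_left)
    also have "\<dots> = 2 * catalan n * (x / 4) ^ Suc n"
      unfolding b by (simp add: power_divide)
    finally show "- ((1 / 2 gchoose Suc n) * (- x) ^ Suc n) = 2 * catalan n * (x / 4) ^ Suc n" .
  qed
  finally show ?thesis by simp
qed

text \<open>Catalan numbers are the even moments of the semicircle. The function t^(2n+1) (1 -
  t^2)^(3/2) vanishes at both endpoints, and integrating its derivative gives the moment recurrence
  with factor (2n + 1) / (2n + 4), which is a quarter of the factor in
  \<open>catalan_Suc\<close>.\<close>

lemma semicircle_moment:
  "((\<lambda>t. t ^ (2 * n) * sqrt (1 - t\<^sup>2)) has_integral (pi / 2 * catalan n / 4 ^ n)) {-1..1}"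
proof (induction n)
  case 0
  have "((\<lambda>t. sqrt (1 - t\<^sup>2)) has_integral ((1 * sqrt (1 - 1\<^sup>2) + arcsin 1) / 2 - ((-1) * sqrt (1 - (-1)\<^sup>2) + arcsin (-1)) / 2)) {-1..1}"
  proof (rule fundamental_theorem_of_calculus_interior)
    fix t :: real assume t: "t \<in> {-1<..<1}"
    then have t2: "t\<^sup>2 < 1" by (simp add: abs_square_less_1 abs_less_iff)
    define y where "y = sqrt (1 - t\<^sup>2)"
    have y: "y > 0" "y * y = 1 - t * t" using t2 by (auto simp: y_def power2_eq_square)
    have dy: "((\<lambda>t. sqrt (1 - t\<^sup>2)) has_real_derivative (- t / y)) (at t)"
      using t2 unfolding y_def by (auto intro!: derivative_eq_intros simp: field_simps)
    have da: "(arcsin has_real_derivative inverse y) (at t)"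
      unfolding y_def using t by (intro DERIV_arcsin) auto
    have "((\<lambda>t. (t * sqrt (1 - t\<^sup>2) + arcsin t) / 2) has_real_derivative ((1 * y + (- t / y) * t + inverse y) / 2)) (at t)"
      unfolding y_def by (intro DERIV_cdivide DERIV_add DERIV_mult DERIV_ident dy[unfolded y_def] da[unfolded y_def])
    also have "(1 * y + (- t / y) * t + inverse y) / 2 = y"
      using y by (simp add: field_simps)
    finally show "((\<lambda>t. (t * sqrt (1 - t\<^sup>2) + arcsin t) / 2) has_vector_derivative sqrt (1 - t\<^sup>2)) (at t)"
      unfolding has_real_derivative_iff_has_vector_derivative[symmetric] y_def .
  qed (auto intro!: continuous_intros)
  then show ?case by simp
next
  case (Suc n)
  have "((\<lambda>t. (2 * n + 1) * (t ^ (2 * n) * sqrt (1 - t\<^sup>2)) - (2 * n + 4) * (t ^ (2 * Suc n) * sqrt (1 - t\<^sup>2))) has_integral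
     (1 ^ (2 * n + 1) * sqrt (1 - 1\<^sup>2) ^ 3 - (-1) ^ (2 * n + 1) * sqrt (1 - (-1)\<^sup>2) ^ 3)) {-1..1}"
  proof (rule fundamental_theorem_of_calculus_interior)
    fix t :: real assume t: "t \<in> {-1<..<1}"
    then have t2: "t\<^sup>2 < 1" by (simp add: abs_square_less_1 abs_less_iff)
    define y where "y = sqrt (1 - t\<^sup>2)"
    have y: "y > 0" "y * y = 1 - t * t" using t2 by (auto simp: y_def power2_eq_square)
    have dy: "((\<lambda>t. sqrt (1 - t\<^sup>2)) has_real_derivative (- t / y)) (at t)"
      using t2 unfolding y_def by (auto intro!: derivative_eq_intros simp: field_simps)
    have eq: "real (2 * n + 1) * (1 * t ^ (2 * n + 1 - Suc 0)) * y ^ 3 + real 3 * ((- t / y) * y ^ (3 - Suc 0)) * t ^ (2 * n + 1) =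
        (2 * n + 1) * (t ^ (2 * n) * y) - (2 * n + 4) * (t ^ (2 * Suc n) * y)"
    proof -
      have "real (2 * n + 1) * (1 * t ^ (2 * n + 1 - Suc 0)) * y ^ 3 + real 3 * ((- t / y) * y ^ (3 - Suc 0)) * t ^ (2 * n + 1) =
         t ^ (2 * n) * y * ((2 * n + 1) * (y * y) - 3 * (t * t))"
        using y(1) by (simp add: algebra_simps power3_eq_cube power2_eq_square)
      also have "\<dots> = (2 * n + 1) * (t ^ (2 * n) * y) - (2 * n + 4) * (t ^ (2 * Suc n) * y)"
        unfolding y(2) by (simp add: algebra_simps)
      finally show ?thesis .
    qed
    show "((\<lambda>t. t ^ (2 * n + 1) * sqrt (1 - t\<^sup>2) ^ 3) has_vector_derivative
        (2 * n + 1) * (t ^ (2 * n) * sqrt (1 - t\<^sup>2)) - (2 * n + 4) * (t ^ (2 * Suc n) * sqrt (1 - t\<^sup>2))) (at t)"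
      unfolding has_real_derivative_iff_has_vector_derivative[symmetric] y_def[symmetric] eq[symmetric]
      using DERIV_mult[OF DERIV_power[OF DERIV_ident, of "2 * n + 1"] DERIV_power[OF dy, of 3]]
      unfolding y_def .
  qed (auto intro!: continuous_intros)
  from has_integral_diff[OF has_integral_mult_right[OF Suc.IH, of "2 * n + 1"] this]
  have I: "((\<lambda>t. (2 * n + 4) * (t ^ (2 * Suc n) * sqrt (1 - t\<^sup>2))) has_integral ((2 * n + 1) * (pi / 2 * catalan n / 4 ^ n))) {-1..1}"
    by simp
  have "1 / c * (c * x) = x" if "c \<noteq> 0" for c x :: real using that by simp
  from this[of "real (2 * n + 4)"] has_integral_mult_right[OF I, of "1 / (2 * n + 4)"]
  have "((\<lambda>t. t ^ (2 * Suc n) * sqrt (1 - t\<^sup>2)) has_integral (1 / (2 * n + 4) * ((2 * n + 1) * (pi / 2 * catalan n / 4 ^ n)))) {-1..1}"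
    by (simp only: of_nat_eq_0_iff)
  also have "1 / (2 * n + 4) * ((2 * n + 1) * (pi / 2 * catalan n / 4 ^ n)) = pi / 2 * catalan (Suc n) / 4 ^ Suc n"
    unfolding catalan_Suc by (simp add: divide_simps)
  finally show ?case .
qed

lemma summable_catalan_mult:
  assumes "\<bar>z\<bar> < 1"
  shows "summable (\<lambda>n. catalan n * catalan (n + k) / 16 ^ n * z ^ n)"
proof (rule summable_comparison_test')
  show "summable (\<lambda>n. 4 ^ k * \<bar>z\<bar> ^ n)"
    using assms by (intro summable_mult summable_geometric) simp
  fix n :: nat
  have "catalan n * catalan (n + k) \<le> 4 ^ n * 4 ^ (n + k)"
    using catalan_pos by (intro mult_mono catalan_le) (auto intro: less_imp_le)
  also have "\<dots> = 4 ^ k * 16 ^ n"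
    by (simp add: power_add flip: power_mult_distrib)
  finally have "catalan n * catalan (n + k) / 16 ^ n \<le> 4 ^ k" by (simp add: divide_le_eq)
  then have "catalan n * catalan (n + k) / 16 ^ n * \<bar>z\<bar> ^ n \<le> 4 ^ k * \<bar>z\<bar> ^ n"
    by (rule mult_right_mono) simp
  then show "norm (catalan n * catalan (n + k) / 16 ^ n * z ^ n) \<le> 4 ^ k * \<bar>z\<bar> ^ n"
    using catalan_pos[of n] catalan_pos[of "n + k"]
    by (simp add: abs_mult power_abs)
qed

text \<open>As a power series this is the hypergeometric function 2F1(-1/2, 1/2; 2; z); the argument
  is z = rho^2.\<close>

definition ser_H :: "real \<Rightarrow> real" where
  "ser_H z = 1 - z / 8 * (\<Sum>n. catalan n * catalan (n + 1) / 16 ^ n * z ^ n)"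

text \<open>One factor C_n comes from expanding 1 - sqrt(1 - r^2 t^2), the other, C_(n+1), from the
  semicircle moment of t^(2n+2). Working with the complement of the square root makes all terms
  nonnegative, so the sum and the integral may be exchanged. The constant 1/8 is 2 / 16.\<close>

lemma elliptic_integral:
  fixes r :: real
  assumes r: "0 \<le> r" "r < 1"
  shows "((\<lambda>t. sqrt (1 - t\<^sup>2) * sqrt (1 - r\<^sup>2 * t\<^sup>2)) has_integral (pi / 2 * ser_H (r\<^sup>2))) {-1..1}"
proof -
  have r2: "r\<^sup>2 < 1" using r by (simp add: abs_square_less_1)
  let ?f = "\<lambda>t. sqrt (1 - t\<^sup>2) * (1 - sqrt (1 - r\<^sup>2 * t\<^sup>2))"
  let ?u = "\<lambda>n t. 2 * catalan n * (r\<^sup>2 / 4) ^ Suc n * (t ^ (2 * Suc n) * sqrt (1 - t\<^sup>2))"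
  let ?c = "\<lambda>n. 2 * catalan n * (r\<^sup>2 / 4) ^ Suc n * (pi / 2 * catalan (Suc n) / 4 ^ Suc n)"
  let ?S = "\<Sum>n. catalan n * catalan (n + 1) / 16 ^ n * (r\<^sup>2) ^ n"
  have rt: "r\<^sup>2 * t\<^sup>2 < 1" "0 \<le> r\<^sup>2 * t\<^sup>2" "t\<^sup>2 \<le> 1" if "t \<in> {-1..1}" for t
  proof -
    show t: "t\<^sup>2 \<le> 1" using that by (simp add: abs_square_le_1 abs_le_iff)
    then have "r\<^sup>2 * t\<^sup>2 \<le> r\<^sup>2 * 1" by (intro mult_left_mono) auto
    then show "r\<^sup>2 * t\<^sup>2 < 1" using r2 by simp
  qed simp
  have te: "0 \<le> t ^ (2 * Suc n)" for t :: real and n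
    by (rule zero_le_even_power) simp
  have S: "(\<lambda>n. catalan n * catalan (n + 1) / 16 ^ n * (r\<^sup>2) ^ n) sums ?S"
    using summable_catalan_mult[of "r\<^sup>2" 1] r2 by (simp add: summable_sums)
  have c: "?c = (\<lambda>n. pi / 2 * (r\<^sup>2 / 8) * (catalan n * catalan (n + 1) / 16 ^ n * (r\<^sup>2) ^ n))"
  proof
    fix n
    have "(16::real) ^ n = 4 ^ n * 4 ^ n" by (simp flip: power_mult_distrib)
    then show "?c n = pi / 2 * (r\<^sup>2 / 8) * (catalan n * catalan (n + 1) / 16 ^ n * (r\<^sup>2) ^ n)"
      by (simp add: power_divide)
  qed
  have csums: "?c sums (pi / 2 * (r\<^sup>2 / 8) * ?S)"
    unfolding c by (rule sums_mult[OF S])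
  have cnn: "0 \<le> ?c n" for n using catalan_pos[of n] catalan_pos[of "Suc n"] by simp
  have fint: "(?f has_integral integral {-1..1} ?f) {-1..1}"
    by (intro integrable_integral integrable_continuous_real continuous_intros)
  have fnn: "0 \<le> ?f t" if "t \<in> {-1..1}" for t using rt[OF that] by simp
  have "ennreal (integral {-1..1} ?f) = (\<integral>\<^sup>+t. ennreal (?f t) * indicator {-1..1} t \<partial>lborel)"
    by (rule nn_integral_has_integral_lebesgue'[symmetric, OF fnn fint])
  also have "\<dots> = (\<integral>\<^sup>+t. (\<Sum>n. ennreal (?u n t) * indicator {-1..1} t) \<partial>lborel)"
  proof (rule nn_integral_cong)
    fix t :: real
    show "ennreal (?f t) * indicator {-1..1} t = (\<Sum>n. ennreal (?u n t) * indicator {-1..1} t)"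
    proof (cases "t \<in> {-1..1}")
      case True
      have "(\<lambda>n. 2 * catalan n * ((r\<^sup>2 * t\<^sup>2) / 4) ^ Suc n) sums (1 - sqrt (1 - r\<^sup>2 * t\<^sup>2))"
        using rt[OF True] by (intro sqrt_catalan_series) simp
      from sums_mult[OF this, of "sqrt (1 - t\<^sup>2)"]
      have s: "(\<lambda>n. ?u n t) sums ?f t"
      proof (rule back_subst[of "\<lambda>f. f sums _"], intro ext)
        fix n
        have "(r\<^sup>2 * t\<^sup>2) / 4 = (r\<^sup>2 / 4) * t\<^sup>2" by simp
        then show "sqrt (1 - t\<^sup>2) * (2 * catalan n * ((r\<^sup>2 * t\<^sup>2) / 4) ^ Suc n) = ?u n t"
          unfolding power_mult by (simp only: power_mult_distrib mult_ac)
      qed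
      have "0 \<le> ?u n t" for n
        using rt[OF True] catalan_pos[of n] by (intro mult_nonneg_nonneg te) auto
      then have "(\<Sum>n. ennreal (?u n t)) = ennreal (\<Sum>n. ?u n t)"
        using s by (intro suminf_ennreal2) (auto simp: sums_iff)
      then show ?thesis using True s by (simp add: sums_iff)
    qed simp
  qed
  also have "\<dots> = (\<Sum>n. (\<integral>\<^sup>+t. ennreal (?u n t) * indicator {-1..1} t \<partial>lborel))"
    by (rule nn_integral_suminf) measurable
  also have "\<dots> = (\<Sum>n. ennreal (?c n))"
  proof (intro suminf_cong)
    fix n
    show "(\<integral>\<^sup>+t. ennreal (?u n t) * indicator {-1..1} t \<partial>lborel) = ennreal (?c n)"
    proof (rule nn_integral_has_integral_lebesgue'[OF _ has_integral_mult_right[OF semicircle_moment]])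
      fix t :: real assume "t \<in> {-1..1}"
      then show "0 \<le> ?u n t"
        using rt[of t] catalan_pos[of n] by (intro mult_nonneg_nonneg te) auto
    qed
  qed
  also have "\<dots> = ennreal (\<Sum>n. ?c n)"
    using csums by (intro suminf_ennreal2 cnn) (simp add: sums_iff)
  also have "(\<Sum>n. ?c n) = pi / 2 * (r\<^sup>2 / 8) * ?S"
    using csums by (simp add: sums_iff)
  finally have "ennreal (integral {-1..1} ?f) = ennreal (pi / 2 * (r\<^sup>2 / 8) * ?S)" .
  moreover have "0 \<le> integral {-1..1} ?f"
    by (rule integral_nonneg[OF has_integral_integrable[OF fint]]) (rule fnn)
  moreover have "0 \<le> pi / 2 * (r\<^sup>2 / 8) * ?S"
    by (rule sums_le[OF cnn sums_zero csums])
  ultimately have "integral {-1..1} ?f = pi / 2 * (r\<^sup>2 / 8) * ?S"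
    by (subst (asm) ennreal_inj)
  with fint have f: "(?f has_integral (pi / 2 * (r\<^sup>2 / 8) * ?S)) {-1..1}" by simp
  have "((\<lambda>t. sqrt (1 - t\<^sup>2)) has_integral (pi / 2)) {-1..1}"
    using semicircle_moment[of 0] by simp
  from has_integral_diff[OF this f] show ?thesis
    by (simp add: ser_H_def algebra_simps)
qed

section \<open>Convolution of two semicircle laws\<close>

lemma dens_H_eq: "dens_H e = e\<^sup>2 * (8 - e) / (64 * pi) * ser_H ((rho e)\<^sup>2)"
  by (simp add: dens_H_def ser_H_def power_mult)

lemma measurable_dens_H [measurable]: "dens_H \<in> borel_measurable borel"
  unfolding dens_H_def[abs_def] rho_def by measurable

lemma semicircle_eq_0:
  assumes "\<bar>s\<bar> \<ge> 1" shows "semicircle s = 0"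
proof -
  have "s\<^sup>2 \<ge> 1" using assms by (metis abs_square_less_1 not_less)
  then show ?thesis by (simp add: semicircle_def ennreal_neg mult_le_0_iff divide_le_0_iff)
qed

lemma rho_bounds:
  assumes "0 < e" "e < 4" shows "0 < rho e" "rho e < 1"
  using assms by (auto simp: rho_def)

text \<open>For 0 < e < 4 the supports overlap in the interval from -1 to e/2 - 1, and s = e/4 - 1 +
  (e/4) t maps [-1, 1] onto it. The inner endpoints give the factor 1 - t^2; the outer ones give (8
  - e)^2 - e^2 t^2, which is where rho = e / (8 - e) originates. The value is twice the density
  because e = 2 s + 2 t + 4 has Jacobian 1/2.\<close>

lemma nn_integral_semicircle_convolution:
  assumes e: "e < 4"
  shows "(\<integral>\<^sup>+s. semicircle s * semicircle ((e - 4) / 2 - s) \<partial>lborel) = ennreal (2 * dens_H e) * indicator {0<..} e"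
proof (cases "e > 0")
  case False
  have "semicircle s * semicircle ((e - 4) / 2 - s) = 0" for s
  proof (cases "s \<le> -1")
    case True then show ?thesis by (simp add: semicircle_eq_0)
  next
    case s: False
    have "(e - 4) / 2 \<le> -2" using False by simp
    with s have "(e - 4) / 2 - s \<le> -1" by linarith
    then have "\<bar>(e - 4) / 2 - s\<bar> \<ge> 1" by linarith
    then show ?thesis by (simp add: semicircle_eq_0)
  qed
  then have "(\<lambda>s. semicircle s * semicircle ((e - 4) / 2 - s)) = (\<lambda>s. 0)" by (rule ext)
  then show ?thesis using False by simp
next
  case True
  define r where "r = rho e"
  have r: "0 \<le> r" "r < 1" using rho_bounds[OF True e] by (auto simp: r_def)
  let ?k = "4 / pi\<^sup>2 * (e * (8 - e) / 16)"
  have k: "?k \<ge> 0" using True e by simp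
  have ptw: "semicircle (e / 4 - 1 + e / 4 * t) * semicircle ((e - 4) / 2 - (e / 4 - 1 + e / 4 * t)) =
      ennreal (?k * (sqrt (1 - t\<^sup>2) * sqrt (1 - r\<^sup>2 * t\<^sup>2))) * indicator {-1..1} t" for t
  proof -
    consider "t < -1" | "t > 1" | "t \<in> {-1..1}" by force
    then show ?thesis
    proof cases
      case 1
      then have "e / 4 * t \<le> e / 4 * (-1)" using True by (intro mult_left_mono) auto
      then have "semicircle (e / 4 - 1 + e / 4 * t) = 0" by (intro semicircle_eq_0) linarith
      then show ?thesis using 1 by simp
    next
      case 2
      then have "e / 4 * 1 \<le> e / 4 * t" using True by (intro mult_left_mono) auto
      then have "\<bar>(e - 4) / 2 - (e / 4 - 1 + e / 4 * t)\<bar> \<ge> 1" by (simp add: field_simps)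
      then have "semicircle ((e - 4) / 2 - (e / 4 - 1 + e / 4 * t)) = 0" by (rule semicircle_eq_0)
      then show ?thesis using 2 by simp
    next
      case 3
      have p: "0 \<le> 1 - (e / 4 - 1 + e / 4 * t)\<^sup>2" "0 \<le> 1 - ((e - 4) / 2 - (e / 4 - 1 + e / 4 * t))\<^sup>2"
      proof -
        have "0 \<le> e / 4 * (1 + t)" "e / 4 * (1 + t) \<le> 1 * 2" "0 \<le> e / 4 * (1 - t)" "e / 4 * (1 - t) \<le> 1 * 2"
          using 3 True e by (intro mult_nonneg_nonneg mult_mono; simp)+
        then have "\<bar>e / 4 - 1 + e / 4 * t\<bar> \<le> 1" "\<bar>(e - 4) / 2 - (e / 4 - 1 + e / 4 * t)\<bar> \<le> 1"
          by (auto simp: abs_le_iff field_simps)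
        then show "0 \<le> 1 - (e / 4 - 1 + e / 4 * t)\<^sup>2" "0 \<le> 1 - ((e - 4) / 2 - (e / 4 - 1 + e / 4 * t))\<^sup>2"
          by (simp_all add: abs_square_le_1)
      qed
      have "(1 - (e / 4 - 1 + e / 4 * t)\<^sup>2) * (1 - ((e - 4) / 2 - (e / 4 - 1 + e / 4 * t))\<^sup>2) =
          (e / 4 * (1 + t) * ((8 - e) - e * t) / 4) * (e / 4 * (1 - t) * ((8 - e) + e * t) / 4)"
        by (intro arg_cong2[where f="(*)"]) (simp_all add: field_simps power2_eq_square)
      also have "\<dots> = (e / 16)\<^sup>2 * (1 - t\<^sup>2) * ((8 - e)\<^sup>2 - e\<^sup>2 * t\<^sup>2)"
        by (simp add: field_simps power2_eq_square)
      also have "(8 - e)\<^sup>2 - e\<^sup>2 * t\<^sup>2 = (8 - e)\<^sup>2 * (1 - r\<^sup>2 * t\<^sup>2)"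
        using e by (simp add: r_def rho_def field_simps power_divide)
      finally have "(1 - (e / 4 - 1 + e / 4 * t)\<^sup>2) * (1 - ((e - 4) / 2 - (e / 4 - 1 + e / 4 * t))\<^sup>2) =
        (e * (8 - e) / 16)\<^sup>2 * ((1 - t\<^sup>2) * (1 - r\<^sup>2 * t\<^sup>2))" by (simp add: power_mult_distrib power_divide mult_ac)
      then have S1: "sqrt (1 - (e / 4 - 1 + e / 4 * t)\<^sup>2) * sqrt (1 - ((e - 4) / 2 - (e / 4 - 1 + e / 4 * t))\<^sup>2) =
          e * (8 - e) / 16 * (sqrt (1 - t\<^sup>2) * sqrt (1 - r\<^sup>2 * t\<^sup>2))"
        using True e by (simp flip: real_sqrt_mult) (simp add: real_sqrt_mult)
      have S2: "semicircle (e / 4 - 1 + e / 4 * t) * semicircle ((e - 4) / 2 - (e / 4 - 1 + e / 4 * t)) =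
         ennreal (4 / pi\<^sup>2 * (sqrt (1 - (e / 4 - 1 + e / 4 * t)\<^sup>2) * sqrt (1 - ((e - 4) / 2 - (e / 4 - 1 + e / 4 * t))\<^sup>2)))"
        unfolding semicircle_def using p
        by (subst ennreal_mult[symmetric]) (simp_all add: power2_eq_square[of pi])
      show ?thesis unfolding S2 S1 using 3 by (simp add: mult.assoc)
    qed
  qed
  have "(\<integral>\<^sup>+s. semicircle s * semicircle ((e - 4) / 2 - s) \<partial>lborel) =
     ennreal (e / 4) * (\<integral>\<^sup>+t. semicircle (e / 4 - 1 + e / 4 * t) * semicircle ((e - 4) / 2 - (e / 4 - 1 + e / 4 * t)) \<partial>lborel)"
    using True by (subst nn_integral_real_affine[where c="e / 4" and t="e / 4 - 1"]) simp_all
  also have "\<dots> = ennreal (e / 4) * ennreal (?k * (pi / 2 * ser_H (r\<^sup>2)))"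
    unfolding ptw
  proof (subst nn_integral_has_integral_lebesgue'[OF _ has_integral_mult_right[OF elliptic_integral[OF r]]])
    fix t :: real assume "t \<in> {-1..1}"
    then have t: "t\<^sup>2 \<le> 1" by (simp add: abs_square_le_1 abs_le_iff)
    moreover have "r\<^sup>2 * t\<^sup>2 \<le> 1 * 1" using r t by (intro mult_mono) (auto simp: power_le_one)
    ultimately show "0 \<le> ?k * (sqrt (1 - t\<^sup>2) * sqrt (1 - r\<^sup>2 * t\<^sup>2))"
      by (intro mult_nonneg_nonneg[OF k]) simp
  qed simp
  also have "\<dots> = ennreal (e / 4 * (?k * (pi / 2 * ser_H (r\<^sup>2))))"
    using True by (intro ennreal_mult'[symmetric]) simp
  also have "e / 4 * (?k * (pi / 2 * ser_H (r\<^sup>2))) = 2 * dens_H e"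
    by (simp add: dens_H_eq r_def power2_eq_square)
  finally show ?thesis using True by simp
qed

text \<open>The sign is not visible in the series but is visible in the elliptic integral it
  represents.\<close>

lemma dens_H_nonneg:
  assumes "0 \<le> e" "e < 4"
  shows "0 \<le> dens_H e"
proof -
  have "0 \<le> rho e" "rho e < 1" using assms by (auto simp: rho_def)
  then have r: "(\<lambda>t. sqrt (1 - t\<^sup>2) * sqrt (1 - (rho e)\<^sup>2 * t\<^sup>2)) integrable_on {-1..1}" 
    "integral {-1..1} (\<lambda>t. sqrt (1 - t\<^sup>2) * sqrt (1 - (rho e)\<^sup>2 * t\<^sup>2)) = pi / 2 * ser_H ((rho e)\<^sup>2)"
    using elliptic_integral[of "rho e"] by (blast intro: has_integral_integrable integral_unique)+
  have "0 \<le> integral {-1..1} (\<lambda>t. sqrt (1 - t\<^sup>2) * sqrt (1 - (rho e)\<^sup>2 * t\<^sup>2))"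
  proof (rule integral_nonneg[OF r(1)])
    fix t :: real assume "t \<in> {-1..1}"
    then have t: "t\<^sup>2 \<le> 1" by (simp add: abs_square_le_1 abs_le_iff)
    moreover have "(rho e)\<^sup>2 * t\<^sup>2 \<le> 1 * 1"
      using \<open>0 \<le> rho e\<close> \<open>rho e < 1\<close> t by (intro mult_mono) (auto simp: power_le_one)
    ultimately show "0 \<le> sqrt (1 - t\<^sup>2) * sqrt (1 - (rho e)\<^sup>2 * t\<^sup>2)" by simp
  qed
  then have "0 \<le> ser_H ((rho e)\<^sup>2)" unfolding r(2) using pi_gt_zero by (auto simp: zero_le_mult_iff)
  then show ?thesis using assms by (simp add: dens_H_eq)
qed

text \<open>The set may reach below 0, and the indicator of \<open>{0<..}\<close> is kept, because
  the rescaled sets \<open>{e. r * (e - 4) + 4 \<in> A}\<close> to which this is applied can contain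
  negative points.\<close>

lemma emeasure_mu_H_density:
  assumes [measurable]: "A \<in> sets borel" and A: "A \<subseteq> {..<4}"
  shows "emeasure mu_H A = (\<integral>\<^sup>+e. ennreal (dens_H e) * indicator {0<..} e * indicator A e \<partial>lborel)"
proof -
  have "emeasure mu_H A = (\<integral>\<^sup>+s. \<integral>\<^sup>+e. ennreal (1 / 2) * (semicircle s * semicircle ((e - 4) / 2 - s) * indicator A e) \<partial>lborel \<partial>lborel)"
    unfolding emeasure_mu_H[OF assms(1)]
  proof (rule nn_integral_cong)
    fix s :: real
    have "(\<integral>\<^sup>+t. semicircle t * indicator A (2 * s + 2 * t + 4) \<partial>lborel) =
        ennreal (1 / 2) * (\<integral>\<^sup>+e. semicircle ((e - 4) / 2 - s) * indicator A e \<partial>lborel)"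
      by (subst nn_integral_real_affine[where c="1 / 2" and t="-2 - s"])
        (auto intro!: arg_cong2[where f="(*)"] nn_integral_cong arg_cong[where f=semicircle] arg_cong[where f="indicator A"] simp: field_simps)
    then show "semicircle s * (\<integral>\<^sup>+t. semicircle t * indicator A (2 * s + 2 * t + 4) \<partial>lborel) =
        (\<integral>\<^sup>+e. ennreal (1 / 2) * (semicircle s * semicircle ((e - 4) / 2 - s) * indicator A e) \<partial>lborel)"
      by (simp add: nn_integral_cmult[symmetric] mult_ac)
  qed
  also have "\<dots> = (\<integral>\<^sup>+e. \<integral>\<^sup>+s. ennreal (1 / 2) * (semicircle s * semicircle ((e - 4) / 2 - s) * indicator A e) \<partial>lborel \<partial>lborel)"
    by (rule lborel_pair.Fubini') measurable
  also have "\<dots> = (\<integral>\<^sup>+e. ennreal (dens_H e) * indicator {0<..} e * indicator A e \<partial>lborel)"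
  proof (rule nn_integral_cong)
    fix e :: real
    have "(\<integral>\<^sup>+s. ennreal (1 / 2) * (semicircle s * semicircle ((e - 4) / 2 - s) * indicator A e) \<partial>lborel) =
       ennreal (1 / 2) * (\<integral>\<^sup>+s. semicircle s * semicircle ((e - 4) / 2 - s) \<partial>lborel) * indicator A e"
      by (subst nn_integral_cmult, simp, subst nn_integral_multc) (simp_all add: mult.assoc)
    also have "\<dots> = ennreal (dens_H e) * indicator {0<..} e * indicator A e"
    proof (cases "e \<in> A \<and> 0 < e")
      case True
      then have "e < 4" using A by auto
      moreover have "ennreal (1 / 2) * ennreal (2 * dens_H e) = ennreal (dens_H e)"
        by (subst ennreal_mult'[symmetric]) simp_all
      ultimately show ?thesis using True
        by (simp only: nn_integral_semicircle_convolution) simp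
    next
      case False
      then show ?thesis using A
        by (cases "e \<in> A") (auto simp: nn_integral_semicircle_convolution)
    qed
    finally show "(\<integral>\<^sup>+s. ennreal (1 / 2) * (semicircle s * semicircle ((e - 4) / 2 - s) * indicator A e) \<partial>lborel) =
       ennreal (dens_H e) * indicator {0<..} e * indicator A e" .
  qed
  finally show ?thesis .
qed

section \<open>The differential equation and the density on the symplectic group\<close>

text \<open>The constant term is folded into the coefficient sequence so that a single recurrence
  holds from n = 0 on.\<close>

definition coeff_G :: "nat \<Rightarrow> real" where
  "coeff_G n = (case n of 0 \<Rightarrow> 1 | Suc k \<Rightarrow> - (catalan k * catalan (k + 2) / 16 ^ k) / 8)"

definition ser_G :: "real \<Rightarrow> real" where
  "ser_G z = (\<Sum>n. coeff_G n * z ^ n)"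

definition ser_G' :: "real \<Rightarrow> real" where
  "ser_G' z = (\<Sum>n. diffs coeff_G n * z ^ n)"

definition ser_G'' :: "real \<Rightarrow> real" where
  "ser_G'' z = (\<Sum>n. diffs (diffs coeff_G) n * z ^ n)"

text \<open>The hypergeometric ratio (n + a)(n + b) / ((n + 1)(n + c)) with a = -1/2, b = 3/2, c =
  3, cleared of denominators. The case n = 0 joins the constant 1 to the first Catalan product and
  is checked by hand.\<close>

lemma coeff_G_Suc: "(real n + 1) * (real n + 3) * coeff_G (Suc n) = (n - 1 / 2) * (n + 3 / 2) * coeff_G n"
proof (cases n)
  case 0
  have "catalan (Suc (Suc 0)) = 2" by (simp add: catalan_Suc)
  then show ?thesis using 0 by (simp add: coeff_G_def)
next
  case (Suc k)
  have c: "catalan (k + 3) = (4 * k + 10) / (k + 4) * catalan (k + 2)" "catalan (Suc k) = (4 * k + 2) / (k + 2) * catalan k"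
    using catalan_Suc[of "k + 2"] catalan_Suc[of k] by (simp_all add: algebra_simps eval_nat_numeral)
  have "coeff_G (Suc n) = - (catalan (Suc k) * catalan (k + 3) / 16 ^ Suc k) / 8"
    unfolding Suc coeff_G_def by (simp add: eval_nat_numeral)
  also have "\<dots> = ((4 * k + 10) / (k + 4)) * ((4 * k + 2) / (k + 2)) / 16 * coeff_G n"
    unfolding c by (simp add: Suc coeff_G_def mult_ac)
  finally show ?thesis
    unfolding Suc by (simp add: divide_simps) (simp add: algebra_simps)
qed

lemma ser_G_sums:
  assumes "\<bar>z\<bar> < 1"
  shows "(\<lambda>n. coeff_G n * z ^ n) sums (1 - z / 8 * (\<Sum>n. catalan n * catalan (n + 2) / 16 ^ n * z ^ n))"
proof -
  have "(\<lambda>n. catalan n * catalan (n + 2) / 16 ^ n * z ^ n) sums (\<Sum>n. catalan n * catalan (n + 2) / 16 ^ n * z ^ n)"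
    using summable_catalan_mult[OF assms] by (rule summable_sums)
  from sums_mult[OF this, of "- z / 8"]
  have "(\<lambda>n. coeff_G (Suc n) * z ^ Suc n) sums (- z / 8 * (\<Sum>n. catalan n * catalan (n + 2) / 16 ^ n * z ^ n))"
    by (rule back_subst[of "\<lambda>f. f sums _"]) (simp add: fun_eq_iff coeff_G_def mult_ac)
  then show ?thesis
    by (subst (asm) sums_Suc_iff) (simp add: coeff_G_def)
qed

lemma ser_G_eq: "\<bar>z\<bar> < 1 \<Longrightarrow> ser_G z = 1 - z / 8 * (\<Sum>n. catalan n * catalan (n + 2) / 16 ^ n * z ^ n)"
  unfolding ser_G_def using ser_G_sums by (simp add: sums_iff)

lemma summable_coeff_G: "\<bar>z\<bar> < 1 \<Longrightarrow> summable (\<lambda>n. coeff_G n * z ^ n)"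
  using ser_G_sums by (blast intro: sums_summable)

lemma summable_diffs:
  fixes c :: "nat \<Rightarrow> real"
  assumes "\<And>z. \<bar>z\<bar> < 1 \<Longrightarrow> summable (\<lambda>n. c n * z ^ n)" "\<bar>z\<bar> < 1"
  shows "summable (\<lambda>n. diffs c n * z ^ n)"
  using termdiff_converges[of z 1 c] assms by simp

lemma DERIV_ser_G: "\<bar>z\<bar> < 1 \<Longrightarrow> (ser_G has_real_derivative ser_G' z) (at z)"
  unfolding ser_G_def[abs_def] ser_G'_def
  by (rule termdiffs_strong'[where K=1]) (simp_all add: summable_coeff_G)

lemma DERIV_ser_G': "\<bar>z\<bar> < 1 \<Longrightarrow> (ser_G' has_real_derivative ser_G'' z) (at z)"
  unfolding ser_G'_def[abs_def] ser_G''_def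
  by (rule termdiffs_strong'[where K=1]) (simp_all add: summable_coeff_G summable_diffs)

text \<open>Multiplying the nth coefficient by n is the Euler operator z d/dz; this translates the
  coefficient recurrence into a differential equation.\<close>

lemma sums_of_nat_mult:
  fixes f :: "nat \<Rightarrow> real"
  assumes "(\<lambda>n. diffs f n * z ^ n) sums d"
  shows "(\<lambda>n. real n * f n * z ^ n) sums (z * d)"
proof -
  have "(\<lambda>n. z * (diffs f n * z ^ n)) sums (z * d)" using assms by (rule sums_mult)
  then have "(\<lambda>n. real (Suc n) * f (Suc n) * z ^ Suc n) sums (z * d)"
    by (rule back_subst[of "\<lambda>f. f sums _"]) (simp add: fun_eq_iff diffs_def)
  then show ?thesis by (subst (asm) sums_Suc_iff) simp
qed

lemma ser_G_sums_all:
  assumes "\<bar>z\<bar> < 1"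
  shows "(\<lambda>n. coeff_G n * z ^ n) sums ser_G z"
    and "(\<lambda>n. diffs coeff_G n * z ^ n) sums ser_G' z"
    and "(\<lambda>n. real n * coeff_G n * z ^ n) sums (z * ser_G' z)"
    and "(\<lambda>n. real n * diffs coeff_G n * z ^ n) sums (z * ser_G'' z)"
    and "(\<lambda>n. real n * (real n * coeff_G n) * z ^ n) sums (z * (z * ser_G'' z + ser_G' z))"
proof -
  show 1: "(\<lambda>n. coeff_G n * z ^ n) sums ser_G z"
    unfolding ser_G_def by (intro summable_sums summable_coeff_G assms)
  show 2: "(\<lambda>n. diffs coeff_G n * z ^ n) sums ser_G' z"
    unfolding ser_G'_def by (intro summable_sums summable_diffs summable_coeff_G assms)
  show "(\<lambda>n. real n * coeff_G n * z ^ n) sums (z * ser_G' z)"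
    by (rule sums_of_nat_mult[OF 2])
  have "(\<lambda>n. diffs (diffs coeff_G) n * z ^ n) sums ser_G'' z"
    unfolding ser_G''_def by (intro summable_sums summable_diffs summable_coeff_G assms)
  then show 4: "(\<lambda>n. real n * diffs coeff_G n * z ^ n) sums (z * ser_G'' z)"
    by (rule sums_of_nat_mult)
  show "(\<lambda>n. real n * (real n * coeff_G n) * z ^ n) sums (z * (z * ser_G'' z + ser_G' z))"
  proof (rule sums_of_nat_mult)
    from sums_add[OF 4 2] show "(\<lambda>n. diffs (\<lambda>n. real n * coeff_G n) n * z ^ n) sums (z * ser_G'' z + ser_G' z)"
      by (rule back_subst[of "\<lambda>f. f sums _"]) (simp add: fun_eq_iff diffs_def algebra_simps)
  qed
qed

text \<open>\<open>ser_G\<close> is the hypergeometric function \<open>\<^sub>2F\<^sub>1(-1/2, 3/2; 3; z)\<close>.\<close>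

lemma ser_G_ode:
  assumes z: "\<bar>z\<bar> < 1"
  shows "z * (1 - z) * ser_G'' z = - (3 - 2 * z) * ser_G' z - 3 / 4 * ser_G z"
proof -
  note s = ser_G_sums_all[OF z]
  have "(\<lambda>n. real n * diffs coeff_G n * z ^ n + 3 * (diffs coeff_G n * z ^ n)
       - real n * (real n * coeff_G n) * z ^ n - real n * coeff_G n * z ^ n + 3 / 4 * (coeff_G n * z ^ n)) sums
      (z * ser_G'' z + 3 * ser_G' z - z * (z * ser_G'' z + ser_G' z) - z * ser_G' z + 3 / 4 * ser_G z)"
    by (intro sums_add sums_diff sums_mult s)
  also have "(\<lambda>n. real n * diffs coeff_G n * z ^ n + 3 * (diffs coeff_G n * z ^ n)
       - real n * (real n * coeff_G n) * z ^ n - real n * coeff_G n * z ^ n + 3 / 4 * (coeff_G n * z ^ n)) = (\<lambda>n. 0)"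
  proof
    fix n
    have "real n * diffs coeff_G n * z ^ n + 3 * (diffs coeff_G n * z ^ n)
       - real n * (real n * coeff_G n) * z ^ n - real n * coeff_G n * z ^ n + 3 / 4 * (coeff_G n * z ^ n) =
      ((real n + 1) * (real n + 3) * coeff_G (Suc n) - (n - 1 / 2) * (n + 3 / 2) * coeff_G n) * z ^ n"
      by (simp add: diffs_def algebra_simps)
    also have "\<dots> = 0" unfolding coeff_G_Suc by simp
    finally show "real n * diffs coeff_G n * z ^ n + 3 * (diffs coeff_G n * z ^ n)
       - real n * (real n * coeff_G n) * z ^ n - real n * coeff_G n * z ^ n + 3 / 4 * (coeff_G n * z ^ n) = 0" .
  qed
  finally have "z * ser_G'' z + 3 * ser_G' z - z * (z * ser_G'' z + ser_G' z) - z * ser_G' z + 3 / 4 * ser_G z = 0"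
    using sums_unique2[OF _ sums_zero] by blast
  then show ?thesis by (simp add: algebra_simps)
qed

text \<open>A contiguous relation between 2F1(-1/2, 1/2; 2; z) and 2F1(-1/2, 3/2; 3; z). It holds
  coefficientwise, because the coefficient of \<open>ser_H\<close> and, by the recurrence, the
  relevant multiple of \<open>coeff_G n\<close> are both rational multiples of
  \<open>coeff_G (Suc n)\<close>. It expresses \<open>dens_H\<close> through the same two functions
  that survive differentiation of \<open>profile_G\<close>.\<close>

lemma ser_H_eq:
  assumes z: "\<bar>z\<bar> < 1"
  shows "ser_H z = ser_G z * (1 + z / 4) + (1 - z) * z * ser_G' z / 2"
proof -
  note s = ser_G_sums_all[OF z]
  have h: "- (catalan n * catalan (n + 1) / 16 ^ n) / 8 = coeff_G (Suc n) * (1 + (n + 1) / 2) + coeff_G n * (1 / 4 - n / 2)" for n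
  proof -
    have c: "catalan (n + 2) = (4 * n + 6) / (n + 3) * catalan (n + 1)"
      using catalan_Suc[of "n + 1"] by (simp add: algebra_simps eval_nat_numeral)
    have "coeff_G (Suc n) = (4 * n + 6) / (n + 3) * (- (catalan n * catalan (n + 1) / 16 ^ n) / 8)"
      unfolding coeff_G_def nat.case c by (simp add: mult_ac)
    then have "- (catalan n * catalan (n + 1) / 16 ^ n) / 8 = (n + 3) / (4 * n + 6) * coeff_G (Suc n)"
      by simp
    moreover have "coeff_G n * (1 / 4 - n / 2) = - (n + 1) * (n + 3) / (2 * n + 3) * coeff_G (Suc n)"
    proof -
      have "coeff_G n * (1 / 4 - n / 2) * (n + 3 / 2) = - 1 / 2 * ((n - 1 / 2) * (n + 3 / 2) * coeff_G n)"
        by (simp add: algebra_simps)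
      also have "\<dots> = - 1 / 2 * ((real n + 1) * (real n + 3) * coeff_G (Suc n))"
        unfolding coeff_G_Suc ..
      finally show ?thesis by (simp add: field_simps)
    qed
    ultimately show ?thesis by (simp only:) (simp add: divide_simps, simp add: algebra_simps)
  qed
  have "(\<lambda>n. coeff_G (Suc n) * z ^ Suc n) sums (ser_G z - 1)"
    using s(1) by (subst sums_Suc_iff) (simp add: coeff_G_def)
  moreover have "(\<lambda>n. real (Suc n) * coeff_G (Suc n) * z ^ Suc n) sums (z * ser_G' z)"
    using s(3) by (subst sums_Suc_iff) simp
  moreover note sums_mult[OF s(1), of "z / 4"] sums_mult[OF s(3), of "- z / 2"]
  ultimately have S: "(\<lambda>n. coeff_G (Suc n) * z ^ Suc n + 1 / 2 * (real (Suc n) * coeff_G (Suc n) * z ^ Suc n)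
       + z / 4 * (coeff_G n * z ^ n) + - z / 2 * (real n * coeff_G n * z ^ n)) sums
      ((ser_G z - 1) + 1 / 2 * (z * ser_G' z) + z / 4 * ser_G z + - z / 2 * (z * ser_G' z))"
    by (intro sums_add sums_mult s)
  have E: "(\<lambda>n. coeff_G (Suc n) * z ^ Suc n + 1 / 2 * (real (Suc n) * coeff_G (Suc n) * z ^ Suc n)
       + z / 4 * (coeff_G n * z ^ n) + - z / 2 * (real n * coeff_G n * z ^ n)) =
      (\<lambda>n. - z / 8 * (catalan n * catalan (n + 1) / 16 ^ n * z ^ n))"
  proof
    fix n
    have "coeff_G (Suc n) * z ^ Suc n + 1 / 2 * (real (Suc n) * coeff_G (Suc n) * z ^ Suc n)
       + z / 4 * (coeff_G n * z ^ n) + - z / 2 * (real n * coeff_G n * z ^ n) =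
       (coeff_G (Suc n) * (1 + (n + 1) / 2) + coeff_G n * (1 / 4 - n / 2)) * z ^ Suc n"
      by (simp add: algebra_simps add_divide_distrib)
    also have "\<dots> = - z / 8 * (catalan n * catalan (n + 1) / 16 ^ n * z ^ n)"
      unfolding h[symmetric] by (simp add: mult_ac)
    finally show "coeff_G (Suc n) * z ^ Suc n + 1 / 2 * (real (Suc n) * coeff_G (Suc n) * z ^ Suc n)
       + z / 4 * (coeff_G n * z ^ n) + - z / 2 * (real n * coeff_G n * z ^ n) = - z / 8 * (catalan n * catalan (n + 1) / 16 ^ n * z ^ n)" .
  qed
  have T: "(\<lambda>n. - z / 8 * (catalan n * catalan (n + 1) / 16 ^ n * z ^ n)) sums (ser_H z - 1)"
    using sums_mult[OF summable_sums[OF summable_catalan_mult[OF z, of 1]], of "- z / 8"] by (simp add: ser_H_def)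
  have "ser_H z - 1 = (ser_G z - 1) + 1 / 2 * (z * ser_G' z) + z / 4 * ser_G z + - z / 2 * (z * ser_G' z)"
    by (rule sums_unique2[OF T S[unfolded E]])
  then show ?thesis by (simp add: field_simps)
qed

text \<open>In the variable \<open>y = 4 - \<epsilon>\<close>, \<open>profile_G y\<close> is \<open>dens_G (4 - y) / y ^ 3\<close> and \<open>profile_G'\<close> is \<open>1 / y\<close> times its derivative.\<close>

definition profile_G :: "real \<Rightarrow> real" where
  "profile_G y = (4 - y) ^ 4 * (4 + y) / (512 * pi * y ^ 3) * ser_G (((4 - y) / (4 + y))\<^sup>2)"

definition profile_G' :: "real \<Rightarrow> real" where
  "profile_G' y = (4 - y) ^ 3 / (512 * pi * y ^ 5) *
     (- (2 * y\<^sup>2 + 12 * y + 48) * ser_G (((4 - y) / (4 + y))\<^sup>2) +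
      - 16 * (y * ((4 - y) / (4 + y))\<^sup>2) * ser_G' (((4 - y) / (4 + y))\<^sup>2))"

lemma ratio_bound:
  fixes y :: real
  assumes "y > 0"
  shows "\<bar>((4 - y) / (4 + y))\<^sup>2\<bar> < 1"
proof -
  have "\<bar>(4 - y) / (4 + y)\<bar> < 1" using assms by (simp add: abs_less_iff field_simps)
  then show ?thesis by (simp add: abs_square_less_1)
qed

lemma DERIV_ratio:
  fixes y :: real
  assumes "y > 0"
  shows "((\<lambda>y. ((4 - y) / (4 + y))\<^sup>2) has_real_derivative (- 16 * (4 - y) / (4 + y) ^ 3)) (at y)"
proof -
  have "4 + y \<noteq> 0" using assms by simp
  then show ?thesis
    by (auto intro!: derivative_eq_intros simp: divide_simps power2_eq_square power3_eq_cube) (simp add: algebra_simps)?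
qed

lemma dens_G_eq_profile:
  assumes "0 < y"
  shows "dens_G (4 - y) = y ^ 3 * profile_G y"
proof -
  have "rho (4 - y) = (4 - y) / (4 + y)" by (simp add: rho_def)
  then show ?thesis
    using assms ser_G_eq[OF ratio_bound[OF assms]] by (simp add: dens_G_def profile_G_def power_mult)
qed

text \<open>The polynomial -(2 y^2 + 12 y + 48) comes from differentiating the algebraic prefactor.
  The chain rule contributes -16 (4 - y) / (4 + y)^3, and together with the prefactor (4 - y)^4 (4 +
  y) this is -16 z times (4 - y)^3.\<close>

lemma DERIV_profile_G:
  assumes y: "0 < y"
  shows "(profile_G has_real_derivative (y * profile_G' y)) (at y)"
proof -
  define z where "z = ((4 - y) / (4 + y))\<^sup>2"
  have nz: "4 + y \<noteq> 0" "y \<noteq> 0" using y by auto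
  have 1: "((\<lambda>y. (4 - y) ^ 4 * (4 + y) / (512 * pi * y ^ 3)) has_real_derivative
      ((4 - y) ^ 3 / (512 * pi * y ^ 4) * (- (2 * y\<^sup>2 + 12 * y + 48)))) (at y)"
    using nz by (auto intro!: derivative_eq_intros simp: divide_simps) (simp add: algebra_simps eval_nat_numeral)
  have 2: "((\<lambda>y. ser_G (((4 - y) / (4 + y))\<^sup>2)) has_real_derivative (ser_G' z * (- 16 * (4 - y) / (4 + y) ^ 3))) (at y)"
    unfolding z_def by (rule DERIV_chain2[OF DERIV_ser_G[OF ratio_bound[OF y]] DERIV_ratio[OF y]])
  have z: "z * (4 + y)\<^sup>2 = (4 - y)\<^sup>2" using nz by (simp add: z_def power_divide)
  have "y * profile_G' y = (4 - y) ^ 3 / (512 * pi * y ^ 4) * (- (2 * y\<^sup>2 + 12 * y + 48)) * ser_G z +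
      ser_G' z * (- 16 * (4 - y) / (4 + y) ^ 3) * ((4 - y) ^ 4 * (4 + y) / (512 * pi * y ^ 3))"
  proof -
    have "g * (- 16 * (4 - y) / (4 + y) ^ 3) * ((4 - y) ^ 4 * (4 + y) / (512 * pi * y ^ 3)) =
      (4 - y) ^ 3 / (512 * pi * y ^ 3) * (- 16 * z) * g" for g
      using nz unfolding z_def power_divide
      by (simp add: divide_simps eval_nat_numeral) (simp add: algebra_simps)
    moreover have "y * profile_G' y = (4 - y) ^ 3 / (512 * pi * y ^ 4) * (- (2 * y\<^sup>2 + 12 * y + 48)) * ser_G z +
      (4 - y) ^ 3 / (512 * pi * y ^ 3) * (- 16 * z) * ser_G' z"
      using nz unfolding profile_G'_def z_def[symmetric] by (simp add: divide_simps eval_nat_numeral) (simp add: algebra_simps)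
    ultimately show ?thesis by simp
  qed
  then show ?thesis
    using DERIV_mult[OF 1 2] unfolding profile_G_def[abs_def] z_def by (simp only: mult_ac)
qed

text \<open>This is what the averaging over r demands: an integral from x to 4 of 12 (y^2 - x^2)
  y^(-6) times a function, differentiated as (1/x) d/dx and then d/dx, returns 24 x^(-6) times that
  function. The differential equation eliminates \<open>ser_G''\<close>, after which the
  coefficients of \<open>ser_G\<close> and \<open>ser_G'\<close> are matched separately with
  \<open>ser_H_eq\<close>.\<close>

lemma DERIV_profile_G':
  assumes y: "0 < y"
  shows "(profile_G' has_real_derivative (24 / y ^ 6 * dens_H (4 - y))) (at y)"
proof -
  define z where "z = ((4 - y) / (4 + y))\<^sup>2"
  define z1 where "z1 = - 16 * (4 - y) / (4 + y) ^ 3"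
  define B where "B = (4 - y) ^ 3 / (512 * pi * y ^ 5)"
  define B1 where "B1 = - ((4 - y)\<^sup>2 * (20 - 2 * y)) / (512 * pi * y ^ 6)"
  define a where "a = - (2 * y\<^sup>2 + 12 * y + 48)"
  define a1 where "a1 = - (4 * y + 12)"
  have nz: "4 + y \<noteq> 0" "y \<noteq> 0" using y by auto
  have dz: "((\<lambda>y. ((4 - y) / (4 + y))\<^sup>2) has_real_derivative z1) (at y)"
    unfolding z1_def by (rule DERIV_ratio[OF y])
  have dB: "((\<lambda>y. (4 - y) ^ 3 / (512 * pi * y ^ 5)) has_real_derivative B1) (at y)"
    unfolding B1_def using nz by (auto intro!: derivative_eq_intros simp: divide_simps) (simp add: algebra_simps eval_nat_numeral)
  have da: "((\<lambda>y. - (2 * y\<^sup>2 + 12 * y + 48)) has_real_derivative a1) (at y)"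
    unfolding a1_def by (auto intro!: derivative_eq_intros)
  have db: "((\<lambda>y. - 16 * (y * ((4 - y) / (4 + y))\<^sup>2)) has_real_derivative - 16 * (1 * z + z1 * y)) (at y)"
    unfolding z_def by (intro DERIV_cmult DERIV_mult DERIV_ident dz)
  have dM: "((\<lambda>y. ser_G (((4 - y) / (4 + y))\<^sup>2)) has_real_derivative (ser_G' z * z1)) (at y)"
    unfolding z_def by (rule DERIV_chain2[OF DERIV_ser_G[OF ratio_bound[OF y]] dz])
  have dM1: "((\<lambda>y. ser_G' (((4 - y) / (4 + y))\<^sup>2)) has_real_derivative (ser_G'' z * z1)) (at y)"
    unfolding z_def by (rule DERIV_chain2[OF DERIV_ser_G'[OF ratio_bound[OF y]] dz])
  have D: "(profile_G' has_real_derivative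
      B1 * (a * ser_G z + - 16 * (y * z) * ser_G' z) +
      ((a1 * ser_G z + ser_G' z * z1 * a) + (- 16 * (1 * z + z1 * y) * ser_G' z + ser_G'' z * z1 * (- 16 * (y * z)))) * B) (at y)"
    unfolding profile_G'_def[abs_def]
    using DERIV_mult[OF dB DERIV_add[OF DERIV_mult[OF da dM] DERIV_mult[OF db dM1]]]
    unfolding z_def[symmetric] a_def[symmetric] B_def[symmetric] .
  \<comment> \<open>With p standing for the reciprocal of 4 + y, the remaining identities become
    polynomial consequences of p (4 + y) = 1 and q = (4 - y) p; c collects the common
    factor.\<close>
  define p where "p = 1 / (4 + y)"
  define q where "q = (4 - y) / (4 + y)"
  define c where "c = (4 - y)\<^sup>2 / (512 * pi * y ^ 6)"
  have p: "p * (4 + y) = 1" using nz by (simp add: p_def)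
  have q: "q = (4 - y) * p" by (simp add: q_def p_def)
  have zq: "z = q\<^sup>2" by (simp add: z_def q_def)
  have z1p: "z1 = - 16 * (4 - y) * p ^ 3" by (simp add: z1_def p_def power_divide)
  have Bc: "B = c * (4 - y) * y"
    using nz by (simp add: B_def c_def) (simp add: eval_nat_numeral)
  have B1c: "B1 = - c * (20 - 2 * y)"
    by (simp add: B1_def c_def)
  have Kc: "3 / (8 * pi * y ^ 6) * ((4 - y)\<^sup>2 * (4 + y)) = 192 * c * (4 + y)"
    by (simp add: c_def)
  \<comment> \<open>Since (4 + y)^2 - (4 - y)^2 = 16 y, one has 1 - z = 16 y p^2. Hence the
    coefficient of \<open>ser_G''\<close> contains z (1 - z), exactly the leading coefficient of the
    differential equation.\<close>
  have z1: "z1 * (- 16 * (y * z)) = 16 * q * (z * (1 - z))"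
  proof -
    have "(- 16 * v * p ^ 3) * (- 16 * (y * (v * p)\<^sup>2)) = 16 * (v * p) * ((v * p)\<^sup>2 * (1 - (v * p)\<^sup>2))"
      if "v = 4 - y" for v using p that by algebra
    from this[OF refl] show ?thesis unfolding z1p zq q .
  qed
  have M2: "ser_G'' z * z1 * (- 16 * (y * z)) = 16 * q * (- (3 - 2 * z) * ser_G' z - 3 / 4 * ser_G z)"
  proof -
    have "ser_G'' z * z1 * (- 16 * (y * z)) = 16 * q * (z * (1 - z) * ser_G'' z)"
      unfolding mult.assoc[of _ z1] z1 by simp
    also have "z * (1 - z) * ser_G'' z = - (3 - 2 * z) * ser_G' z - 3 / 4 * ser_G z"
      unfolding z_def by (rule ser_G_ode[OF ratio_bound[OF y]])
    finally show ?thesis .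
  qed
  have c0: "B1 * a + B * a1 - 12 * B * q = 192 * c * (4 + y) * (1 + z / 4)"
  proof -
    have "(20 - 2 * y) * (2 * y\<^sup>2 + 12 * y + 48) - (4 - y) * y * (4 * y + 12) - 12 * ((4 - y) * y) * q = 192 * (4 + y) + 48 * (4 + y) * q\<^sup>2"
      using p q by algebra
    from arg_cong[OF this, of "\<lambda>t. c * t"] have "c * ((20 - 2 * y) * (2 * y\<^sup>2 + 12 * y + 48) - (4 - y) * y * (4 * y + 12) - 12 * ((4 - y) * y) * q) =
        c * (192 * (4 + y) + 48 * (4 + y) * q\<^sup>2)" .
    then show ?thesis unfolding B1c Bc a_def a1_def zq by (simp add: algebra_simps)
  qed
  have c1: "B1 * (- 16 * (y * z)) + B * (a * z1 - 16 * (z + y * z1) - 16 * q * (3 - 2 * z)) =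
      192 * c * (4 + y) * ((1 - z) * z / 2)"
  proof -
    have "16 * (20 - 2 * y) * (y * q\<^sup>2) + (4 - y) * y * ((2 * y\<^sup>2 + 12 * y + 48) * (16 * (4 - y) * p ^ 3)
        - 16 * (q\<^sup>2 - 16 * y * ((4 - y) * p ^ 3)) - 16 * q * (3 - 2 * q\<^sup>2)) = 96 * (4 + y) * ((1 - q\<^sup>2) * q\<^sup>2)"
      using p q by algebra
    from arg_cong[OF this, of "\<lambda>t. c * t"] have "c * (16 * (20 - 2 * y) * (y * q\<^sup>2) + (4 - y) * y * ((2 * y\<^sup>2 + 12 * y + 48) * (16 * (4 - y) * p ^ 3)
        - 16 * (q\<^sup>2 - 16 * y * ((4 - y) * p ^ 3)) - 16 * q * (3 - 2 * q\<^sup>2))) = c * (96 * (4 + y) * ((1 - q\<^sup>2) * q\<^sup>2))" .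
    moreover have "192 * c * (4 + y) * ((1 - z) * z / 2) = c * (96 * (4 + y) * ((1 - q\<^sup>2) * q\<^sup>2))"
      by (simp add: zq)
    ultimately show ?thesis unfolding B1c Bc a_def z1p zq
      by (simp only:) (simp add: algebra_simps power2_eq_square power3_eq_cube)
  qed
  have "B1 * (a * ser_G z + - 16 * (y * z) * ser_G' z) +
      ((a1 * ser_G z + ser_G' z * z1 * a) + (- 16 * (1 * z + z1 * y) * ser_G' z + ser_G'' z * z1 * (- 16 * (y * z)))) * B =
     (B1 * a + B * a1 - 12 * B * q) * ser_G z +
     (B1 * (- 16 * (y * z)) + B * (a * z1 - 16 * (z + y * z1) - 16 * q * (3 - 2 * z))) * ser_G' z"
    unfolding M2 by (simp add: algebra_simps)
  also have "\<dots> = 3 / (8 * pi * y ^ 6) * ((4 - y)\<^sup>2 * (4 + y)) * (ser_G z * (1 + z / 4) + (1 - z) * z * ser_G' z / 2)"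
  proof -
    have "K * s * g + K * (t / 2) * g' = K * (g * s + t * g' / 2)" for K s t g g' :: real
      by (simp add: algebra_simps)
    then show ?thesis unfolding c0 c1 Kc .
  qed
  also have "\<dots> = 3 / (8 * pi * y ^ 6) * ((4 - y)\<^sup>2 * (4 + y)) * ser_H z"
    unfolding z_def ser_H_eq[OF ratio_bound[OF y]] ..
  also have "\<dots> = 24 / y ^ 6 * dens_H (4 - y)"
    using nz unfolding dens_H_eq rho_def z_def by (simp add: divide_simps)
  finally show ?thesis using D by (rule back_subst[rotated, where P="\<lambda>d. (profile_G' has_real_derivative d) (at y)"])
qed

text \<open>The weight is the density \<open>12 * r ^ 3 * (1 - r^2)\<close> of r times the Jacobian
  1 / r of the rescaling, and the lower limit is where the argument of \<open>dens_H\<close> reaches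
  0. The integral is evaluated by the fundamental theorem; nonnegativity of the integrand comes from
  \<open>dens_H_nonneg\<close>.\<close>

lemma dens_G_as_mixture:
  assumes e: "0 < e" "e < 4"
  shows "(\<integral>\<^sup>+r. ennreal (12 * r\<^sup>2 * (1 - r\<^sup>2) * dens_H (4 - (4 - e) / r)) * indicator {(4 - e) / 4..1} r \<partial>lborel) = ennreal (dens_G e)"
proof -
  define x where "x = 4 - e"
  have x: "0 < x" "x < 4" using e by (auto simp: x_def)
  \<comment> \<open>With \<open>y = x / r\<close>, the function \<open>(y\<^sup>2 - x\<^sup>2) / 2 * profile_G' y - profile_G y\<close> has derivative
    \<open>(y\<^sup>2 - x\<^sup>2) / 2\<close> times that of \<open>profile_G'\<close>, i.e. the integrand up to the factor \<open>dy/dr\<close>; it vanishes at \<open>y = 4\<close>.\<close>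
  define F where "F r = - (x ^ 3) * (((x / r)\<^sup>2 - x\<^sup>2) / 2 * profile_G' (x / r) - profile_G (x / r))" for r
  have dF: "(F has_real_derivative 12 * r\<^sup>2 * (1 - r\<^sup>2) * dens_H (4 - x / r)) (at r)" if r: "r > 0" for r
  proof -
    define y where "y = x / r"
    have y: "y > 0" using x r by (simp add: y_def)
    have dy: "((\<lambda>r. x / r) has_real_derivative (- x / r\<^sup>2)) (at r)"
      using r by (auto intro!: derivative_eq_intros simp: power2_eq_square)
    have "((\<lambda>y. (y\<^sup>2 - x\<^sup>2) / 2 * profile_G' y - profile_G y) has_real_derivative
        (y * profile_G' y + 24 / y ^ 6 * dens_H (4 - y) * ((y\<^sup>2 - x\<^sup>2) / 2) - y * profile_G' y)) (at y)"
      by (intro DERIV_diff DERIV_mult DERIV_profile_G DERIV_profile_G' y) (auto intro!: derivative_eq_intros)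
    then have "((\<lambda>y. (y\<^sup>2 - x\<^sup>2) / 2 * profile_G' y - profile_G y) has_real_derivative
        (24 / y ^ 6 * dens_H (4 - y) * ((y\<^sup>2 - x\<^sup>2) / 2))) (at (x / r))" by (simp add: y_def)
    from DERIV_cmult[OF DERIV_chain2[OF this dy], of "- (x ^ 3)"]
    have "(F has_real_derivative - (x ^ 3) * (24 / y ^ 6 * dens_H (4 - y) * ((y\<^sup>2 - x\<^sup>2) / 2) * (- x / r\<^sup>2))) (at r)"
      unfolding F_def[abs_def] .
    also have "- (x ^ 3) * (24 / y ^ 6 * dens_H (4 - y) * ((y\<^sup>2 - x\<^sup>2) / 2) * (- x / r\<^sup>2)) =
        12 * r\<^sup>2 * (1 - r\<^sup>2) * dens_H (4 - y)"
    proof -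
      have "- (x ^ 3) * (24 / y ^ 6 * d * ((y\<^sup>2 - x\<^sup>2) / 2) * (- x / r\<^sup>2)) = 12 * r\<^sup>2 * (1 - r\<^sup>2) * d" for d
        unfolding y_def using x r by (simp add: divide_simps) (simp add: algebra_simps eval_nat_numeral)
      then show ?thesis .
    qed
    finally show ?thesis by (simp add: y_def)
  qed
  have "(\<integral>\<^sup>+r. ennreal (12 * r\<^sup>2 * (1 - r\<^sup>2) * dens_H (4 - x / r)) * indicator {x / 4..1} r \<partial>lborel) = ennreal (F 1 - F (x / 4))"
  proof (rule nn_integral_FTC_Icc)
    fix r assume "r \<in> {x / 4..1}"
    then have r: "x / 4 \<le> r" "r \<le> 1" by auto
    then have r0: "r > 0" using x by linarith
    show "(F has_real_derivative 12 * r\<^sup>2 * (1 - r\<^sup>2) * dens_H (4 - x / r)) (at r)" by (rule dF[OF r0])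
    have "0 \<le> dens_H (4 - x / r)"
      using r r0 x by (intro dens_H_nonneg) (auto simp: field_simps)
    then show "0 \<le> 12 * r\<^sup>2 * (1 - r\<^sup>2) * dens_H (4 - x / r)"
      using r r0 by (intro mult_nonneg_nonneg) (auto simp: power_le_one)
  qed (use x in auto)
  \<comment> \<open>At r = 1 the factor multiplying \<open>profile_G'\<close> vanishes, so only x^3
    times \<open>profile_G x\<close> is left.\<close>
  also have "F 1 = dens_G e"
    using dens_G_eq_profile[OF x(1)] by (simp add: F_def x_def)
  also have "F (x / 4) = 0"
  proof -
    have "x / (x / 4) = 4" using x by simp
    then show ?thesis unfolding F_def by (simp add: profile_G_def profile_G'_def)
  qed
  finally show ?thesis by (simp add: x_def)
qed

text \<open>For fixed r the substitution of 4 - (4 - e) / r for the variable of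
  \<open>dens_H\<close> moves the indicator of A to e itself. Exchanging the integrals then leaves,
  at each e in A, the average already computed.\<close>

lemma emeasure_mu_G_density:
  assumes [measurable]: "A \<in> sets borel" and A: "A \<subseteq> {0<..<4}"
  shows "emeasure mu_G A = (\<integral>\<^sup>+e. ennreal (dens_G e) * indicator A e \<partial>lborel)"
proof -
  let ?D = "\<lambda>r e. ennreal (12 * r\<^sup>2 * (1 - r\<^sup>2) * dens_H (4 - (4 - e) / r)) * indicator {(4 - e) / 4..1} r * indicator A e"
  have "emeasure mu_G A = (\<integral>\<^sup>+r. \<integral>\<^sup>+e. ?D r e \<partial>lborel \<partial>lborel)"
    unfolding emeasure_mu_G[OF assms(1)]
  proof (intro nn_integral_cong_AE, use AE_lborel_singleton[of 0] in eventually_elim)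
    fix r :: real assume "r \<noteq> 0"
    show "ennreal (12 * r ^ 3 * (1 - r\<^sup>2)) * indicator {0..1} r * emeasure mu_H {e. r * (e - 4) + 4 \<in> A} = (\<integral>\<^sup>+e. ?D r e \<partial>lborel)"
    proof (cases "r \<in> {0..1}")
      case False
      \<comment> \<open>On A one has e < 4, so the lower limit (4 - e) / 4 is positive and excludes
        negative r.\<close>
      have "?D r e = 0" for e
        using False A by (auto simp: indicator_def)
      then have "(\<integral>\<^sup>+e. ?D r e \<partial>lborel) = (\<integral>\<^sup>+e. 0 \<partial>(lborel :: real measure))" by (simp only:)
      also have "\<dots> = ennreal (12 * r ^ 3 * (1 - r\<^sup>2)) * indicator {0..1} r * emeasure mu_H {e. r * (e - 4) + 4 \<in> A}"
        using False by simp
      finally show ?thesis ..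
    next
      case True
      then have r: "0 < r" "r \<le> 1" using \<open>r \<noteq> 0\<close> by auto
      have sub: "{e. r * (e - 4) + 4 \<in> A} \<subseteq> {..<4}"
      proof
        fix e assume "e \<in> {e. r * (e - 4) + 4 \<in> A}"
        then have "r * (e - 4) + 4 \<in> {0<..<4}" using A by blast
        then have "r * (e - 4) < 0" by simp
        then show "e \<in> {..<4}" using r by (simp add: mult_less_0_iff)
      qed
      have "emeasure mu_H {e. r * (e - 4) + 4 \<in> A} =
          (\<integral>\<^sup>+e. ennreal (dens_H e) * indicator {0<..} e * indicator A (r * (e - 4) + 4) \<partial>lborel)"
        by (subst emeasure_mu_H_density[OF _ sub]) (auto intro!: nn_integral_cong simp: indicator_def)
      also have "\<dots> = ennreal (1 / r) * (\<integral>\<^sup>+e. ennreal (dens_H (4 - 4 / r + 1 / r * e)) * indicator {0<..} (4 - 4 / r + 1 / r * e) *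
          indicator A (r * ((4 - 4 / r + 1 / r * e) - 4) + 4) \<partial>lborel)"
        using r by (subst nn_integral_real_affine[where c="1 / r" and t="4 - 4 / r"]) simp_all
      finally have E: "emeasure mu_H {e. r * (e - 4) + 4 \<in> A} = \<dots>" .
      have "ennreal (12 * r ^ 3 * (1 - r\<^sup>2)) * indicator {0..1} r * emeasure mu_H {e. r * (e - 4) + 4 \<in> A} =
          (\<integral>\<^sup>+e. ennreal (12 * r ^ 3 * (1 - r\<^sup>2)) * ennreal (1 / r) * (ennreal (dens_H (4 - 4 / r + 1 / r * e)) * indicator {0<..} (4 - 4 / r + 1 / r * e) *
          indicator A (r * ((4 - 4 / r + 1 / r * e) - 4) + 4)) \<partial>lborel)"
        unfolding E using True by (subst nn_integral_cmult) (simp_all add: mult.assoc)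
      also have "\<dots> = (\<integral>\<^sup>+e. ?D r e \<partial>lborel)"
      \<comment> \<open>At e = 4 - 4 r the argument of \<open>dens_H\<close> is 0; this is the only
        point where the strict condition on one side and the closed interval on the other
        disagree.\<close>
      proof (intro nn_integral_cong_AE, use AE_lborel_singleton[of "4 - 4 * r"] in eventually_elim)
        fix e :: real assume ne: "e \<noteq> 4 - 4 * r"
        have 1: "4 - 4 / r + 1 / r * e = 4 - (4 - e) / r" by (simp add: diff_divide_distrib)
        have 2: "r * ((4 - (4 - e) / r) - 4) + 4 = e" using r by (simp add: field_simps)
        have 3: "0 < 4 - (4 - e) / r \<longleftrightarrow> (4 - e) / 4 \<le> r" using r ne by (auto simp: field_simps)
        have 4: "ennreal (12 * r ^ 3 * (1 - r\<^sup>2)) * ennreal (1 / r) = ennreal (12 * r\<^sup>2 * (1 - r\<^sup>2))"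
          using r by (subst ennreal_mult'[symmetric]) (auto simp: power2_eq_square power3_eq_cube mult_le_one)
        have 5: "0 \<le> 12 * r\<^sup>2 * (1 - r\<^sup>2)" using r by (simp add: power_le_one)
        show "ennreal (12 * r ^ 3 * (1 - r\<^sup>2)) * ennreal (1 / r) * (ennreal (dens_H (4 - 4 / r + 1 / r * e)) * indicator {0<..} (4 - 4 / r + 1 / r * e) *
          indicator A (r * ((4 - 4 / r + 1 / r * e) - 4) + 4)) = ?D r e"
          unfolding 1 2 4 ennreal_mult'[OF 5]
          using 3 r by (simp add: indicator_def)
      qed
      finally show ?thesis .
    qed
  qed
  also have "\<dots> = (\<integral>\<^sup>+e. \<integral>\<^sup>+r. ?D r e \<partial>lborel \<partial>lborel)"
  proof (rule lborel_pair.Fubini'[symmetric])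
    have eq: "(\<lambda>(r, e). ?D r e) = (\<lambda>p. ennreal (12 * (fst p)\<^sup>2 * (1 - (fst p)\<^sup>2) * dens_H (4 - (4 - snd p) / fst p)) *
        (if (4 - snd p) / 4 \<le> fst p \<and> fst p \<le> 1 then 1 else 0) * indicator A (snd p))"
      by (auto simp: fun_eq_iff)
    show "(\<lambda>(r, e). ?D r e) \<in> borel_measurable (lborel \<Otimes>\<^sub>M lborel)"
      unfolding eq by measurable
  qed
  also have "\<dots> = (\<integral>\<^sup>+e. ennreal (dens_G e) * indicator A e \<partial>lborel)"
  proof (rule nn_integral_cong)
    fix e :: real
    show "(\<integral>\<^sup>+r. ?D r e \<partial>lborel) = ennreal (dens_G e) * indicator A e"
    proof (cases "e \<in> A")
      case True
      then have e: "0 < e" "e < 4" using A by auto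
      show ?thesis using True by (simp add: dens_G_as_mixture[OF e])
    qed simp
  qed
  finally show ?thesis .
qed

theorem theorem9:
  shows "\<exists>\<delta>>0. \<forall>A \<in> sets borel. A \<subseteq> {0<..<\<delta>} \<longrightarrow>
           emeasure mu_G A = (\<integral>\<^sup>+ e. ennreal (dens_G e) * indicator A e \<partial>lborel) \<and>
           emeasure mu_H A = (\<integral>\<^sup>+ e. ennreal (dens_H e) * indicator A e \<partial>lborel)"
\<comment> \<open>The neighbourhood can be taken as large as 4, since 0 < e < 4 gives 0 < rho < 1,
  where both Catalan series converge.\<close>
proof (intro exI[of _ 4] conjI ballI impI)
  fix A :: "real set" assume A: "A \<in> sets borel" "A \<subseteq> {0<..<4}"
  show "emeasure mu_G A = (\<integral>\<^sup>+ e. ennreal (dens_G e) * indicator A e \<partial>lborel)"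
    by (rule emeasure_mu_G_density[OF A])
  have "emeasure mu_H A = (\<integral>\<^sup>+e. ennreal (dens_H e) * indicator {0<..} e * indicator A e \<partial>lborel)"
    by (rule emeasure_mu_H_density) (use A in auto)
  also have "\<dots> = (\<integral>\<^sup>+ e. ennreal (dens_H e) * indicator A e \<partial>lborel)"
    using A by (intro nn_integral_cong) (auto simp: indicator_def)
  finally show "emeasure mu_H A = (\<integral>\<^sup>+ e. ennreal (dens_H e) * indicator A e \<partial>lborel)" .
qed simp

end
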